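(* Let $r\ge 1$ be an integer and let $\mathbf z=(z_1,\dots,z_r)\in\mathbb C^r$ be such that every $z_i$ is a root of unity. Let $\mathbf a=(a_1,\dots,a_r)\in\mathbb Z^r\cap\overline{U_r(\mathbf z)}$. Then the power series $$\sum_{k_1,\dots,k_r\ge 0}\frac{(-1)^{k_1+\cdots+k_r}}{k_1!\cdots k_r!}\,\ell^{(a_1,\dots,a_r)}_{[k_1,\dots,k_r]}(\mathbf z)\,(s_1-a_1)^{k_1}\cdots(s_r-a_r)^{k_r}$$ converges in a neighbourhood of $\mathbf a$ and extends to a meromorphic function on $\mathbb C^r$. Moreover, denoting this meromorphic function by $\mathrm{Li}^{\mathrm{Reg}}_{(\mathbf z;\mathbf a)}(s_1,\dots,s_r)$, we have the following equality of meromorphic functions on $\mathbb C^r$: $$\mathrm{Li}^{\mathrm{Reg}}_{(\mathbf z;\mathbf a)}(s_1,\dots,s_r)=\sum_{i\in\mathcal I(\mathbf z,\mathbf a)}(-1)^i\,\frac{\mathrm{Li}_{(z_{i+1},\dots,z_r)}(s_{i+1},\dots,s_r)}{\prod_{1\le j\le i}H^{(i)}_j(s_j,\dots,s_i;z_{[t_i,i]})}.$$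
   Context: Notation: $\mathbb N$ denotes the non-negative integers; $z_{[j,i]}:=\prod_{k=j}^i z_k$ for $1\le j\le i\le r$. Multiple polylogarithm: for roots of unity $w_1,\dots,w_d$, $\mathrm{Li}_{(w_1,\dots,w_d)}(s_1,\dots,s_d):=\sum_{n_1>\cdots>n_d>0}\frac{w_1^{n_1}\cdots w_d^{n_d}}{n_1^{s_1}\cdots n_d^{s_d}}$, holomorphic on $\{\Re(s_1+\cdots+s_i)>i,\ 1\le i\le d\}$; it is known to extend to a meromorphic function on $\mathbb C^d$, and this continuation is what is meant. The depth-$0$ function (case $i=r$) is the constant $1$. Empty products equal $1$. The domain $U_r(\mathbf z)$: let $q(\mathbf z)$ be the smallest index $1\le q\le r$ with $z_q\ne 1$ (and $q(\mathbf z)=r+1$ if there is none). Then $U_r(\mathbf z)=\{(s_1,\dots,s_r)\in\mathbb C^r:\Re(s_1+\cdots+s_i)>i\text{ if }1\le i<q(\mathbf z),\ \Re(s_1+\cdots+s_i)>i-1\text{ if }q(\mathbf z)\le i\le r\}$, and $\overline{U_r(\mathbf z)}$ is its closure. Regularised values: let $\mathcal C_{\mathbf z}$ be the $\mathbb C$-algebra of complex sequences generated by the constant sequence $(1)_{n\ge1}$ and the sequences $(z_i^n)_{n\ge1}$, $1\le i\le r$. It has the basis $\mathcal B_{\mathbf z}$ consisting of the sequences $(\xi^n)_{n\ge1}$, where $\xi$ runs over the distinct values of the monomials $z_1^{k_1}\cdots z_r^{k_r}$ ($k_i\in\mathbb N$). For $\mathbf a\in\mathbb Z^r$ and $\mathbf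 k=(k_1,\dots,k_r)\in\mathbb N^r$, the partial sums $S_N=\sum_{N>n_1>\cdots>n_r>0}\frac{z_1^{n_1}(\log n_1)^{k_1}\cdots z_r^{n_r}(\log n_r)^{k_r}}{n_1^{a_1}\cdots n_r^{a_r}}$ admit, as $N\to\infty$, an expansion $S_N=\sum_{(l,m)\in F}u_{l,m}(N)(\log N)^lN^m+o(1)$ with $F\subset\mathbb N\times\mathbb N$ finite and $u_{l,m}\in\mathcal C_{\mathbf z}$ (uniquely determined). The regularised value $\ell^{(a_1,\dots,a_r)}_{[k_1,\dots,k_r]}(\mathbf z)$ is the coefficient of the constant sequence $(1)_{n\ge1}$ in the expansion of $u_{0,0}$ in the basis $\mathcal B_{\mathbf z}$ (i.e. the constant part of $S_N$, discarding divergent, bounded oscillating and vanishing parts). Index set: let $a(\mathbf z)_0:=0$ and for $1\le i\le r$, $a(\mathbf z)_i:=0$ if $z_j=1$ for all $1\le j\le i$ and $a(\mathbf z)_i:=1$ otherwise. $\mathcal I(\mathbf z,\mathbf a)$ is the set of integers $0\le i\le r$ such that (I) $z_{[1,i]}=1$; (II) there is at most one integer $t$ with $1\le t\le i$ and $z_{[t,i]}\ne1$; (III) $a_1+\cdots+a_i=i-a(\mathbf z)_i$. In particular $0\in\mathcal I(\mathbf z,\mathbf a)$. For $i\in\mathcal I(\mathbf z,\mathbf a)$, $t_i$ denotes the unique integer $1\le t_i\le i$ with $z_{[t_i,i]}\ne1$ if it exists, and $t_i:=0$ otherwise. For $1\le i$ in $\mathcal I(\mathbf z,\mathbf a)$ and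 $1\le j\le i$: $H^{(i)}_j(s_j,\dots,s_i;z_{[t_i,i]}):=s_j+\cdots+s_i-(i-j)$ if $1\le j<t_i$; $:=1-z_{[t_i,i]}$ if $j=t_i$; $:=s_j+\cdots+s_i-(i-j+1)$ if $t_i<j\le i$. *)

theory Defs
  imports "HOL-Analysis.Analysis"
begin

text \<open>Conventions. Points of C^d are complex lists of length d; list position j-1
  holds the paper's coordinate with index j (1-based). Topology on C^d is given by
  polydiscs (equivalent to the standard one).\<close>

definition root_of_unity :: "complex \<Rightarrow> bool" where
  "root_of_unity x \<longleftrightarrow> (\<exists>n>0. x ^ n = 1)"

definition polydisc :: "complex list \<Rightarrow> real \<Rightarrow> complex list set" where
  "polydisc p e = {q. length q = length p \<and> (\<forall>j<length p. cmod (q ! j - p ! j) < e)}"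

definition pd_closure :: "complex list set \<Rightarrow> complex list \<Rightarrow> bool" where
  "pd_closure A p \<longleftrightarrow> (\<forall>e>0. \<exists>q\<in>A. q \<in> polydisc p e)"

text \<open>Holomorphic in several variables: continuous and holomorphic in each variable
  separately (equivalent by Osgood's lemma).\<close>
definition holo_on :: "complex list set \<Rightarrow> (complex list \<Rightarrow> complex) \<Rightarrow> bool" where
  "holo_on U f \<longleftrightarrow>
     (\<forall>p\<in>U. \<forall>e>0. \<exists>d>0. \<forall>q\<in>U \<inter> polydisc p d. cmod (f q - f p) < e) \<and>
     (\<forall>p\<in>U. \<forall>j<length p. (\<lambda>w. f (p[j := w])) field_differentiable (at (p ! j)))"

definition meromorphic :: "nat \<Rightarrow> (complex list \<Rightarrow> complex) \<Rightarrow> bool" where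
  "meromorphic d f \<longleftrightarrow>
     (\<forall>p. length p = d \<longrightarrow>
        (\<exists>e>0. \<exists>g h. holo_on (polydisc p e) g \<and> holo_on (polydisc p e) h \<and>
            (\<exists>q\<in>polydisc p e. h q \<noteq> 0) \<and>
            (\<forall>q\<in>polydisc p e. h q \<noteq> 0 \<longrightarrow> f q = g q / h q)))"

definition mero_eq :: "nat \<Rightarrow> (complex list \<Rightarrow> complex) \<Rightarrow> (complex list \<Rightarrow> complex) \<Rightarrow> bool" where
  "mero_eq d f g \<longleftrightarrow>
     (\<forall>p e. length p = d \<longrightarrow> e > 0 \<longrightarrow> (\<exists>q\<in>polydisc p e. f q = g q))"

definition Li_series :: "complex list \<Rightarrow> complex list \<Rightarrow> complex" where
  "Li_series w s = infsum (\<lambda>ns. \<Prod>j<length w. w ! j ^ (ns ! j) / of_nat (ns ! j) powr (s ! j))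
     {ns. length ns = length w \<and> sorted_wrt (\<lambda>x y. x > y) ns \<and> (\<forall>n\<in>set ns. 0 < n)}"

definition Li_conv_dom :: "complex list \<Rightarrow> complex list set" where
  "Li_conv_dom w = {s. length s = length w \<and>
     (\<forall>i\<in>{1..length w}. Re (\<Sum>j=1..i. s ! (j - 1)) > real i)}"

definition qidx :: "complex list \<Rightarrow> nat" where
  "qidx z = (if \<exists>q\<in>{1..length z}. z ! (q - 1) \<noteq> 1
             then (LEAST q. 1 \<le> q \<and> q \<le> length z \<and> z ! (q - 1) \<noteq> 1)
             else length z + 1)"

definition U_dom :: "complex list \<Rightarrow> complex list set" where
  "U_dom z = {s. length s = length z \<and>
     (\<forall>i\<in>{1..length z}. (i < qidx z \<longrightarrow> Re (\<Sum>j=1..i. s ! (j - 1)) > real i) \<and>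
                         (qidx z \<le> i \<longrightarrow> Re (\<Sum>j=1..i. s ! (j - 1)) > real i - 1))}"

definition reg_partial :: "complex list \<Rightarrow> int list \<Rightarrow> nat list \<Rightarrow> nat \<Rightarrow> complex" where
  "reg_partial z a k N = (\<Sum>ns\<in>{ns. length ns = length z \<and> sorted_wrt (\<lambda>x y. x > y) ns \<and>
        (\<forall>n\<in>set ns. 0 < n \<and> n < N)}.
      \<Prod>j<length z. z ! j ^ (ns ! j) * (of_real (ln (real (ns ! j)))) ^ (k ! j)
                     / (of_nat (ns ! j)) powi (a ! j))"

definition monomials :: "complex list \<Rightarrow> complex set" where
  "monomials z = {\<xi>. \<exists>ks. length ks = length z \<and> \<xi> = (\<Prod>j<length z. z ! j ^ (ks ! j))}"

definition reg_val :: "complex list \<Rightarrow> int list \<Rightarrow> nat list \<Rightarrow> complex" where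
  "reg_val z a k = (THE c. \<exists>(Lm::nat) (Mm::nat) (coef :: nat \<Rightarrow> nat \<Rightarrow> complex \<Rightarrow> complex).
      (\<lambda>N. reg_partial z a k N -
          (\<Sum>l\<le>Lm. \<Sum>m\<le>Mm. \<Sum>\<xi>\<in>monomials z.
              coef l m \<xi> * \<xi> ^ N * (of_real (ln (real N))) ^ l * (of_nat N) ^ m))
        \<longlonglongrightarrow> 0
      \<and> c = coef 0 0 1)"

definition zprod :: "complex list \<Rightarrow> nat \<Rightarrow> nat \<Rightarrow> complex" where
  "zprod z j i = (\<Prod>k\<in>{j..i}. z ! (k - 1))"

definition aflag :: "complex list \<Rightarrow> nat \<Rightarrow> int" where
  "aflag z i = (if \<forall>j\<in>{1..i}. z ! (j - 1) = 1 then 0 else 1)"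

definition Iset :: "complex list \<Rightarrow> int list \<Rightarrow> nat set" where
  "Iset z a = {i. i \<le> length z \<and> zprod z 1 i = 1 \<and>
      card {t\<in>{1..i}. zprod z t i \<noteq> 1} \<le> 1 \<and>
      (\<Sum>j=1..i. a ! (j - 1)) = int i - aflag z i}"

definition tidx :: "complex list \<Rightarrow> nat \<Rightarrow> nat" where
  "tidx z i = (if \<exists>t\<in>{1..i}. zprod z t i \<noteq> 1
               then (THE t. t \<in> {1..i} \<and> zprod z t i \<noteq> 1) else 0)"

definition Hfun :: "complex list \<Rightarrow> nat \<Rightarrow> nat \<Rightarrow> complex list \<Rightarrow> complex" where
  "Hfun z i j s =
     (if j < tidx z i then (\<Sum>k=j..i. s ! (k - 1)) - of_nat (i - j)
      else if j = tidx z i then 1 - zprod z (tidx z i) i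
      else (\<Sum>k=j..i. s ! (k - 1)) - of_nat (i - j + 1))"

text \<open>Right-hand side, given a family L of (meromorphically continued) polylogarithms.\<close>
definition Li_reg_rhs :: "(complex list \<Rightarrow> complex list \<Rightarrow> complex) \<Rightarrow> complex list \<Rightarrow> int list
     \<Rightarrow> complex list \<Rightarrow> complex" where
  "Li_reg_rhs L z a s = (\<Sum>i\<in>Iset z a.
      (-1) ^ i * L (drop i z) (drop i s) / (\<Prod>j=1..i. Hfun z i j s))"

definition reg_term :: "complex list \<Rightarrow> int list \<Rightarrow> complex list \<Rightarrow> nat list \<Rightarrow> complex" where
  "reg_term z a s k = (-1) ^ sum_list k / of_nat (\<Prod>j<length k. fact (k ! j)) * reg_val z a k *
      (\<Prod>j<length k. (s ! j - of_int (a ! j)) ^ (k ! j))"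

definition multi_idx :: "nat \<Rightarrow> nat list set" where
  "multi_idx r = {k. length k = r}"

end

theory Submission
  imports Defs "HOL-Complex_Analysis.Complex_Analysis"
begin

text \<open>
  Peeling off the outermost summation variable, one proves by induction on the depth that the
  truncated sum \<open>S_N(s)\<close>, for s in a large polydisc, is a finite combination of terms
  \<open>(z_1 ... z_i)^N N^(k - m - (s_1 + ... + s_i))\<close> with \<open>i \<le> r\<close> and \<open>m \<ge> 0\<close>, up to an error \<open>O(N^-M)\<close>. All
  coefficients become holomorphic after multiplication by one product Q of linear forms, and the
  coefficient with \<open>m = 0\<close> is, up to sign, the continued polylogarithm in \<open>s_(i+1), ..., s_r\<close> divided by
  explicit linear factors. At a point a of the closure of \<open>U_dom z\<close> no exponent is positive, so the only
  contributions to the constant term are those with \<open>m = 0\<close> and i in the index set. Hence the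
  regularised Taylor coefficients of \<open>Q S_N\<close> at a are the Taylor coefficients of Q times the right-hand
  side. Dividing by the linear factors of Q one at a time, on the level of coefficients, carries
  existence of the constant terms, geometric bounds and the identity over to \<open>S_N\<close> itself.
  The given continuations L enter only through the identity theorem for meromorphic functions.
\<close>

section \<open>Holomorphic functions on polydiscs\<close>

text \<open>The partial sums are entire in s, but the separate terms of their expansion may have
  poles passing through a that cancel only in total, so at a neither limits nor Taylor coefficients
  can be taken term by term. The factor Q removes these poles, but Q may itself vanish at a and
  cannot be divided out pointwise; this forces the recursions for coefficients.

  Differentiating N^(-s) in s produces powers of ln N. A term whose exponent at a is 0 therefore
  gives a polynomial in ln N, whose constant coefficient is the Taylor coefficient of the term's own
  coefficient function, and it counts only if z_1 ... z_i = 1, since otherwise it oscillates. As a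
  is integral, every other exponent is at most -1 and beats all powers of ln N. So the index set
  collects the i for which exponent and root of unity are both trivial.

  Every new variable costs K + 2 orders of the error: K for the factor n^(-s) on the polydisc of
  radius K, and 2 for the summation. The induction therefore has to run over all M.\<close>

definition pdnhds :: "complex list set \<Rightarrow> complex list \<Rightarrow> complex list filter" where
  "pdnhds U p = (INF d\<in>{0<..}. principal (U \<inter> polydisc p d))"

definition polydisc_open :: "complex list set \<Rightarrow> bool" where
  "polydisc_open U \<longleftrightarrow> (\<forall>p\<in>U. \<exists>d>0. polydisc p d \<subseteq> U)"

lemma polydisc_mono: "d \<le> e \<Longrightarrow> polydisc p d \<subseteq> polydisc p e"
  by (force simp: polydisc_def)

lemma polydisc_center [simp]: "e > 0 \<Longrightarrow> p \<in> polydisc p e"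
  by (simp add: polydisc_def)

lemma polydisc_length: "q \<in> polydisc p e \<Longrightarrow> length q = length p"
  by (simp add: polydisc_def)

lemma polydisc_nth: "q \<in> polydisc p e \<Longrightarrow> j < length p \<Longrightarrow> cmod (q ! j - p ! j) < e"
  by (simp add: polydisc_def)

lemma polydisc_open_polydisc: "polydisc_open (polydisc p e)"
  unfolding polydisc_open_def
proof
  fix q assume q: "q \<in> polydisc p e"
  define d where "d = Min (insert 1 ((\<lambda>j. e - cmod (q ! j - p ! j)) ` {..<length p}))"
  have "d > 0"
    using q by (auto simp: d_def polydisc_def)
  have d: "d \<le> e - cmod (q ! j - p ! j)" if "j < length p" for j
    unfolding d_def by (rule Min_le) (use that in auto)
  have "polydisc q d \<subseteq> polydisc p e"
  proof
    fix s assume s: "s \<in> polydisc q d"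
    have "cmod (s ! j - p ! j) < e" if "j < length p" for j
    proof -
      have "cmod (s ! j - p ! j) \<le> cmod (s ! j - q ! j) + cmod (q ! j - p ! j)"
        using norm_triangle_ineq[of "s ! j - q ! j" "q ! j - p ! j"] by simp
      moreover have "cmod (s ! j - q ! j) < d"
        using s q that by (auto simp: polydisc_def)
      ultimately show ?thesis using d[OF that] by linarith
    qed
    then show "s \<in> polydisc p e"
      using s q by (auto simp: polydisc_def)
  qed
  with \<open>d > 0\<close> show "\<exists>d>0. polydisc q d \<subseteq> polydisc p e" by blast
qed

lemma polydisc_update:
  "q \<in> polydisc p e \<Longrightarrow> cmod (w - p ! j) < e \<Longrightarrow> q[j := w] \<in> polydisc p e"
  by (cases "j < length q") (auto simp: polydisc_def nth_list_update)

lemma polydisc_drop: "q \<in> polydisc p d \<Longrightarrow> drop i q \<in> polydisc (drop i p) d"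
  by (auto simp: polydisc_def)

lemma eventually_pdnhds:
  "eventually P (pdnhds U p) \<longleftrightarrow> (\<exists>d>0. \<forall>q\<in>U \<inter> polydisc p d. P q)"
  unfolding pdnhds_def
proof (subst eventually_INF_base)
  fix a b :: real assume "a \<in> {0<..}" "b \<in> {0<..}"
  then show "\<exists>x\<in>{0<..}. principal (U \<inter> polydisc p x)
      \<le> inf (principal (U \<inter> polydisc p a)) (principal (U \<inter> polydisc p b))"
    using polydisc_mono[of "min a b" a p] polydisc_mono[of "min a b" b p]
    by (intro bexI[of _ "min a b"]) auto
qed (auto simp: eventually_principal)

text \<open>Continuity within \<open>U\<close> becomes a limit along the filter
  \<open>pdnhds U p\<close>, so that the rules for \<open>tendsto\<close> cover sums, products and
  compositions.\<close>

lemma holo_on_iff: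
  "holo_on U f \<longleftrightarrow> (\<forall>p\<in>U. (f \<longlongrightarrow> f p) (pdnhds U p)) \<and>
     (\<forall>p\<in>U. \<forall>j<length p. (\<lambda>w. f (p[j := w])) field_differentiable (at (p ! j)))"
  unfolding holo_on_def tendsto_iff eventually_pdnhds by (simp add: dist_norm)

lemma holo_onD_tendsto: "holo_on U f \<Longrightarrow> p \<in> U \<Longrightarrow> (f \<longlongrightarrow> f p) (pdnhds U p)"
  by (simp add: holo_on_iff)

lemma holo_onD_diff:
  "holo_on U f \<Longrightarrow> p \<in> U \<Longrightarrow> j < length p \<Longrightarrow> (\<lambda>w. f (p[j := w])) field_differentiable (at (p ! j))"
  by (simp add: holo_on_iff)

lemma holo_on_subset:
  assumes "holo_on U f" "V \<subseteq> U" shows "holo_on V f"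
  unfolding holo_on_def
proof (intro conjI ballI allI impI)
  fix p and e :: real assume p: "p \<in> V" and "e > 0"
  then have "p \<in> U" using assms by blast
  then obtain d where "d > 0" "\<forall>q\<in>U \<inter> polydisc p d. cmod (f q - f p) < e"
    using assms(1) \<open>e > 0\<close> unfolding holo_on_def by blast
  then show "\<exists>d>0. \<forall>q\<in>V \<inter> polydisc p d. cmod (f q - f p) < e"
    using assms(2) by blast
qed (use assms in \<open>auto simp: holo_on_def\<close>)

lemma holo_on_const: "holo_on U (\<lambda>s. c)"
  by (simp add: holo_on_iff)

lemma holo_on_coord:
  assumes "\<And>p. p \<in> U \<Longrightarrow> j < length p"
  shows "holo_on U (\<lambda>s. s ! j)"
  unfolding holo_on_iff
proof (intro conjI ballI allI impI)
  fix p assume p: "p \<in> U"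
  show "((\<lambda>s. s ! j) \<longlongrightarrow> p ! j) (pdnhds U p)"
    unfolding tendsto_iff eventually_pdnhds
  proof (intro allI impI)
    fix e :: real assume "e > 0"
    then show "\<exists>d>0. \<forall>q\<in>U \<inter> polydisc p d. dist (q ! j) (p ! j) < e"
      using assms[OF p] by (intro exI[of _ e]) (auto simp: polydisc_def dist_norm)
  qed
  fix i assume i: "i < length p"
  show "(\<lambda>w. p[i := w] ! j) field_differentiable at (p ! i)"
    by (cases "i = j") (use i in \<open>auto simp: field_differentiable_ident\<close>)
qed

lemma holo_on_add: "holo_on U f \<Longrightarrow> holo_on U g \<Longrightarrow> holo_on U (\<lambda>s. f s + g s)"
  unfolding holo_on_iff by (auto intro!: tendsto_add field_differentiable_add)

lemma holo_on_mult: "holo_on U f \<Longrightarrow> holo_on U g \<Longrightarrow> holo_on U (\<lambda>s. f s * g s)"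
  unfolding holo_on_iff by (auto intro!: tendsto_mult field_differentiable_mult)

lemma holo_on_diff: "holo_on U f \<Longrightarrow> holo_on U g \<Longrightarrow> holo_on U (\<lambda>s. f s - g s)"
  unfolding holo_on_iff by (auto intro!: tendsto_diff field_differentiable_diff)

lemma holo_on_uminus: "holo_on U f \<Longrightarrow> holo_on U (\<lambda>s. - f s)"
  using holo_on_diff[OF holo_on_const[of U 0]] by simp

lemma holo_on_sum: "(\<And>i. i \<in> I \<Longrightarrow> holo_on U (f i)) \<Longrightarrow> holo_on U (\<lambda>s. \<Sum>i\<in>I. f i s)"
  by (induction I rule: infinite_finite_induct) (auto intro: holo_on_const holo_on_add)

lemma holo_on_prod: "(\<And>i. i \<in> I \<Longrightarrow> holo_on U (f i)) \<Longrightarrow> holo_on U (\<lambda>s. \<Prod>i\<in>I. f i s)"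
  by (induction I rule: infinite_finite_induct) (auto intro: holo_on_const holo_on_mult)

lemma holo_on_compose:
  assumes f: "holo_on U f" and F: "\<And>x. F field_differentiable at x"
  shows "holo_on U (\<lambda>s. F (f s))"
  unfolding holo_on_iff
proof (intro conjI ballI allI impI)
  fix p assume p: "p \<in> U"
  have "isCont F (f p)"
    using F field_differentiable_imp_continuous_at by blast
  then show "((\<lambda>s. F (f s)) \<longlongrightarrow> F (f p)) (pdnhds U p)"
    using holo_onD_tendsto[OF f p] isCont_tendsto_compose by blast
  fix j assume j: "j < length p"
  have "(F \<circ> (\<lambda>w. f (p[j := w]))) field_differentiable at (p ! j)"
    by (rule field_differentiable_compose[OF holo_onD_diff[OF f p j] F])
  then show "(\<lambda>w. F (f (p[j := w]))) field_differentiable at (p ! j)"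
    by (simp add: o_def)
qed

lemma holo_on_drop:
  assumes f: "holo_on U f" and V: "\<And>s. s \<in> V \<Longrightarrow> drop i s \<in> U"
  shows "holo_on V (\<lambda>s. f (drop i s))"
  unfolding holo_on_def
proof (intro conjI ballI allI impI)
  fix p and e :: real assume p: "p \<in> V" and "e > 0"
  then obtain d where "d > 0" "\<forall>q\<in>U \<inter> polydisc (drop i p) d. cmod (f q - f (drop i p)) < e"
    using f V unfolding holo_on_def by meson
  then show "\<exists>d>0. \<forall>q\<in>V \<inter> polydisc p d. cmod (f (drop i q) - f (drop i p)) < e"
    using V polydisc_drop by (metis Int_iff)
next
  fix p j assume p: "p \<in> V" and j: "j < length p"
  show "(\<lambda>w. f (drop i (p[j := w]))) field_differentiable at (p ! j)"
  proof (cases "j < i")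
    case True then show ?thesis by (simp add: drop_update_cancel)
  next
    case False
    then show ?thesis
      using holo_onD_diff[OF f V[OF p], of "j - i"] j by (simp add: drop_update_swap)
  qed
qed

lemma holo_on_holomorphic:
  assumes f: "holo_on U f" and U: "\<And>w. w \<in> A \<Longrightarrow> p[j := w] \<in> U" and j: "j < length p"
  shows "(\<lambda>w. f (p[j := w])) holomorphic_on A"
  unfolding holomorphic_on_def
proof
  fix w assume w: "w \<in> A"
  have "(\<lambda>v. f ((p[j := w])[j := v])) field_differentiable at (p[j := w] ! j)"
    using holo_onD_diff[OF f U[OF w], of j] j by simp
  then show "(\<lambda>w. f (p[j := w])) field_differentiable at w within A"
    using j by (simp add: field_differentiable_at_within)
qed

lemma holo_on_local:
  assumes "\<And>p. p \<in> U \<Longrightarrow> \<exists>d>0. holo_on (polydisc p d) f"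
  shows "holo_on U f"
  unfolding holo_on_def
proof (intro conjI ballI allI impI)
  fix p and e :: real assume p: "p \<in> U" and "e > 0"
  obtain d where d: "d > 0" "holo_on (polydisc p d) f" using assms[OF p] by blast
  then obtain d' where "d' > 0" "\<forall>q\<in>polydisc p d \<inter> polydisc p d'. cmod (f q - f p) < e"
    using \<open>e > 0\<close> unfolding holo_on_def by (meson polydisc_center)
  then show "\<exists>d>0. \<forall>q\<in>U \<inter> polydisc p d. cmod (f q - f p) < e"
    using d polydisc_mono[of "min d d'" d p] polydisc_mono[of "min d d'" d' p]
    by (intro exI[of _ "min d d'"]) auto
next
  fix p j assume p: "p \<in> U" and j: "j < length p"
  obtain d where d: "d > 0" "holo_on (polydisc p d) f" using assms[OF p] by blast
  then show "(\<lambda>w. f (p[j := w])) field_differentiable at (p ! j)"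
    using holo_onD_diff j polydisc_center by blast
qed

text \<open>Openness serves the derivatives: they depend on values near p, and f and g have to agree
  there too.\<close>

lemma holo_on_cong:
  assumes "holo_on U f" "polydisc_open U" "\<And>s. s \<in> U \<Longrightarrow> f s = g s"
  shows "holo_on U g"
  unfolding holo_on_def
proof (intro conjI ballI allI impI)
  fix p and e :: real assume p: "p \<in> U" and "e > 0"
  then show "\<exists>d>0. \<forall>q\<in>U \<inter> polydisc p d. cmod (g q - g p) < e"
    using assms(1,3) unfolding holo_on_def by (metis IntD1)
next
  fix p j assume p: "p \<in> U" and j: "j < length p"
  obtain d where d: "d > 0" "polydisc p d \<subseteq> U"
    using assms(2) p unfolding polydisc_open_def by blast
  have f: "(\<lambda>w. f (p[j := w])) field_differentiable at (p ! j)"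
    using holo_onD_diff[OF assms(1) p j] .
  have "f (p[j := w]) = g (p[j := w])" if "dist w (p ! j) < d" for w
    using that d assms(3) polydisc_update[of p p d w j] by (auto simp: dist_norm)
  then have "\<forall>\<^sub>F w in nhds (p ! j). f (p[j := w]) = g (p[j := w])"
    unfolding eventually_nhds_metric using d by blast
  then show "(\<lambda>w. g (p[j := w])) field_differentiable at (p ! j)"
    using f unfolding field_differentiable_def by (simp add: DERIV_cong_ev)
qed

text \<open>Continuity is the epsilon/3 argument. On each one-variable slice the convergence is
  uniform, so Weierstrass's theorem gives separate holomorphy.\<close>

lemma holo_on_uniform_limit:
  assumes U: "polydisc_open U" and f: "\<And>n. holo_on U (f n)"
    and B: "\<And>n s. s \<in> U \<Longrightarrow> cmod (f n s - g s) \<le> B n" and B0: "B \<longlonglongrightarrow> 0"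
  shows "holo_on U g"
  unfolding holo_on_def
proof (intro conjI ballI allI impI)
  fix p and e :: real assume p: "p \<in> U" and e: "e > 0"
  have "\<forall>\<^sub>F n in sequentially. B n < e / 3"
    using B0 e order_tendstoD(2)[OF B0, of "e/3"] by simp
  then obtain n where n: "B n < e / 3"
    by (auto simp: eventually_sequentially)
  obtain d where d: "d > 0" "\<forall>q\<in>U \<inter> polydisc p d. cmod (f n q - f n p) < e / 3"
    using f[of n] e p unfolding holo_on_def by (meson divide_pos_pos zero_less_numeral)
  have "cmod (g q - g p) < e" if "q \<in> U \<inter> polydisc p d" for q
  proof -
    have "g q - g p = (f n q - f n p) - (f n q - g q) + (f n p - g p)" by simp
    then have "cmod (g q - g p) \<le> cmod (f n q - f n p) + cmod (f n q - g q) + cmod (f n p - g p)"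
      by (smt (verit) norm_triangle_ineq norm_triangle_ineq4)
    then show ?thesis
      using d(2)[rule_format, OF that] B[of q n] B[OF p, of n] n that by simp
  qed
  with d show "\<exists>d>0. \<forall>q\<in>U \<inter> polydisc p d. cmod (g q - g p) < e" by blast
next
  fix p j assume p: "p \<in> U" and j: "j < length p"
  obtain d where d: "d > 0" "polydisc p d \<subseteq> U"
    using U p unfolding polydisc_open_def by blast
  have in_U: "p[j := w] \<in> U" if "w \<in> ball (p ! j) d" for w
    using that d polydisc_update[of p p d w j] by (auto simp: dist_norm norm_minus_commute)
  have "(\<lambda>w. g (p[j := w])) holomorphic_on ball (p ! j) d"
  proof (rule holomorphic_uniform_sequence[where f = "\<lambda>n w. f n (p[j := w])"])
    show "(\<lambda>w. f n (p[j := w])) holomorphic_on ball (p ! j) d" for n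
      by (rule holo_on_holomorphic[OF f in_U j])
    fix x assume x: "x \<in> ball (p ! j) d"
    then obtain r where r: "r > 0" "cball x r \<subseteq> ball (p ! j) d"
      using open_contains_cball open_ball by blast
    have "uniform_limit (cball x r) (\<lambda>n w. f n (p[j := w])) (\<lambda>w. g (p[j := w])) sequentially"
    proof (rule uniform_limitI)
      fix e :: real assume "e > 0"
      then have "\<forall>\<^sub>F n in sequentially. B n < e"
        using B0 order_tendstoD(2) by blast
      then show "\<forall>\<^sub>F n in sequentially. \<forall>w\<in>cball x r. dist (f n (p[j := w])) (g (p[j := w])) < e"
      proof eventually_elim
        case (elim n)
        have "cmod (f n (p[j := w]) - g (p[j := w])) < e" if "w \<in> cball x r" for w
          using B[OF in_U, of w n] r that elim by force
        then show ?case by (simp add: dist_norm)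
      qed
    qed
    with r show "\<exists>d'>0. cball x d' \<subseteq> ball (p ! j) d \<and>
        uniform_limit (cball x d') (\<lambda>n w. f n (p[j := w])) (\<lambda>w. g (p[j := w])) sequentially"
      by blast
  qed auto
  then show "(\<lambda>w. g (p[j := w])) field_differentiable at (p ! j)"
    using d holomorphic_on_imp_differentiable_at by (metis centre_in_ball open_ball)
qed

lemma holo_on_locally_bounded:
  assumes "holo_on U f" "polydisc_open U" "p \<in> U"
  obtains d where "d > 0" "polydisc p d \<subseteq> U" "\<And>q. q \<in> polydisc p d \<Longrightarrow> cmod (f q) \<le> cmod (f p) + 1"
proof -
  obtain d1 where d1: "d1 > 0" "polydisc p d1 \<subseteq> U"
    using assms unfolding polydisc_open_def by blast
  obtain d2 where d2: "d2 > 0" "\<forall>q\<in>U \<inter> polydisc p d2. cmod (f q - f p) < 1"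
    using assms(1,3) unfolding holo_on_def by (meson zero_less_one)
  have "cmod (f q) \<le> cmod (f p) + 1" if "q \<in> polydisc p (min d1 d2)" for q
  proof -
    have "cmod (f q - f p) < 1"
      using that d1 d2 polydisc_mono[of "min d1 d2" d1 p] polydisc_mono[of "min d1 d2" d2 p] by auto
    then show ?thesis
      using norm_triangle_ineq2[of "f q" "f p"] by linarith
  qed
  then show ?thesis
    using that[of "min d1 d2"] d1 d2 polydisc_mono[of "min d1 d2" d1 p] by auto
qed

section \<open>Derivatives in the first variable\<close>

definition deriv_hd :: "(complex list \<Rightarrow> complex) \<Rightarrow> complex list \<Rightarrow> complex" where
  "deriv_hd f s = deriv (\<lambda>w. f (s[0 := w])) (s ! 0)"

lemma polydisc_shift_hd:
  assumes "q \<in> polydisc p d" "cmod h \<le> e" "p \<noteq> []" "e > 0"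
  shows "q[0 := q ! 0 + h] \<in> polydisc p (d + e)"
proof -
  have "cmod (q ! 0 + h - p ! 0) \<le> cmod (q ! 0 - p ! 0) + cmod h"
    using norm_triangle_ineq[of "q ! 0 - p ! 0" h] by (simp add: algebra_simps)
  also have "\<dots> < d + e"
    using assms by (simp add: polydisc_def add_less_le_mono)
  finally show ?thesis
    using assms polydisc_mono[of d "d + e" p]
    by (intro polydisc_update) auto
qed

lemma holo_on_shift_hd:
  assumes f: "holo_on U f" and V: "\<And>s. s \<in> V \<Longrightarrow> s[0 := s ! 0 + h] \<in> U \<and> s \<noteq> []"
  shows "holo_on V (\<lambda>s. f (s[0 := s ! 0 + h]))"
  unfolding holo_on_def
proof (intro conjI ballI allI impI)
  fix p and e :: real assume p: "p \<in> V" and "e > 0"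
  define p' where "p' = p[0 := p ! 0 + h]"
  obtain d where d: "d > 0" "\<forall>q\<in>U \<inter> polydisc p' d. cmod (f q - f p') < e"
    using f V[OF p] \<open>e > 0\<close> unfolding holo_on_def p'_def by blast
  have "cmod (f (q[0 := q ! 0 + h]) - f p') < e" if "q \<in> V \<inter> polydisc p d" for q
  proof -
    have "q[0 := q ! 0 + h] \<in> polydisc p' d"
      using that using V[of q] V[OF p] that by (auto simp: polydisc_def p'_def nth_list_update)
    then show ?thesis using d V that by auto
  qed
  with d show "\<exists>d>0. \<forall>q\<in>V \<inter> polydisc p d. cmod (f (q[0 := q ! 0 + h]) - f (p[0 := p ! 0 + h])) < e"
    unfolding p'_def by blast
next
  fix p j assume p: "p \<in> V" and j: "j < length p"
  define p' where "p' = p[0 := p ! 0 + h]"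
  have p': "p' \<in> U" "length p' = length p" using V[OF p] by (auto simp: p'_def)
  have D: "(\<lambda>w. f (p'[j := w])) field_differentiable at (p' ! j)"
    using holo_onD_diff[OF f p'(1)] p' j by simp
  show "(\<lambda>w. f ((p[j := w])[0 := (p[j := w]) ! 0 + h])) field_differentiable at (p ! j)"
  proof (cases "j = 0")
    case True
    have "((\<lambda>w. f (p'[0 := w])) \<circ> (\<lambda>w. w + h)) field_differentiable at (p ! 0)"
      by (rule field_differentiable_compose)
         (use D True j in \<open>auto simp: p'_def intro!: derivative_intros
            field_differentiable_add field_differentiable_ident\<close>)
    then show ?thesis using True j by (simp add: o_def p'_def)
  next
    case False
    have "(p[j := w])[0 := (p[j := w]) ! 0 + h] = p'[j := w]" for w
      using False by (simp add: p'_def list_update_swap)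
    then show ?thesis using D False by (simp add: p'_def)
  qed
qed

lemma difference_quotient_bound:
  assumes hol: "\<phi> holomorphic_on ball c (2 * d)" and d: "d > 0"
    and B: "\<And>w. w \<in> ball c (2 * d) \<Longrightarrow> cmod (\<phi> w) \<le> B"
    and h: "cmod h \<le> d" "h \<noteq> 0"
  shows "cmod ((\<phi> (c + h) - \<phi> c) / h - deriv \<phi> c) \<le> 8 * B / d ^ 2 * cmod h"
proof -
  \<comment> \<open>First-order Taylor remainder. Circles of radius d/2 around points of the closed
    disc of radius d stay inside the ball of radius 2 d, so Cauchy's inequality bounds the second
    derivative by 2! B / (d/2)^2; this is the 8 in the constant.\<close>
  have "cmod (\<phi> (c + h) - (\<Sum>i\<le>1. (deriv ^^ i) \<phi> c * (c + h - c) ^ i / fact i))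
      \<le> (8 * B / d ^ 2) * cmod (c + h - c) ^ Suc 1 / fact 1"
  proof (rule complex_Taylor[where f = "\<lambda>i. (deriv ^^ i) \<phi>" and S = "cball c d", simplified funpow_0])
    fix i x assume x: "x \<in> cball c d"
    then have xb: "x \<in> ball c (2 * d)" using d by auto
    show "((deriv ^^ i) \<phi> has_field_derivative (deriv ^^ Suc i) \<phi> x) (at x within cball c d)"
      using has_field_derivative_higher_deriv[OF hol open_ball xb]
      by (simp add: has_field_derivative_at_within)
    have sub: "ball x (d / 2) \<subseteq> ball c (2 * d)" "cball x (d / 2) \<subseteq> ball c (2 * d)"
      using x d by (auto simp: dist_norm norm_minus_commute)
         (smt (verit) norm_minus_commute norm_triangle_ineq diff_add_cancel add_diff_eq field_sum_of_halves)+
    have "cmod ((deriv ^^ 2) \<phi> x) \<le> fact 2 * B / (d / 2) ^ 2"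
    proof (rule Cauchy_inequality)
      show "\<phi> holomorphic_on ball x (d / 2)" "continuous_on (cball x (d / 2)) \<phi>"
        using sub hol holomorphic_on_subset holomorphic_on_imp_continuous_on by blast+
      show "cmod (\<phi> y) \<le> B" if "cmod (x - y) = d / 2" for y
        using that sub(2) by (intro B) (auto simp: dist_norm)
    qed (use d in auto)
    also have "\<dots> = 8 * B / d ^ 2" by (simp add: power2_eq_square)
    finally show "cmod ((deriv ^^ Suc 1) \<phi> x) \<le> 8 * B / d ^ 2"
      by (simp add: numeral_2_eq_2)
  qed (use d h in \<open>auto simp: dist_norm\<close>)
  then have "cmod (\<phi> (c + h) - \<phi> c - deriv \<phi> c * h) \<le> (8 * B / d ^ 2) * cmod h ^ 2"
    by (simp add: algebra_simps power2_eq_square)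
  then have "cmod (\<phi> (c + h) - \<phi> c - deriv \<phi> c * h) / cmod h \<le> (8 * B / d ^ 2) * cmod h"
    using h by (simp add: pos_divide_le_eq power2_eq_square mult_ac)
  moreover have "(\<phi> (c + h) - \<phi> c) / h - deriv \<phi> c = (\<phi> (c + h) - \<phi> c - deriv \<phi> c * h) / h"
    using h by (simp add: field_simps)
  ultimately show ?thesis by (simp add: norm_divide)
qed

text \<open>On a small polydisc the derivative is the uniform limit of difference quotients in the
  first variable. Each quotient is holomorphic by \<open>holo_on_shift_hd\<close>, and
  \<open>difference_quotient_bound\<close> with a local bound for f makes the convergence
  uniform.\<close>

lemma holo_on_deriv_hd:
  assumes f: "holo_on U f" and U: "polydisc_open U" and ne: "\<And>s. s \<in> U \<Longrightarrow> s \<noteq> []"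
  shows "holo_on U (deriv_hd f)"
proof (rule holo_on_local)
  fix p assume p: "p \<in> U"
  obtain d' where d': "d' > 0" "polydisc p d' \<subseteq> U"
      and bd: "\<And>q. q \<in> polydisc p d' \<Longrightarrow> cmod (f q) \<le> cmod (f p) + 1"
    using holo_on_locally_bounded[OF f U p] by blast
  \<comment> \<open>A point within d of p may still be moved by up to 2 d without leaving the
    polydisc of radius d'.\<close>
  define d where "d = d' / 3"
  define B where "B = cmod (f p) + 1"
  have d: "d > 0" "d' = d + 2 * d" using d' by (auto simp: d_def)
  define h where "h n = complex_of_real (d / real (Suc n))" for n
  have h: "cmod (h n) \<le> d" "h n \<noteq> 0" for n
    using d by (auto simp: h_def norm_divide divide_simps simp del: of_nat_Suc)
  have "holo_on (polydisc p d) (deriv_hd f)"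
  proof (rule holo_on_uniform_limit[where B = "\<lambda>n. 8 * B / d ^ 2 * cmod (h n)"])
    show "holo_on (polydisc p d) (\<lambda>s. (f (s[0 := s ! 0 + h n]) - f s) * (1 / h n))" for n
    proof (intro holo_on_mult holo_on_diff holo_on_const holo_on_shift_hd[OF f] conjI)
      show "holo_on (polydisc p d) f"
        using holo_on_subset[OF f] d d' polydisc_mono[of d d' p] by auto
      fix s assume s: "s \<in> polydisc p d"
      have "s[0 := s ! 0 + h n] \<in> polydisc p (d + 2 * d)"
        using h[of n] d ne[OF p] by (intro polydisc_shift_hd s) auto
      then show "s[0 := s ! 0 + h n] \<in> U" using d d' by auto
      show "s \<noteq> []" using ne[OF p] polydisc_length[OF s] by auto
    qed
    show "cmod ((f (s[0 := s ! 0 + h n]) - f s) * (1 / h n) - deriv_hd f s) \<le> 8 * B / d\<^sup>2 * cmod (h n)"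
      if s: "s \<in> polydisc p d" for n s
    proof -
      have sne: "s \<noteq> []" using ne[OF p] polydisc_length[OF s] by auto
      have upd: "s[0 := w] \<in> polydisc p d'" if "w \<in> ball (s ! 0) (2 * d)" for w
      proof -
        have "s[0 := s ! 0 + (w - s ! 0)] \<in> polydisc p (d + 2 * d)"
          using that d ne[OF p] by (intro polydisc_shift_hd s) (auto simp: dist_norm norm_minus_commute)
        then show ?thesis using d by simp
      qed
      have "cmod ((f (s[0 := s ! 0 + h n]) - f (s[0 := s ! 0])) / h n - deriv (\<lambda>w. f (s[0 := w])) (s ! 0))
          \<le> 8 * B / d\<^sup>2 * cmod (h n)"
      proof (rule difference_quotient_bound[where \<phi> = "\<lambda>w. f (s[0 := w])"])
        show "(\<lambda>w. f (s[0 := w])) holomorphic_on ball (s ! 0) (2 * d)"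
          using upd d' sne by (intro holo_on_holomorphic[OF f]) auto
        show "cmod (f (s[0 := w])) \<le> B" if "w \<in> ball (s ! 0) (2 * d)" for w
          unfolding B_def using bd upd[OF that] by blast
      qed (use d h in auto)
      then show ?thesis by (simp add: deriv_hd_def)
    qed
    have "(\<lambda>n. d / real (Suc n)) \<longlonglongrightarrow> 0"
      using LIMSEQ_Suc[OF lim_const_over_n[of d]] by simp
    moreover have "cmod (h n) = d / real (Suc n)" for n
      using d unfolding h_def norm_of_real by simp
    ultimately have "(\<lambda>n. cmod (h n)) \<longlonglongrightarrow> 0" by simp
    then show "(\<lambda>n. 8 * B / d\<^sup>2 * cmod (h n)) \<longlonglongrightarrow> 0"
      by (intro tendsto_mult_right_zero)
  qed (rule polydisc_open_polydisc)
  with d show "\<exists>d>0. holo_on (polydisc p d) (deriv_hd f)" by blast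
qed

text \<open>Vanishing spreads one coordinate at a time, so separate holomorphy is enough.\<close>

lemma holo_on_identity:
  assumes f: "holo_on (polydisc p e) f"
    and sub: "polydisc q \<eta> \<subseteq> polydisc p e" and \<eta>: "\<eta> > 0"
    and zero: "\<And>s. s \<in> polydisc q \<eta> \<Longrightarrow> f s = 0"
    and s: "s \<in> polydisc p e"
  shows "f s = 0"
proof -
  have q: "q \<in> polydisc p e" using sub \<eta> by auto
  have lq: "length q = length p" using polydisc_length[OF q] .
  have "f s = 0" if "s \<in> polydisc p e" "\<forall>j. m \<le> j \<longrightarrow> j < length p \<longrightarrow> cmod (s ! j - q ! j) < \<eta>" for m s
    using that
  proof (induction m arbitrary: s)
    case 0
    then show ?case using zero lq by (auto simp: polydisc_def)
  next
    case (Suc m)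
    show ?case
    proof (cases "m < length p")
      case False
      then show ?thesis using Suc by auto
    next
      case True
      have ls: "length s = length p" using Suc.prems polydisc_length by blast
      define \<phi> where "\<phi> w = f (s[m := w])" for w
      have hol: "\<phi> holomorphic_on ball (p ! m) e"
        unfolding \<phi>_def using Suc.prems True ls
        by (intro holo_on_holomorphic[OF f] polydisc_update) (auto simp: dist_norm norm_minus_commute)
      have qm: "q ! m \<in> ball (p ! m) e"
        using q True by (auto simp: polydisc_def dist_norm norm_minus_commute)
      have *: "\<phi> w = 0" if "w \<in> ball (p ! m) e \<inter> ball (q ! m) \<eta>" for w
        unfolding \<phi>_def
      proof (rule Suc.IH)
        show "s[m := w] \<in> polydisc p e"
          using that Suc.prems by (intro polydisc_update) (auto simp: dist_norm norm_minus_commute)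
        show "\<forall>j\<ge>m. j < length p \<longrightarrow> cmod (s[m := w] ! j - q ! j) < \<eta>"
          using that Suc.prems ls True by (auto simp: nth_list_update dist_norm norm_minus_commute)
      qed
      have "\<phi> (s ! m) = 0"
      proof (rule analytic_continuation_open[where f = \<phi> and g = "\<lambda>_. 0"
            and s = "ball (p ! m) e \<inter> ball (q ! m) \<eta>" and s' = "ball (p ! m) e"])
        show "ball (p ! m) e \<inter> ball (q ! m) \<eta> \<noteq> {}" using qm \<eta> by auto
        show "s ! m \<in> ball (p ! m) e"
          using Suc.prems True by (auto simp: polydisc_def dist_norm norm_minus_commute)
      qed (use hol * in auto)
      then show ?thesis by (simp add: \<phi>_def)
    qed
  qed
  from this[of s "length p"] s show ?thesis by auto
qed

text \<open>P holds on an open dense subset of D; unlike density alone this is preserved by conjunction.\<close>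

definition generically :: "complex list set \<Rightarrow> (complex list \<Rightarrow> bool) \<Rightarrow> bool" where
  "generically D P \<longleftrightarrow> (\<forall>p e. e > 0 \<longrightarrow> polydisc p e \<subseteq> D \<longrightarrow>
     (\<exists>q e'. e' > 0 \<and> polydisc q e' \<subseteq> polydisc p e \<and> (\<forall>s\<in>polydisc q e'. P s)))"

lemma generically_conj: "generically D P \<Longrightarrow> generically D Q \<Longrightarrow> generically D (\<lambda>s. P s \<and> Q s)"
  unfolding generically_def
proof (intro allI impI)
  fix p and e :: real
  assume P: "\<forall>p e. e > 0 \<longrightarrow> polydisc p e \<subseteq> D \<longrightarrow>
      (\<exists>q e'. e' > 0 \<and> polydisc q e' \<subseteq> polydisc p e \<and> (\<forall>s\<in>polydisc q e'. P s))"
    and Q: "\<forall>p e. e > 0 \<longrightarrow> polydisc p e \<subseteq> D \<longrightarrow>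
      (\<exists>q e'. e' > 0 \<and> polydisc q e' \<subseteq> polydisc p e \<and> (\<forall>s\<in>polydisc q e'. Q s))"
    and e: "e > 0" "polydisc p e \<subseteq> D"
  obtain q e' where q: "e' > 0" "polydisc q e' \<subseteq> polydisc p e" "\<forall>s\<in>polydisc q e'. P s"
    using P e by blast
  then have "polydisc q e' \<subseteq> D" using e by blast
  then obtain q' e'' where "e'' > 0" "polydisc q' e'' \<subseteq> polydisc q e'" "\<forall>s\<in>polydisc q' e''. Q s"
    using Q q(1) by blast
  then show "\<exists>q e'. 0 < e' \<and> polydisc q e' \<subseteq> polydisc p e \<and> (\<forall>s\<in>polydisc q e'. P s \<and> Q s)"
    using q by blast
qed

lemma generically_mono: "generically D P \<Longrightarrow> (\<And>s. s \<in> D \<Longrightarrow> P s \<Longrightarrow> Q s) \<Longrightarrow> generically D Q"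
  unfolding generically_def by (metis order_trans subsetD)

lemma generically_subset: "generically D P \<Longrightarrow> D' \<subseteq> D \<Longrightarrow> generically D' P"
  unfolding generically_def by (meson order_trans)

lemma generically_True: "generically D (\<lambda>s. True)"
  unfolding generically_def by blast

lemma generically_ball_finite:
  "finite I \<Longrightarrow> (\<And>i. i \<in> I \<Longrightarrow> generically D (P i)) \<Longrightarrow> generically D (\<lambda>s. \<forall>i\<in>I. P i s)"
proof (induction I rule: finite_induct)
  case empty then show ?case by (simp add: generically_True)
next
  case (insert i I)
  then have "generically D (\<lambda>s. P i s \<and> (\<forall>i\<in>I. P i s))" by (intro generically_conj) auto
  then show ?case by simp
qed

text \<open>If h vanished on some smaller polydisc, \<open>holo_on_identity\<close> would make it
  vanish everywhere. So each smaller polydisc contains a point where h is nonzero, and continuity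
  keeps h nonzero nearby.\<close>

lemma generically_holo_nonzero:
  assumes h: "holo_on (polydisc p e) h" and nz: "\<exists>q\<in>polydisc p e. h q \<noteq> 0"
  shows "generically (polydisc p e) (\<lambda>s. h s \<noteq> 0)"
  unfolding generically_def
proof (intro allI impI)
  fix p' and e' :: real assume e': "e' > 0" "polydisc p' e' \<subseteq> polydisc p e"
  obtain q where q: "q \<in> polydisc p' e'" "h q \<noteq> 0"
    using holo_on_identity[OF h e'(2,1)] nz by blast
  obtain d1 where d1: "d1 > 0" "polydisc q d1 \<subseteq> polydisc p' e'"
    using polydisc_open_polydisc q unfolding polydisc_open_def by blast
  have "q \<in> polydisc p e" using q e' by auto
  then obtain d2 where d2: "d2 > 0" "\<forall>s\<in>polydisc p e \<inter> polydisc q d2. cmod (h s - h q) < cmod (h q)"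
    using h q unfolding holo_on_def by (meson zero_less_norm_iff)
  have "h s \<noteq> 0" if "s \<in> polydisc q (min d1 d2)" for s
  proof
    assume "h s = 0"
    moreover have "s \<in> polydisc p e \<inter> polydisc q d2"
      using that d1 e' polydisc_mono[of "min d1 d2" d1 q] polydisc_mono[of "min d1 d2" d2 q] by auto
    ultimately show False using d2 by force
  qed
  then show "\<exists>q e''. 0 < e'' \<and> polydisc q e'' \<subseteq> polydisc p' e' \<and> (\<forall>s\<in>polydisc q e''. h s \<noteq> 0)"
    using d1 d2 polydisc_mono[of "min d1 d2" d1 q] by (intro exI[of _ q] exI[of _ "min d1 d2"]) auto
qed

lemma holo_on_generically_zero:
  assumes h: "holo_on (polydisc p e) h" and g: "generically (polydisc p e) (\<lambda>s. h s = 0)"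
    and s: "s \<in> polydisc p e"
  shows "h s = 0"
proof -
  \<comment> \<open>The polydisc of \<open>[]\<close> is \<open>{[]}\<close> whatever the radius, so
    in dimension 0 nothing forces e to be positive and \<open>generically\<close> is applied with
    radius 1 instead.\<close>
  have "e > 0 \<or> p = []"
    using s by (cases p) (auto simp: polydisc_def intro: le_less_trans[OF norm_ge_zero])
  then show ?thesis
  proof
    assume "e > 0"
    then obtain q e' where "e' > 0" "polydisc q e' \<subseteq> polydisc p e" "\<forall>s\<in>polydisc q e'. h s = 0"
      using g unfolding generically_def by blast
    then show ?thesis using holo_on_identity[OF h] s by blast
  next
    assume [simp]: "p = []"
    have eq: "polydisc p e = {[]}" for e by (auto simp: polydisc_def)
    obtain q e' where "e' > 0" "polydisc q e' \<subseteq> polydisc p 1" "\<forall>s\<in>polydisc q e'. h s = 0"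
      using g eq unfolding generically_def by (metis order_refl zero_less_one)
    then show ?thesis using s eq polydisc_center by (metis singletonD subsetD)
  qed
qed

section \<open>Quotients by products of linear forms\<close>

abbreviation disc0 :: "nat \<Rightarrow> real \<Rightarrow> complex list set" where
  "disc0 d K \<equiv> polydisc (replicate d 0) K"

lemma disc0_iff: "s \<in> disc0 d K \<longleftrightarrow> length s = d \<and> (\<forall>j<d. cmod (s ! j) < K)"
  by (auto simp: polydisc_def)

text \<open>Nonempty \<open>P\<close> keeps every factor nonconstant: its zeros are then nowhere
  dense, and there is a variable in which a power series can be divided by it. The inductive form
  lets both arguments treat one factor at a time.\<close>

inductive form_product :: "nat \<Rightarrow> (complex list \<Rightarrow> complex) \<Rightarrow> bool" for d where
  one: "form_product d (\<lambda>s. 1)"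
| step: "form_product d Q \<Longrightarrow> P \<subseteq> {..<d} \<Longrightarrow> P \<noteq> {} \<Longrightarrow> form_product d (\<lambda>s. (c + (\<Sum>p\<in>P. s ! p)) * Q s)"

lemma form_product_mult:
  assumes "form_product d Q1" "form_product d Q2"
  shows "form_product d (\<lambda>s. Q1 s * Q2 s)"
  using assms(1)
proof induction
  case one
  then show ?case using assms(2) by simp
next
  case (step Q P c)
  have "form_product d (\<lambda>s. (c + (\<Sum>p\<in>P. s ! p)) * (Q s * Q2 s))"
    by (rule form_product.step) (use step in auto)
  then show ?case by (simp add: mult.assoc)
qed

lemma form_product_form:
  "P \<subseteq> {..<d} \<Longrightarrow> P \<noteq> {} \<Longrightarrow> form_product d (\<lambda>s. c + (\<Sum>p\<in>P. s ! p))"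
  using form_product.step[OF form_product.one, of P d c] by simp

lemma form_holo:
  "P \<subseteq> {..<d} \<Longrightarrow> (\<And>s. s \<in> U \<Longrightarrow> length s = d) \<Longrightarrow> holo_on U (\<lambda>s. c + (\<Sum>p\<in>P. s ! p))"
  by (intro holo_on_add holo_on_const holo_on_sum holo_on_coord) auto

lemma form_product_holo:
  assumes "form_product d Q" "\<And>s. s \<in> U \<Longrightarrow> length s = d"
  shows "holo_on U Q"
  using assms(1)
  by induction (use assms(2) in \<open>auto intro!: holo_on_const holo_on_mult[OF form_holo]\<close>)

lemma form_bounded:
  assumes "P \<subseteq> {..<d}" "s \<in> disc0 d K"
  shows "cmod (c + (\<Sum>p\<in>P. s ! p)) \<le> cmod c + real (card P) * K"
proof -
  have "cmod (\<Sum>p\<in>P. s ! p) \<le> (\<Sum>p\<in>P. K)"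
    by (rule sum_norm_le) (use assms in \<open>auto simp: disc0_iff intro: less_imp_le\<close>)
  then show ?thesis using norm_triangle_ineq[of c "\<Sum>p\<in>P. s ! p"] by simp
qed

lemma form_product_bounded:
  assumes "form_product d Q"
  shows "\<exists>B\<ge>0. \<forall>s\<in>disc0 d K. cmod (Q s) \<le> B"
  using assms
proof induction
  case one then show ?case by (intro exI[of _ 1]) auto
next
  case (step Q P c)
  then obtain B where B: "B \<ge> 0" "\<forall>s\<in>disc0 d K. cmod (Q s) \<le> B" by blast
  have "cmod ((c + (\<Sum>p\<in>P. s ! p)) * Q s) \<le> (cmod c + real (card P) * \<bar>K\<bar>) * B" if "s \<in> disc0 d K" for s
  proof -
    have "cmod (c + (\<Sum>p\<in>P. s ! p)) \<le> cmod c + real (card P) * K"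
      by (rule form_bounded) (use step that in auto)
    also have "\<dots> \<le> cmod c + real (card P) * \<bar>K\<bar>"
      by (simp add: mult_left_mono)
    finally show ?thesis
      unfolding norm_mult using B that by (intro mult_mono) auto
  qed
  then show ?case using B
    by (intro exI[of _ "(cmod c + real (card P) * \<bar>K\<bar>) * B"]) auto
qed

text \<open>Moving one coordinate from \<open>P\<close> by e/2 changes the form by e/2, so it cannot
  vanish at both points, and \<open>generically_holo_nonzero\<close> applies.\<close>

lemma form_generically:
  assumes P: "P \<subseteq> {..<d}" "P \<noteq> {}" and U: "\<And>s. s \<in> U \<Longrightarrow> length s = d"
  shows "generically U (\<lambda>s. c + (\<Sum>p\<in>P. s ! p) \<noteq> 0)"
  unfolding generically_def
proof (intro allI impI)
  fix q and e :: real assume e: "e > 0" and sub: "polydisc q e \<subseteq> U"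
  have lq: "length q = d" using U[of q] sub e polydisc_center[of e q] by blast
  obtain j where j: "j \<in> P" using P by blast
  have fin: "finite P" using P finite_subset by blast
  let ?l = "\<lambda>s::complex list. c + (\<Sum>p\<in>P. s ! p)"
  define q' where "q' = q[j := q ! j + of_real (e / 2)]"
  have q': "q' \<in> polydisc q e"
    unfolding q'_def using e by (intro polydisc_update) (auto simp: norm_divide)
  have "(\<Sum>p\<in>P. q' ! p) = q' ! j + (\<Sum>p\<in>P - {j}. q' ! p)"
    using sum.remove[OF fin j] by blast
  also have "(\<Sum>p\<in>P - {j}. q' ! p) = (\<Sum>p\<in>P - {j}. q ! p)"
    by (rule sum.cong) (auto simp: q'_def)
  also have "q' ! j = q ! j + of_real (e / 2)"
    using j P lq by (auto simp: q'_def)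
  finally have "?l q' - ?l q = of_real (e / 2)"
    using sum.remove[OF fin j, of "\<lambda>p. q ! p"] by simp
  then have "?l q' \<noteq> ?l q" using e by auto
  then have "?l q \<noteq> 0 \<or> ?l q' \<noteq> 0" by metis
  then have "\<exists>s\<in>polydisc q e. ?l s \<noteq> 0" using q' e polydisc_center by blast
  moreover have "holo_on (polydisc q e) ?l"
    by (rule form_holo[OF P(1)]) (use sub U in blast)
  ultimately have "generically (polydisc q e) (\<lambda>s. ?l s \<noteq> 0)"
    by (intro generically_holo_nonzero)
  then show "\<exists>q' e'. 0 < e' \<and> polydisc q' e' \<subseteq> polydisc q e \<and> (\<forall>s\<in>polydisc q' e'. ?l s \<noteq> 0)"
    unfolding generically_def using e by blast
qed

lemma form_product_generically:
  assumes "form_product d Q" and U: "\<And>s. s \<in> U \<Longrightarrow> length s = d"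
  shows "generically U (\<lambda>s. Q s \<noteq> 0)"
  using assms(1)
proof induction
  case one then show ?case using generically_True by simp
next
  case (step Q P c)
  then have "generically U (\<lambda>s. c + (\<Sum>p\<in>P. s ! p) \<noteq> 0 \<and> Q s \<noteq> 0)"
    using U by (intro generically_conj form_generically) auto
  then show ?case by simp
qed

lemma form_product_drop:
  assumes "form_product d Q"
  shows "\<exists>Q'. form_product (i + d) Q' \<and> (\<forall>s. length s = i + d \<longrightarrow> Q' s = Q (drop i s))"
  using assms
proof induction
  case one
  then show ?case by (intro exI[of _ "\<lambda>s. 1"]) (auto intro: form_product.one)
next
  case (step Q P c)
  then obtain Q' where Q': "form_product (i + d) Q'" "\<forall>s. length s = i + d \<longrightarrow> Q' s = Q (drop i s)" by blast
  have "form_product (i + d) (\<lambda>s. (c + (\<Sum>p\<in>(+) i ` P. s ! p)) * Q' s)"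
    by (rule form_product.step) (use step Q' in auto)
  moreover have "(\<Sum>p\<in>(+) i ` P. s ! p) = (\<Sum>p\<in>P. drop i s ! p)" if "length s = i + d" for s :: "complex list"
    by (subst sum.reindex) (use that in auto)
  ultimately show ?case using Q' by (intro exI[of _ "\<lambda>s. (c + (\<Sum>p\<in>(+) i ` P. s ! p)) * Q' s"]) auto
qed

text \<open>A sequence of quotients \<open>g n / Q\<close> with \<open>g n = O(n powr -M)\<close>. The common denominator does not
  depend on n, and nothing is claimed on its zero set, where division yields the junk value 0.\<close>

definition mero_bigo :: "nat \<Rightarrow> real \<Rightarrow> real \<Rightarrow> (nat \<Rightarrow> complex list \<Rightarrow> complex) \<Rightarrow> bool" where
  "mero_bigo d K M f \<longleftrightarrow> (\<exists>Q g C. form_product d Q \<and>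
     (\<forall>n\<ge>1. holo_on (disc0 d K) (g n) \<and> (\<forall>s\<in>disc0 d K. cmod (g n s) \<le> C * real n powr (-M))) \<and>
     (\<forall>n\<ge>1. \<forall>s\<in>disc0 d K. Q s \<noteq> 0 \<longrightarrow> f n s = g n s / Q s))"

text \<open>The witnesses of \<open>mero_bigo\<close> made explicit, with the constant nonnegative
  so that estimates can be multiplied.\<close>

definition mero_bigo_rep where
  "mero_bigo_rep d K M f Q g C \<longleftrightarrow> form_product d Q \<and> C \<ge> (0::real) \<and>
     (\<forall>n\<ge>1. holo_on (disc0 d K) (g n) \<and> (\<forall>s\<in>disc0 d K. cmod (g n s) \<le> C * real n powr (-M))) \<and>
     (\<forall>n\<ge>1. \<forall>s\<in>disc0 d K. Q s \<noteq> 0 \<longrightarrow> f n s = g n s / Q s)"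

lemma mero_bigo_repD:
  assumes "mero_bigo_rep d K M f Q g C"
  shows "form_product d Q" "C \<ge> 0" "\<And>n. n \<ge> 1 \<Longrightarrow> holo_on (disc0 d K) (g n)"
    "\<And>n s. n \<ge> 1 \<Longrightarrow> s \<in> disc0 d K \<Longrightarrow> cmod (g n s) \<le> C * real n powr (-M)"
    "\<And>n s. n \<ge> 1 \<Longrightarrow> s \<in> disc0 d K \<Longrightarrow> Q s \<noteq> 0 \<Longrightarrow> f n s = g n s / Q s"
  using assms unfolding mero_bigo_rep_def by blast+

lemma mero_bigoE:
  assumes "mero_bigo d K M f"
  obtains Q g C where "mero_bigo_rep d K M f Q g C"
proof -
  obtain Q g C where *: "form_product d Q"
     "\<forall>n\<ge>1. holo_on (disc0 d K) (g n) \<and> (\<forall>s\<in>disc0 d K. cmod (g n s) \<le> C * real n powr (-M))"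
     "\<forall>n\<ge>1. \<forall>s\<in>disc0 d K. Q s \<noteq> 0 \<longrightarrow> f n s = g n s / Q s"
    using assms unfolding mero_bigo_def by blast
  have "cmod (g n s) \<le> \<bar>C\<bar> * real n powr (-M)" if "n \<ge> 1" "s \<in> disc0 d K" for n s
  proof -
    have "cmod (g n s) \<le> C * real n powr (-M)" using * that by blast
    also have "\<dots> \<le> \<bar>C\<bar> * real n powr (-M)" by (intro mult_right_mono) auto
    finally show ?thesis .
  qed
  then show ?thesis using that[of Q g "\<bar>C\<bar>"] * unfolding mero_bigo_rep_def by auto
qed

lemma mero_bigoI:
  assumes "form_product d Q" "\<And>n. n \<ge> 1 \<Longrightarrow> holo_on (disc0 d K) (g n)"
    "\<And>n s. n \<ge> 1 \<Longrightarrow> s \<in> disc0 d K \<Longrightarrow> cmod (g n s) \<le> C * real n powr (-M)"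
    "\<And>n s. n \<ge> 1 \<Longrightarrow> s \<in> disc0 d K \<Longrightarrow> Q s \<noteq> 0 \<Longrightarrow> f n s = g n s / Q s"
  shows "mero_bigo d K M f"
  unfolding mero_bigo_def using assms by blast

lemma mero_bigo_mult:
  assumes "mero_bigo d K M1 f1" "mero_bigo d K M2 f2"
  shows "mero_bigo d K (M1 + M2) (\<lambda>n s. f1 n s * f2 n s)"
proof -
  obtain Q1 g1 C1 where "mero_bigo_rep d K M1 f1 Q1 g1 C1"
    by (rule mero_bigoE[OF assms(1)])
  note 1 = mero_bigo_repD[OF this]
  obtain Q2 g2 C2 where "mero_bigo_rep d K M2 f2 Q2 g2 C2"
    by (rule mero_bigoE[OF assms(2)])
  note 2 = mero_bigo_repD[OF this]
  show ?thesis
  proof (rule mero_bigoI[where Q = "\<lambda>s. Q1 s * Q2 s" and g = "\<lambda>n s. g1 n s * g2 n s" and C = "C1 * C2"])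
    fix n :: nat and s assume n: "n \<ge> 1" and s: "s \<in> disc0 d K"
    have "cmod (g1 n s * g2 n s) \<le> (C1 * real n powr (-M1)) * (C2 * real n powr (-M2))"
      unfolding norm_mult using 1 2 n s by (intro mult_mono) auto
    then show "cmod (g1 n s * g2 n s) \<le> C1 * C2 * real n powr - (M1 + M2)"
      unfolding minus_add_distrib powr_add by (simp add: mult_ac)
  qed (use 1 2 in \<open>auto intro: form_product_mult holo_on_mult\<close>)
qed

text \<open>Over the common denominator each numerator is multiplied by the other denominator, which
  is bounded on the polydisc and so does not affect the rate.\<close>

lemma mero_bigo_add:
  assumes "mero_bigo d K M f1" "mero_bigo d K M f2"
  shows "mero_bigo d K M (\<lambda>n s. f1 n s + f2 n s)"
proof -
  obtain Q1 g1 C1 where "mero_bigo_rep d K M f1 Q1 g1 C1"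
    by (rule mero_bigoE[OF assms(1)])
  note 1 = mero_bigo_repD[OF this]
  obtain Q2 g2 C2 where "mero_bigo_rep d K M f2 Q2 g2 C2"
    by (rule mero_bigoE[OF assms(2)])
  note 2 = mero_bigo_repD[OF this]
  obtain B1 where B1: "B1 \<ge> 0" "\<And>s. s \<in> disc0 d K \<Longrightarrow> cmod (Q1 s) \<le> B1"
    using form_product_bounded[OF 1(1)] by metis
  obtain B2 where B2: "B2 \<ge> 0" "\<And>s. s \<in> disc0 d K \<Longrightarrow> cmod (Q2 s) \<le> B2"
    using form_product_bounded[OF 2(1)] by metis
  have Qh: "holo_on (disc0 d K) Q1" "holo_on (disc0 d K) Q2"
    using 1 2 by (auto intro!: form_product_holo simp: disc0_iff)
  show ?thesis
  proof (rule mero_bigoI[where Q = "\<lambda>s. Q1 s * Q2 s" and g = "\<lambda>n s. g1 n s * Q2 s + g2 n s * Q1 s"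
        and C = "C1 * B2 + C2 * B1"])
    fix n :: nat and s assume n: "n \<ge> 1" and s: "s \<in> disc0 d K"
    have "cmod (g1 n s * Q2 s) \<le> (C1 * real n powr (-M)) * B2"
      unfolding norm_mult using 1 B2 n s by (intro mult_mono) auto
    moreover have "cmod (g2 n s * Q1 s) \<le> (C2 * real n powr (-M)) * B1"
      unfolding norm_mult using 2 B1 n s by (intro mult_mono) auto
    ultimately show "cmod (g1 n s * Q2 s + g2 n s * Q1 s) \<le> (C1 * B2 + C2 * B1) * real n powr - M"
      using norm_triangle_ineq[of "g1 n s * Q2 s" "g2 n s * Q1 s"] by (simp add: algebra_simps)
  qed (use 1 2 Qh in \<open>auto intro: form_product_mult intro!: holo_on_mult holo_on_add simp: field_simps\<close>)
qed

text \<open>Numerator and denominator are both multiplied by \<open>Q0\<close>. The quotient stays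
  the same, but nothing is asserted any more where \<open>Q0\<close> vanishes, which is where f and
  f' may differ.\<close>

lemma mero_bigo_cong_off_form_zeros:
  assumes f: "mero_bigo d K M f" and Q0: "form_product d Q0"
    and eq: "\<And>n s. n \<ge> 1 \<Longrightarrow> s \<in> disc0 d K \<Longrightarrow> Q0 s \<noteq> 0 \<Longrightarrow> f n s = f' n s"
  shows "mero_bigo d K M f'"
proof -
  obtain Q1 g1 C1 where "mero_bigo_rep d K M f Q1 g1 C1"
    by (rule mero_bigoE[OF f])
  note 1 = mero_bigo_repD[OF this]
  obtain B where B: "B \<ge> 0" "\<And>s. s \<in> disc0 d K \<Longrightarrow> cmod (Q0 s) \<le> B"
    using form_product_bounded[OF Q0] by metis
  have Qh: "holo_on (disc0 d K) Q0"
    using Q0 by (auto intro!: form_product_holo simp: disc0_iff)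
  show ?thesis
  proof (rule mero_bigoI[where Q = "\<lambda>s. Q1 s * Q0 s" and g = "\<lambda>n s. g1 n s * Q0 s" and C = "C1 * B"])
    fix n :: nat and s assume n: "n \<ge> 1" and s: "s \<in> disc0 d K"
    have "cmod (g1 n s * Q0 s) \<le> (C1 * real n powr (-M)) * B"
      unfolding norm_mult using 1 B n s by (intro mult_mono) auto
    then show "cmod (g1 n s * Q0 s) \<le> C1 * B * real n powr - M"
      by (simp add: mult_ac)
    assume "Q1 s * Q0 s \<noteq> 0"
    then show "f' n s = g1 n s * Q0 s / (Q1 s * Q0 s)"
      using 1(5)[OF n s] eq[OF n s] by simp
  qed (use 1 Qh Q0 in \<open>auto intro: form_product_mult intro!: holo_on_mult\<close>)
qed

lemma mero_bigo_cong:
  assumes f: "mero_bigo d K M f" and eq: "\<And>n s. n \<ge> 1 \<Longrightarrow> s \<in> disc0 d K \<Longrightarrow> f n s = f' n s"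
  shows "mero_bigo d K M f'"
  using mero_bigo_cong_off_form_zeros[OF f form_product.one] eq by blast

lemma mero_bigo_holo:
  assumes "\<And>n. n \<ge> 1 \<Longrightarrow> holo_on (disc0 d K) (g n)"
    "\<And>n s. n \<ge> 1 \<Longrightarrow> s \<in> disc0 d K \<Longrightarrow> cmod (g n s) \<le> C * real n powr (-M)"
  shows "mero_bigo d K M g"
  by (rule mero_bigoI[OF form_product.one]) (use assms in auto)

lemma mero_bigo_unit: "cmod \<xi> = 1 \<Longrightarrow> mero_bigo d K 0 (\<lambda>n s. \<xi> ^ n)"
  by (rule mero_bigo_holo[where C = 1]) (auto intro: holo_on_const simp: norm_power)

lemma mero_bigo_const: "mero_bigo d K 0 (\<lambda>n s. c)"
  by (rule mero_bigo_holo[where C = "cmod c"]) (auto intro: holo_on_const)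

lemma mero_bigo_zero: "mero_bigo d K M (\<lambda>n s. 0)"
  by (rule mero_bigo_holo[where C = 0]) (auto intro: holo_on_const)

lemma mero_bigo_cmult: "mero_bigo d K M f \<Longrightarrow> mero_bigo d K M (\<lambda>n s. c * f n s)"
  using mero_bigo_mult[OF mero_bigo_const[of d K c]] by simp

lemma mero_bigo_mult0: "mero_bigo d K 0 f \<Longrightarrow> mero_bigo d K M g \<Longrightarrow> mero_bigo d K M (\<lambda>n s. f n s * g n s)"
  using mero_bigo_mult[of d K 0 f M g] by simp

lemma mero_bigo_uminus: "mero_bigo d K M f \<Longrightarrow> mero_bigo d K M (\<lambda>n s. - f n s)"
  using mero_bigo_cmult[of d K M f "-1"] by simp

lemma mero_bigo_diff: "mero_bigo d K M f \<Longrightarrow> mero_bigo d K M g \<Longrightarrow> mero_bigo d K M (\<lambda>n s. f n s - g n s)"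
  using mero_bigo_add[of d K M f "\<lambda>n s. - g n s"] mero_bigo_uminus[of d K M g] by simp

lemma mero_bigo_sum: "(\<And>i. i \<in> I \<Longrightarrow> mero_bigo d K M (f i)) \<Longrightarrow> mero_bigo d K M (\<lambda>n s. \<Sum>i\<in>I. f i n s)"
  by (induction I rule: infinite_finite_induct) (auto intro: mero_bigo_zero mero_bigo_add)

lemma mero_bigo_prod: "(\<And>i. i \<in> I \<Longrightarrow> mero_bigo d K 0 (f i)) \<Longrightarrow> mero_bigo d K 0 (\<lambda>n s. \<Prod>i\<in>I. f i n s)"
  by (induction I rule: infinite_finite_induct) (auto intro: mero_bigo_const mero_bigo_mult0)

lemma mero_bigo_form:
  assumes "P \<subseteq> {..<d}" shows "mero_bigo d K 0 (\<lambda>n s. c + (\<Sum>p\<in>P. s ! p))"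
proof (rule mero_bigo_holo[where C = "cmod c + real (card P) * K"])
  show "holo_on (disc0 d K) (\<lambda>s. c + (\<Sum>p\<in>P. s ! p))"
    by (rule form_holo[OF assms]) (simp add: disc0_iff)
qed (use form_bounded[OF assms] in auto)

lemma mero_bigo_inv_form:
  assumes "P \<subseteq> {..<d}" "P \<noteq> {}" shows "mero_bigo d K 0 (\<lambda>n s. 1 / (c + (\<Sum>p\<in>P. s ! p)))"
  by (rule mero_bigoI[OF form_product_form[OF assms], where g = "\<lambda>n s. 1" and C = 1])
     (auto intro: holo_on_const)

lemma mero_bigo_drop:
  assumes "mero_bigo d K M f"
  shows "mero_bigo (i + d) K M (\<lambda>n s. f n (drop i s))"
proof -
  obtain Q1 g1 C1 where "mero_bigo_rep d K M f Q1 g1 C1"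
    by (rule mero_bigoE[OF assms(1)])
  note 1 = mero_bigo_repD[OF this]
  obtain Q' where Q': "form_product (i + d) Q'" "\<forall>s. length s = i + d \<longrightarrow> Q' s = Q1 (drop i s)"
    using form_product_drop[OF 1(1)] by blast
  have D: "drop i s \<in> disc0 d K" if "s \<in> disc0 (i + d) K" for s
    using that by (auto simp: disc0_iff)
  show ?thesis
    by (rule mero_bigoI[OF Q'(1), where g = "\<lambda>n s. g1 n (drop i s)" and C = C1])
       (use 1 Q' D in \<open>auto intro!: holo_on_drop simp: disc0_iff\<close>)
qed

section \<open>Powers of n and convergent sums over n\<close>

definition prefix_sum :: "nat \<Rightarrow> complex list \<Rightarrow> complex" where
  "prefix_sum i s = (\<Sum>p<i. s ! p)"

lemma norm_of_nat_powr: "n \<ge> 1 \<Longrightarrow> cmod (of_nat n powr w) = real n powr Re w"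
  using norm_powr_real_powr[of "of_nat n" w] by simp

lemma holo_on_npowr:
  assumes "n \<ge> 1" "holo_on U f"
  shows "holo_on U (\<lambda>s. of_nat n powr f s)"
  by (rule holo_on_compose[OF assms(2)])
     (use assms in \<open>auto intro!: holomorphic_on_imp_differentiable_at[of _ UNIV] holomorphic_intros\<close>)

lemma prefix_sum_holo: "i \<le> d \<Longrightarrow> (\<And>s. s \<in> U \<Longrightarrow> length s = d) \<Longrightarrow> holo_on U (prefix_sum i)"
  unfolding prefix_sum_def by (intro holo_on_sum holo_on_coord) auto

lemma prefix_sum_bound: "i \<le> d \<Longrightarrow> s \<in> disc0 d K \<Longrightarrow> cmod (prefix_sum i s) \<le> real i * K"
  using form_bounded[of "{..<i}" d s K 0] by (simp add: prefix_sum_def)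

text \<open>On the polydisc the prefix sum has modulus at most i K, so the real part of the exponent
  is at most k + i K. A negative M records growth.\<close>

lemma mero_bigo_powr:
  assumes "i \<le> d" "M \<le> - (real_of_int k + real i * K)"
  shows "mero_bigo d K M (\<lambda>n s. of_nat n powr (of_int k - prefix_sum i s))"
proof (rule mero_bigo_holo[where C = 1])
  fix n :: nat assume n: "n \<ge> 1"
  show "holo_on (disc0 d K) (\<lambda>s. of_nat n powr (of_int k - prefix_sum i s))"
    by (intro holo_on_npowr[OF n] holo_on_diff holo_on_const prefix_sum_holo[OF assms(1)]) (simp add: disc0_iff)
  fix s assume s: "s \<in> disc0 d K"
  have "cmod (of_nat n powr (of_int k - prefix_sum i s)) = real n powr (of_int k - Re (prefix_sum i s))"
    using n by (simp add: norm_of_nat_powr)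
  also have "\<dots> \<le> real n powr (- M)"
  proof (rule powr_mono)
    have "- Re (prefix_sum i s) \<le> real i * K"
      using prefix_sum_bound[OF assms(1) s] abs_Re_le_cmod[of "prefix_sum i s"] by linarith
    then show "of_int k - Re (prefix_sum i s) \<le> - M" using assms(2) by linarith
  qed (use n in auto)
  finally show "cmod (of_nat n powr (of_int k - prefix_sum i s)) \<le> 1 * real n powr - M" by simp
qed

lemma summable_inverse_Suc_squares: "summable (\<lambda>n. 1 / real (Suc n) ^ 2)"
  using summable_Suc_iff[of "\<lambda>n. 1 / real n ^ 2"] inverse_power_summable[of 2, where 'a = real]
  by (simp add: divide_inverse)

text \<open>The denominator is common to all n, so the numerators can be summed. Two surplus powers
  of decay give the majorant N^(-M) n^(-2) for n \<ge> N, and hence the bound for the tail.\<close>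

lemma mero_bigo_suminf:
  assumes f: "mero_bigo d K (M + 2) f" and M: "M \<ge> 0"
  obtains Z where "mero_bigo d K 0 (\<lambda>n. Z)" "mero_bigo d K M (\<lambda>N s. (\<Sum>n=1..<N. f n s) - Z s)"
proof -
  obtain Q g C where "mero_bigo_rep d K (M + 2) f Q g C"
    by (rule mero_bigoE[OF f])
  note 1 = mero_bigo_repD[OF this]
  \<comment> \<open>The tail of the series of inverse squares. It tends to 0 by itself, which yields
    uniform convergence also for M = 0, where the power with exponent -M does not decay.\<close>
  define T where "T N = (\<Sum>n. 1 / real (Suc (n + N)) ^ 2)" for N
  have sumT: "summable (\<lambda>n. 1 / real (Suc (n + N)) ^ 2)" for N
    using summable_iff_shift[of "\<lambda>n. 1 / real (Suc n) ^ 2" N] summable_inverse_Suc_squares by simp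
  have T0: "T \<longlonglongrightarrow> 0"
    unfolding T_def using suminf_exist_split2[OF summable_inverse_Suc_squares] by simp
  have Tnn: "T N \<ge> 0" for N unfolding T_def by (intro suminf_nonneg sumT) auto
  have T_le: "T N \<le> T 0" for N
  proof -
    have "T 0 = T N + (\<Sum>n<N. 1 / real (Suc n) ^ 2)"
      unfolding T_def using suminf_split_initial_segment[OF sumT[of 0], of N] by simp
    then show ?thesis by (simp add: sum_nonneg)
  qed
  have gb: "cmod (g (Suc (n + N)) s) \<le> C * real (Suc N) powr (-M) * (1 / real (Suc (n + N)) ^ 2)"
    if "s \<in> disc0 d K" for n N s
  proof -
    have "cmod (g (Suc (n + N)) s) \<le> C * real (Suc (n + N)) powr (-(M + 2))"
      by (rule 1(4)) (use that in auto)
    also have "\<dots> = C * (real (Suc (n + N)) powr (-M) * real (Suc (n + N)) powr (-2))"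
      by (simp add: powr_add[symmetric])
    also have "real (Suc (n + N)) powr (-2) = 1 / real (Suc (n + N)) ^ 2"
      by (simp add: powr_minus_divide)
    also have "C * (real (Suc (n + N)) powr (-M) * (1 / real (Suc (n + N)) ^ 2))
        \<le> C * (real (Suc N) powr (-M) * (1 / real (Suc (n + N)) ^ 2))"
      using 1(2) M by (intro mult_left_mono mult_right_mono powr_mono2') auto
    finally show ?thesis by (simp add: mult_ac)
  qed
  have sumg: "summable (\<lambda>n. norm (g (Suc (n + N)) s))" if "s \<in> disc0 d K" for N s
    by (rule summable_comparison_test'[OF summable_mult[OF sumT]]) (use gb that in force)
  define G where "G s = (\<Sum>n. g (Suc n) s)" for s
  have tail: "cmod ((\<Sum>n<N. g (Suc n) s) - G s) \<le> C * real (Suc N) powr (-M) * T N"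
    if s: "s \<in> disc0 d K" for N s
  proof -
    have "summable (\<lambda>n. g (Suc n) s)"
      using summable_norm_cancel sumg[OF s, of 0] by auto
    then have "G s = (\<Sum>n. g (Suc (n + N)) s) + (\<Sum>n<N. g (Suc n) s)"
      unfolding G_def using suminf_split_initial_segment[of "\<lambda>n. g (Suc n) s" N] by simp
    then have "cmod ((\<Sum>n<N. g (Suc n) s) - G s) = cmod (\<Sum>n. g (Suc (n + N)) s)"
      by (simp add: norm_minus_commute)
    also have "\<dots> \<le> (\<Sum>n. cmod (g (Suc (n + N)) s))"
      by (rule summable_norm[OF sumg[OF s]])
    also have "\<dots> \<le> (\<Sum>n. C * real (Suc N) powr (-M) * (1 / real (Suc (n + N)) ^ 2))"
      by (intro suminf_le gb s sumg summable_mult sumT)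
    also have "\<dots> = C * real (Suc N) powr (-M) * T N"
      unfolding T_def by (intro suminf_mult sumT)
    finally show ?thesis .
  qed
  have Gh: "holo_on (disc0 d K) G"
  proof (rule holo_on_uniform_limit[where f = "\<lambda>N s. \<Sum>n<N. g (Suc n) s" and B = "\<lambda>N. C * T N"])
    show "holo_on (disc0 d K) (\<lambda>s. \<Sum>n<N. g (Suc n) s)" for N
      by (intro holo_on_sum 1) auto
    show "cmod ((\<Sum>n<N. g (Suc n) s) - G s) \<le> C * T N" if "s \<in> disc0 d K" for N s
    proof -
      have "real (Suc N) powr (-M) \<le> 1"
        using M by (simp add: powr_le_one_le powr_minus inverse_le_1_iff ge_one_powr_ge_zero)
      then have "C * real (Suc N) powr (-M) * T N \<le> C * 1 * T N"
        using 1(2) Tnn by (intro mult_mono) auto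
      then show ?thesis using tail[OF that, of N] by simp
    qed
    show "(\<lambda>N. C * T N) \<longlonglongrightarrow> 0" using tendsto_mult_right_zero[OF T0] .
  qed (rule polydisc_open_polydisc)
  have Gb: "cmod (G s) \<le> C * T 0" if "s \<in> disc0 d K" for s
    using tail[OF that, of 0] by simp
  have Z: "mero_bigo d K 0 (\<lambda>n s. G s / Q s)"
    by (rule mero_bigoI[OF 1(1), where g = "\<lambda>n. G" and C = "C * T 0"]) (use Gh Gb in auto)
  have "mero_bigo d K M (\<lambda>N s. (\<Sum>n=1..<N. f n s) - G s / Q s)"
  proof (rule mero_bigoI[OF 1(1), where g = "\<lambda>N s. (\<Sum>n=1..<N. g n s) - G s" and C = "C * T 0"])
    fix N :: nat assume N: "N \<ge> 1"
    show "holo_on (disc0 d K) (\<lambda>s. (\<Sum>n=1..<N. g n s) - G s)"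
      by (intro holo_on_diff holo_on_sum 1 Gh) auto
    fix s assume s: "s \<in> disc0 d K"
    obtain N' where N': "N = Suc N'" using N by (cases N) auto
    have eq: "(\<Sum>n=1..<N. h n) = (\<Sum>n<N'. h (Suc n))" for h :: "nat \<Rightarrow> complex"
      unfolding N' by (simp add: atLeastLessThanSuc_atLeastAtMost sum.atLeast1_atMost_eq del: sum.op_ivl_Suc)
    have "cmod ((\<Sum>n=1..<N. g n s) - G s) \<le> C * real N powr (-M) * T N'"
      using tail[OF s, of N'] unfolding eq[of "\<lambda>n. g n s"] by (simp only: N')
    also have "\<dots> \<le> C * real N powr (-M) * T 0"
      using T_le 1(2) by (intro mult_left_mono) auto
    finally show "cmod ((\<Sum>n=1..<N. g n s) - G s) \<le> C * T 0 * real N powr (-M)"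
      by (simp add: mult_ac)
    assume "Q s \<noteq> 0"
    then have "(\<Sum>n=1..<N. f n s) = (\<Sum>n=1..<N. g n s) / Q s"
      unfolding sum_divide_distrib by (intro sum.cong refl 1) (use s in auto)
    then show "(\<Sum>n=1..<N. f n s) - G s / Q s = ((\<Sum>n=1..<N. g n s) - G s) / Q s"
      by (simp add: diff_divide_distrib)
  qed
  with Z that show ?thesis by blast
qed

section \<open>Asymptotics of power sums\<close>

text \<open>Write (n + 1)^\<beta> as n^\<beta> (1 + 1/n)^\<beta> and use the Taylor remainder of (1
  + x)^\<beta> on the segment from 0 to 1. The point is that C is uniform in all \<beta> of modulus
  at most A.\<close>

lemma binomial_error_bound:
  fixes A :: real and J :: nat
  obtains C where "C \<ge> 0" "\<And>\<beta> n. cmod \<beta> \<le> A \<Longrightarrow> n \<ge> 1 \<Longrightarrow>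
     cmod (of_nat (Suc n) powr \<beta> - (\<Sum>j\<le>J. (\<beta> gchoose j) * of_nat n powr (\<beta> - of_nat j)))
       \<le> C * real n powr (Re \<beta> - real J - 1)"
proof -
  \<comment> \<open>Bound for the derivative of order J + 1 on the segment: the first factor is for
    the product of the \<beta> - l with l \<le> J, the second for the remaining power of 1 + x,
    which lies between 1 and 2.\<close>
  define C where "C = (\<bar>A\<bar> + real J) ^ Suc J * 2 powr \<bar>A\<bar>"
  have bound: "cmod (of_nat (Suc n) powr \<beta> - (\<Sum>j\<le>J. (\<beta> gchoose j) * of_nat n powr (\<beta> - of_nat j)))
       \<le> C * real n powr (Re \<beta> - real J - 1)" if \<beta>: "cmod \<beta> \<le> A" and n: "n \<ge> 1" for \<beta> n
  proof -
    define D where "D i = (\<Prod>l<i. \<beta> - of_nat l)" for i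
    define f where "f i x = D i * (1 + x) powr (\<beta> - of_nat i)" for i x
    define S where "S = closed_segment (0::complex) 1"
    have S: "x \<in> \<real>" "0 \<le> Re x" "Re x \<le> 1" if "x \<in> S" for x
      using that by (auto simp: S_def in_segment scaleR_conv_of_real)
    define z where "z = 1 / (of_nat n :: complex)"
    have zS: "z \<in> S"
      unfolding S_def z_def in_segment using n
      by (intro exI[of _ "1 / real n"]) (auto simp: scaleR_conv_of_real)
    have "cmod (f 0 z - (\<Sum>i\<le>J. f i 0 * (z - 0) ^ i / fact i)) \<le> C * cmod (z - 0) ^ Suc J / fact J"
    proof (rule complex_Taylor)
      show "convex S" by (simp add: S_def)
      fix i x assume x: "x \<in> S"
      have "1 + x \<notin> \<real>\<^sub>\<le>\<^sub>0"
        using S[OF x] by (auto simp: complex_nonpos_Reals_iff)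
      then have "(f i has_field_derivative D i * ((\<beta> - of_nat i) * (1 + x) powr (\<beta> - of_nat i - 1))) (at x)"
        unfolding f_def by (auto intro!: derivative_eq_intros)
      also have "D i * ((\<beta> - of_nat i) * (1 + x) powr (\<beta> - of_nat i - 1)) = f (Suc i) x"
        by (simp add: f_def D_def algebra_simps)
      finally show "(f i has_field_derivative f (Suc i) x) (at x within S)"
        by (rule has_field_derivative_at_within)
    next
      fix x assume x: "x \<in> S"
      have "cmod (D (Suc J)) \<le> (\<Prod>l<Suc J. \<bar>A\<bar> + real J)"
        unfolding D_def prod_norm[symmetric]
      proof (intro prod_mono conjI norm_ge_zero)
        fix l assume "l \<in> {..<Suc J}"
        then have "cmod (\<beta> - of_nat l) \<le> cmod \<beta> + real l"
          using norm_triangle_ineq4[of \<beta> "of_nat l"] by simp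
        then show "cmod (\<beta> - of_nat l) \<le> \<bar>A\<bar> + real J" using \<beta> \<open>l \<in> _\<close> by auto
      qed
      then have 1: "cmod (D (Suc J)) \<le> (\<bar>A\<bar> + real J) ^ Suc J" by simp
      have x1: "1 + x = of_real (1 + Re x)" using S[OF x] by (simp add: complex_is_Real_iff complex_eq_iff)
      have "cmod ((1 + x) powr (\<beta> - of_nat (Suc J))) = (1 + Re x) powr (Re \<beta> - real (Suc J))"
        unfolding x1 using S[OF x] by (subst norm_powr_real_powr) auto
      also have "\<dots> \<le> (1 + Re x) powr \<bar>A\<bar>"
        using S[OF x] \<beta> complex_Re_le_cmod[of \<beta>] by (intro powr_mono) auto
      also have "\<dots> \<le> 2 powr \<bar>A\<bar>"
        using S[OF x] by (intro powr_mono2) auto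
      finally show "cmod (f (Suc J) x) \<le> C"
        unfolding f_def norm_mult C_def using 1 by (intro mult_mono) auto
    qed (use zS in \<open>auto simp: S_def\<close>)
    moreover have "f i 0 * (z - 0) ^ i / fact i = (\<beta> gchoose i) * z ^ i" for i
      by (simp add: f_def D_def gbinomial_prod_rev atLeast0LessThan)
    ultimately have *: "cmod ((1 + z) powr \<beta> - (\<Sum>i\<le>J. (\<beta> gchoose i) * z ^ i)) \<le> C * cmod z ^ Suc J / fact J"
      by (simp add: f_def D_def)
    have Cnn: "C \<ge> 0" by (simp add: C_def)
    have e1: "of_nat (Suc n) powr \<beta> = of_nat n powr \<beta> * (1 + z) powr \<beta>"
    proof -
      have "of_nat (Suc n) = of_nat n * (1 + z)"
        using n by (simp add: z_def field_simps)
      then show ?thesis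
        using n by (auto simp: z_def intro!: powr_times_real)
    qed
    have e2: "of_nat n powr (\<beta> - of_nat j) = of_nat n powr \<beta> * z ^ j" for j
      using n by (simp add: z_def powr_diff powr_nat power_one_over divide_inverse power_inverse)
    have "of_nat (Suc n) powr \<beta> - (\<Sum>j\<le>J. (\<beta> gchoose j) * of_nat n powr (\<beta> - of_nat j))
       = of_nat n powr \<beta> * ((1 + z) powr \<beta> - (\<Sum>i\<le>J. (\<beta> gchoose i) * z ^ i))"
      unfolding e1 e2 by (simp add: algebra_simps sum_distrib_left)
    also have "cmod \<dots> \<le> real n powr Re \<beta> * (C * cmod z ^ Suc J / fact J)"
      unfolding norm_mult norm_of_nat_powr[OF n] using * by (intro mult_left_mono) auto
    also have "\<dots> \<le> real n powr Re \<beta> * (C * cmod z ^ Suc J)"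
    proof (rule mult_left_mono)
      have "C * cmod z ^ Suc J / fact J \<le> C * cmod z ^ Suc J / 1"
        using Cnn by (intro divide_left_mono fact_ge_1) auto
      then show "C * cmod z ^ Suc J / fact J \<le> C * cmod z ^ Suc J" by simp
    qed auto
    also have "cmod z ^ Suc J = real n powr (- (real J + 1))"
    proof -
      have "real n powr (real J + 1) = real n ^ Suc J"
        using n powr_realpow[of "real n" "Suc J"] by (simp add: add.commute)
      then have "real n powr (- (real J + 1)) = 1 / real n ^ Suc J"
        by (simp only: powr_minus_divide)
      then show ?thesis
        by (simp only: z_def norm_divide power_one_over norm_one norm_of_nat)
    qed
    also have "real n powr Re \<beta> * (C * real n powr (- (real J + 1))) = C * real n powr (Re \<beta> - real J - 1)"
      by (simp add: powr_add[symmetric] mult_ac algebra_simps)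
    finally show ?thesis .
  qed
  show ?thesis by (rule that[of C]) (use bound in \<open>auto simp: C_def\<close>)
qed

abbreviation osc :: "complex \<Rightarrow> nat \<Rightarrow> int \<Rightarrow> nat \<Rightarrow> complex list \<Rightarrow> complex" where
  "osc \<xi> i k N s \<equiv> (\<xi>^N) * of_nat N powr (of_int k - prefix_sum i s)"

text \<open>The leading coefficient is recorded, because only it contributes to the constant term at a
  point of the closure of the domain \<open>U_dom z\<close>.\<close>

definition expansion :: "nat \<Rightarrow> real \<Rightarrow> real \<Rightarrow> complex \<Rightarrow> nat \<Rightarrow> int \<Rightarrow> (complex list \<Rightarrow> complex) \<Rightarrow>
    (nat \<Rightarrow> complex list \<Rightarrow> complex) \<Rightarrow> bool" where
  "expansion d K M \<xi> i k lead f \<longleftrightarrow> (\<exists>J c. (\<forall>m. mero_bigo d K 0 (\<lambda>n. c m)) \<and> (\<forall>m>J. c m = (\<lambda>s. 0)) \<and> c 0 = lead \<and>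
     mero_bigo d K M (\<lambda>N s. f N s - (\<Sum>m\<le>J. c m s * (osc \<xi> i (k - int m) N s))))"

text \<open>Coefficients beyond \<open>J\<close> vanish, so the cut-off may be raised at will, and
  two expansions can be brought to the same length.\<close>

definition expansion_rep where
  "expansion_rep d K M \<xi> i k lead f J c \<longleftrightarrow> (\<forall>m. mero_bigo d K 0 (\<lambda>n. c m)) \<and> (\<forall>m>J. c m = (\<lambda>s. 0)) \<and> c 0 = lead \<and>
     (\<forall>J'\<ge>J. mero_bigo d K M (\<lambda>N s. f N s - (\<Sum>m\<le>J'. c m s * (osc \<xi> i (k - int m) N s))))"

lemma expansion_repD:
  assumes "expansion_rep d K M \<xi> i k lead f J c"
  shows "\<And>m. mero_bigo d K 0 (\<lambda>n. c m)" "\<And>m. m > J \<Longrightarrow> c m = (\<lambda>s. 0)" "c 0 = lead"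
    "\<And>J'. J' \<ge> J \<Longrightarrow> mero_bigo d K M (\<lambda>N s. f N s - (\<Sum>m\<le>J'. c m s * (osc \<xi> i (k - int m) N s)))"
  using assms unfolding expansion_rep_def by blast+

lemma expansionE:
  assumes "expansion d K M \<xi> i k lead f"
  obtains J c where "expansion_rep d K M \<xi> i k lead f J c"
proof -
  obtain J0 c where *: "\<forall>m. mero_bigo d K 0 (\<lambda>n. c m)" "\<forall>m>J0. c m = (\<lambda>s. 0)" "c 0 = lead"
    "mero_bigo d K M (\<lambda>N s. f N s - (\<Sum>m\<le>J0. c m s * (osc \<xi> i (k - int m) N s)))"
    using assms unfolding expansion_def by blast
  have eq: "(\<Sum>m\<le>J. c m s * (osc \<xi> i (k - int m) N s))
      = (\<Sum>m\<le>J0. c m s * (osc \<xi> i (k - int m) N s))" if "J \<ge> J0" for J N s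
    by (rule sum.mono_neutral_right) (use that *(2) in auto)
  have H: "mero_bigo d K M (\<lambda>N s. f N s - (\<Sum>m\<le>J. c m s * (osc \<xi> i (k - int m) N s)))"
    if "J \<ge> J0" for J unfolding eq[OF that] using *(4) by blast
  show ?thesis
    by (rule that[of J0 c]) (use *(1-3) H in \<open>unfold expansion_rep_def, blast\<close>)
qed

lemma expansion_add:
  assumes "expansion d K M \<xi> i k l1 f1" "expansion d K M \<xi> i k l2 f2"
  shows "expansion d K M \<xi> i k (\<lambda>s. l1 s + l2 s) (\<lambda>N s. f1 N s + f2 N s)"
proof -
  obtain J1 c1 where "expansion_rep d K M \<xi> i k l1 f1 J1 c1"
    by (rule expansionE[OF assms(1)])
  note 1 = expansion_repD[OF this]
  obtain J2 c2 where "expansion_rep d K M \<xi> i k l2 f2 J2 c2"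
    by (rule expansionE[OF assms(2)])
  note 2 = expansion_repD[OF this]
  show ?thesis
    unfolding expansion_def
  proof (intro exI[of _ "max J1 J2"] exI[of _ "\<lambda>m s. c1 m s + c2 m s"] conjI allI impI)
    show "mero_bigo d K M (\<lambda>N s. f1 N s + f2 N s - (\<Sum>m\<le>max J1 J2. (c1 m s + c2 m s) *
        (osc \<xi> i (k - int m) N s)))"
      by (rule mero_bigo_cong[OF mero_bigo_add[OF 1(4)[of "max J1 J2"] 2(4)[of "max J1 J2"]]])
         (auto simp: ring_distribs sum.distrib)
  qed (use 1 2 in \<open>auto intro: mero_bigo_add\<close>)
qed

lemma expansion_mult:
  assumes "mero_bigo d K 0 (\<lambda>n. b)" "expansion d K M \<xi> i k l f"
  shows "expansion d K M \<xi> i k (\<lambda>s. b s * l s) (\<lambda>N s. b s * f N s)"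
proof -
  obtain J c where "expansion_rep d K M \<xi> i k l f J c"
    by (rule expansionE[OF assms(2)])
  note 1 = expansion_repD[OF this]
  show ?thesis
    unfolding expansion_def
  proof (intro exI[of _ J] exI[of _ "\<lambda>m s. b s * c m s"] conjI allI impI)
    show "mero_bigo d K M (\<lambda>N s. b s * f N s - (\<Sum>m\<le>J. b s * c m s *
        (osc \<xi> i (k - int m) N s)))"
      by (rule mero_bigo_cong[OF mero_bigo_mult0[OF assms(1) 1(4)[of J]]])
         (auto simp: right_diff_distrib sum_distrib_left mult.assoc)
  qed (use 1 assms in \<open>auto intro: mero_bigo_mult0\<close>)
qed

text \<open>Lower exponents enter only through positive m, so they leave the leading coefficient at
  0. This keeps corrections out of the leading term.\<close>

lemma expansion_shift:
  assumes "expansion d K M \<xi> i (k - int j) l f" "j \<ge> 1"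
  shows "expansion d K M \<xi> i k (\<lambda>s. 0) f"
proof -
  obtain J c where "expansion_rep d K M \<xi> i (k - int j) l f J c"
    by (rule expansionE[OF assms(1)])
  note 1 = expansion_repD[OF this]
  define c' where "c' m = (if m < j then (\<lambda>s. 0) else c (m - j))" for m
  have eq: "(\<Sum>m\<le>j + J. c' m s * (osc \<xi> i (k - int m) N s))
      = (\<Sum>m\<le>J. c m s * (osc \<xi> i (k - int j - int m) N s))" for N s
  proof -
    have "(\<Sum>m\<le>j + J. c' m s * (osc \<xi> i (k - int m) N s))
        = (\<Sum>m\<in>{j..j + J}. c' m s * (osc \<xi> i (k - int m) N s))"
      by (rule sum.mono_neutral_right) (auto simp: c'_def)
    also have "\<dots> = (\<Sum>m\<le>J. c m s * (osc \<xi> i (k - int j - int m) N s))"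
      by (rule sum.reindex_bij_witness[where i = "\<lambda>m. m + j" and j = "\<lambda>m. m - j"])
         (auto simp: c'_def of_nat_diff)
    finally show ?thesis .
  qed
  show ?thesis
    unfolding expansion_def
  proof (intro exI[of _ "j + J"] exI[of _ c'] conjI allI impI)
    show "mero_bigo d K 0 (\<lambda>n. c' m)" for m
      using 1(1)[of "m - j"] by (auto simp: c'_def intro: mero_bigo_zero)
    show "mero_bigo d K M (\<lambda>N s. f N s - (\<Sum>m\<le>j + J. c' m s * (osc \<xi> i (k - int m) N s)))"
      unfolding eq by (rule 1(4)) simp
  qed (use 1(2) assms(2) in \<open>auto simp: c'_def\<close>)
qed

lemma expansion_term:
  assumes "mero_bigo d K 0 (\<lambda>n. l)"
  shows "expansion d K M \<xi> i k l (\<lambda>N s. l s * (osc \<xi> i k N s))"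
  unfolding expansion_def
  by (intro exI[of _ 0] exI[of _ "\<lambda>m. if m = 0 then l else (\<lambda>s. 0)"]) (use assms in \<open>auto intro: mero_bigo_zero\<close>)

lemma expansion_mero_bigo:
  assumes "mero_bigo d K M f"
  shows "expansion d K M \<xi> i k (\<lambda>s. 0) f"
  unfolding expansion_def
  by (intro exI[of _ 0] exI[of _ "\<lambda>m s. 0"]) (use assms in \<open>auto intro: mero_bigo_zero\<close>)

text \<open>So far down, the leading term is itself within the error and its coefficient can be
  prescribed freely. This starts the recursion of \<open>sum_power_expansion\<close> with the right
  leading coefficient.\<close>

lemma expansion_mero_bigo_lead:
  assumes "mero_bigo d K M f" "mero_bigo d K 0 (\<lambda>n. l)" "cmod \<xi> = 1" "i \<le> d" "of_int k + real i * K \<le> - M"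
  shows "expansion d K M \<xi> i k l f"
proof -
  have "mero_bigo d K M (\<lambda>N s. osc \<xi> i k N s)"
    by (rule mero_bigo_mult0[OF mero_bigo_unit[OF assms(3)] mero_bigo_powr[OF assms(4)]]) (use assms in auto)
  then have "mero_bigo d K M (\<lambda>N s. f N s - l s * (osc \<xi> i k N s))"
    by (rule mero_bigo_diff[OF assms(1) mero_bigo_mult0[OF assms(2)]])
  from expansion_add[OF expansion_mero_bigo[OF this, of \<xi> i k] expansion_term[OF assms(2), of M \<xi> i k]]
  show ?thesis by simp
qed

lemma expansion_cong:
  assumes "expansion d K M \<xi> i k l f" "\<And>N s. N \<ge> 1 \<Longrightarrow> s \<in> disc0 d K \<Longrightarrow> f N s = f' N s"
  shows "expansion d K M \<xi> i k l f'"
proof -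
  obtain J c where "expansion_rep d K M \<xi> i k l f J c"
    by (rule expansionE[OF assms(1)])
  note 1 = expansion_repD[OF this]
  show ?thesis
    unfolding expansion_def
    by (intro exI[of _ J] exI[of _ c] conjI allI impI mero_bigo_cong[OF 1(4)[of J]]) (use 1 assms in auto)
qed

lemma expansion_sum:
  assumes "\<And>j. j \<in> I \<Longrightarrow> expansion d K M \<xi> i k (l j) (f j)"
  shows "expansion d K M \<xi> i k (\<lambda>s. \<Sum>j\<in>I. l j s) (\<lambda>N s. \<Sum>j\<in>I. f j N s)"
  using assms
  by (induction I rule: infinite_finite_induct) (auto intro: expansion_mero_bigo mero_bigo_zero expansion_add)

lemma mero_bigo_gchoose:
  assumes "i \<le> d"
  shows "mero_bigo d K 0 (\<lambda>n s. (of_int k - prefix_sum i s) gchoose j)"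
proof -
  have *: "mero_bigo d K 0 (\<lambda>n s. of_int k - prefix_sum i s - of_nat l)" for l
  proof -
    have "mero_bigo d K 0 (\<lambda>n s. - (of_nat l - of_int k + (\<Sum>p\<in>{..<i}. s ! p)))"
      by (intro mero_bigo_uminus mero_bigo_form) (use assms in auto)
    then show ?thesis by (simp add: prefix_sum_def algebra_simps)
  qed
  have "mero_bigo d K 0 (\<lambda>n s. (1 / fact j) * (\<Prod>l\<in>{0..<j}. of_int k - prefix_sum i s - of_nat l))"
    by (intro mero_bigo_cmult mero_bigo_prod *)
  then show ?thesis by (simp add: gbinomial_prod_rev)
qed

text \<open>The gain in the exponent when \<xi>^n n^w is summed over n < N: one power of N without
  oscillation, none for \<xi> \<noteq> 1.\<close>

definition one_ind :: "complex \<Rightarrow> int" where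
  "one_ind \<xi> = (if \<xi> = 1 then 1 else 0)"

text \<open>Coefficient of the leading power of N in the sum of the terms
  \<open>osc \<xi> i k n s\<close>: as for the integral of a power if \<xi> = 1, as for a geometric
  sum otherwise.\<close>

definition sum_factor :: "complex \<Rightarrow> nat \<Rightarrow> int \<Rightarrow> complex list \<Rightarrow> complex" where
  "sum_factor \<xi> i k s = (if \<xi> = 1 then 1 / (of_int (k + 1) - prefix_sum i s) else 1 / (\<xi> - 1))"

lemma mero_bigo_sum_factor:
  assumes "1 \<le> i" "i \<le> d"
  shows "mero_bigo d K 0 (\<lambda>n. sum_factor \<xi> i k)"
proof (cases "\<xi> = 1")
  case True
  have "mero_bigo d K 0 (\<lambda>n s. - (1 / (- of_int (k + 1) + (\<Sum>p\<in>{..<i}. s ! p))))"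
    by (intro mero_bigo_uminus mero_bigo_inv_form) (use assms in \<open>auto simp: lessThan_empty_iff\<close>)
  moreover have "- (1 / (- of_int (k + 1) + (\<Sum>p\<in>{..<i}. s ! p))) = 1 / (of_int (k + 1) - prefix_sum i s)" for s
    using minus_divide_right[of 1 "- of_int (k + 1) + prefix_sum i s"] by (simp add: prefix_sum_def)
  ultimately show ?thesis using True by (simp add: sum_factor_def[abs_def])
next
  case False
  then show ?thesis using mero_bigo_const[of d K "1 / (\<xi> - 1)"] by (simp add: sum_factor_def[abs_def])
qed

lemma mero_bigo_binomial_error:
  assumes "i \<le> d" "M \<ge> 0" "K > 0"
  obtains J where "J \<ge> 1" "mero_bigo d K M (\<lambda>n s. of_nat (Suc n) powr (of_int k - prefix_sum i s)
    - (\<Sum>j\<le>J. ((of_int k - prefix_sum i s) gchoose j) * of_nat n powr (of_int (k - int j) - prefix_sum i s)))"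
proof -
  \<comment> \<open>\<open>A\<close> bounds the modulus of the exponent on the polydisc, and
    \<open>J\<close> is so large that the remainder exponent Re \<beta> - J - 1 is at most
    -M.\<close>
  define A where "A = \<bar>real_of_int k\<bar> + real i * K"
  define J where "J = nat \<lceil>A + M + 1\<rceil>"
  have A: "A \<ge> 0" using assms by (simp add: A_def)
  have J: "real J \<ge> A + M + 1" unfolding J_def by linarith
  have J1: "J \<ge> 1" using J A assms(2) by linarith
  obtain C where C: "C \<ge> 0" "\<And>\<beta> n. cmod \<beta> \<le> A \<Longrightarrow> n \<ge> 1 \<Longrightarrow>
     cmod (of_nat (Suc n) powr \<beta> - (\<Sum>j\<le>J. (\<beta> gchoose j) * of_nat n powr (\<beta> - of_nat j)))
       \<le> C * real n powr (Re \<beta> - real J - 1)"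
    using binomial_error_bound[of A J] by blast
  have len: "length s = d" if "s \<in> disc0 d K" for s using that by (simp add: disc0_iff)
  have "mero_bigo d K M (\<lambda>n s. of_nat (Suc n) powr (of_int k - prefix_sum i s)
    - (\<Sum>j\<le>J. ((of_int k - prefix_sum i s) gchoose j) * of_nat n powr (of_int (k - int j) - prefix_sum i s)))"
  proof (rule mero_bigo_holo[where C = C])
    fix n :: nat assume n: "n \<ge> 1"
    have gc: "holo_on (disc0 d K) (\<lambda>s. (of_int k - prefix_sum i s) gchoose j)" for j
    proof -
      have "holo_on (disc0 d K) (\<lambda>s. (\<Prod>l\<in>{0..<j}. of_int k - prefix_sum i s - of_nat l) * (1 / fact j))"
        by (intro holo_on_mult holo_on_prod holo_on_diff holo_on_const prefix_sum_holo[OF assms(1)] len)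
      then show ?thesis by (simp add: gbinomial_prod_rev)
    qed
    show "holo_on (disc0 d K) (\<lambda>s. of_nat (Suc n) powr (of_int k - prefix_sum i s)
      - (\<Sum>j\<le>J. ((of_int k - prefix_sum i s) gchoose j) * of_nat n powr (of_int (k - int j) - prefix_sum i s)))"
      using n by (intro holo_on_mult holo_on_sum holo_on_diff holo_on_const gc holo_on_npowr
          prefix_sum_holo[OF assms(1)] len) auto
    fix s assume s: "s \<in> disc0 d K"
    define \<beta> where "\<beta> = of_int k - prefix_sum i s"
    have "cmod \<beta> \<le> cmod (of_int k) + cmod (prefix_sum i s)"
      unfolding \<beta>_def by (rule norm_triangle_ineq4)
    then have \<beta>: "cmod \<beta> \<le> A" using prefix_sum_bound[OF assms(1) s] by (simp add: A_def)
    have eq: "of_int (k - int j) - prefix_sum i s = \<beta> - of_nat j" for j by (simp add: \<beta>_def)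
    have "cmod (of_nat (Suc n) powr \<beta> - (\<Sum>j\<le>J. (\<beta> gchoose j) * of_nat n powr (\<beta> - of_nat j)))
       \<le> C * real n powr (Re \<beta> - real J - 1)" using C(2)[OF \<beta> n] .
    also have "\<dots> \<le> C * real n powr (- M)"
      using C(1) n J \<beta> complex_Re_le_cmod[of \<beta>] by (intro mult_left_mono powr_mono) auto
    finally show "cmod (of_nat (Suc n) powr (of_int k - prefix_sum i s)
      - (\<Sum>j\<le>J. ((of_int k - prefix_sum i s) gchoose j) * of_nat n powr (of_int (k - int j) - prefix_sum i s)))
      \<le> C * real n powr - M"
      unfolding eq by (simp add: \<beta>_def)
  qed
  with J1 that show ?thesis by blast
qed

text \<open>The power \<open>\<xi>^n n^w\<close> is a multiple of the difference of \<open>\<xi>^n n^(w + one_ind \<xi>)\<close>, up to powers with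
  exponent lowered by a positive integer.\<close>

lemma difference_step:
  assumes "1 \<le> i" "i \<le> d" "M \<ge> 0" "K > 0" "cmod \<xi> = 1"
  obtains J b where "\<And>j. mero_bigo d K 0 (\<lambda>n. b j)"
    "mero_bigo d K M (\<lambda>n s. osc \<xi> i k n s
       - sum_factor \<xi> i k s * (osc \<xi> i (k + one_ind \<xi>) (Suc n) s
            - osc \<xi> i (k + one_ind \<xi>) n s)
       - (\<Sum>j=1..J. b j s * (osc \<xi> i (k - int j) n s)))"
proof -
  define k' where "k' = k + one_ind \<xi>"
  define \<beta> where "\<beta> s = of_int k' - prefix_sum i s" for s
  obtain J where J: "J \<ge> 1" and err: "mero_bigo d K M (\<lambda>n s. of_nat (Suc n) powr (of_int k' - prefix_sum i s)
    - (\<Sum>j\<le>J. ((of_int k' - prefix_sum i s) gchoose j) * of_nat n powr (of_int (k' - int j) - prefix_sum i s)))"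
    using mero_bigo_binomial_error[OF assms(2,3,4), of k'] by blast
  define E where "E n s = of_nat (Suc n) powr (of_int k' - prefix_sum i s)
    - (\<Sum>j\<le>J. ((of_int k' - prefix_sum i s) gchoose j) * of_nat n powr (of_int (k' - int j) - prefix_sum i s))" for n s
  have gc: "mero_bigo d K 0 (\<lambda>n s. \<beta> s gchoose j)" for j
    unfolding \<beta>_def by (rule mero_bigo_gchoose[OF assms(2)])
  have sf: "mero_bigo d K 0 (\<lambda>n. sum_factor \<xi> i k)" by (rule mero_bigo_sum_factor[OF assms(1,2)])
  have res: "mero_bigo d K M (\<lambda>n s. - (sum_factor \<xi> i k s * (\<xi> * (\<xi> ^ n * E n s))))"
    unfolding E_def by (intro mero_bigo_uminus mero_bigo_mult0[OF sf] mero_bigo_cmult mero_bigo_mult0[OF mero_bigo_unit[OF assms(5)]] err)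
  have Suc_pow: "of_nat (Suc n) powr (of_int k' - prefix_sum i s) = of_nat n powr (of_int k' - prefix_sum i s) +
      (\<Sum>j=1..J. (\<beta> s gchoose j) * of_nat n powr (of_int (k' - int j) - prefix_sum i s)) + E n s" for n and s :: "complex list"
    unfolding E_def \<beta>_def atMost_atLeast0 by (simp add: sum.atLeast_Suc_atMost)
  show ?thesis
  proof (cases "\<xi> = 1")
    case False
    have [simp]: "k' = k" using False by (simp add: k'_def one_ind_def)
    \<comment> \<open>For \<xi> \<noteq> 1 the zeroth binomial term survives in the difference with
      the factor \<xi> - 1, which \<open>sum_factor\<close> cancels; the terms with j \<ge> 1 are
      corrections.\<close>
    define b where "b j s = - (sum_factor \<xi> i k s * (\<xi> * (\<beta> s gchoose j)))" for j s
    have "mero_bigo d K 0 (\<lambda>n. b j)" for j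
      unfolding b_def by (intro mero_bigo_uminus mero_bigo_mult0[OF sf] mero_bigo_cmult gc)
    moreover have "mero_bigo d K M (\<lambda>n s. osc \<xi> i k n s
       - sum_factor \<xi> i k s * (\<xi> ^ Suc n * of_nat (Suc n) powr (of_int k' - prefix_sum i s)
            - \<xi> ^ n * of_nat n powr (of_int k' - prefix_sum i s))
       - (\<Sum>j=1..J. b j s * (osc \<xi> i (k - int j) n s)))"
    proof (rule mero_bigo_cong[OF res])
      fix n :: nat and s :: "complex list"
      define u where "u = of_nat n powr (of_int k - prefix_sum i s)"
      define X where "X = (\<Sum>j=1..J. (\<beta> s gchoose j) * of_nat n powr (of_int (k - int j) - prefix_sum i s))"
      have bX: "(\<Sum>j=1..J. b j s * (osc \<xi> i (k - int j) n s))
          = - (sum_factor \<xi> i k s * \<xi> * \<xi> ^ n) * X"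
        unfolding X_def b_def sum_distrib_left by (intro sum.cong) auto
      have sfv: "sum_factor \<xi> i k s * (\<xi> - 1) = 1" using False by (simp add: sum_factor_def)
      have "\<xi> ^ n * u - sum_factor \<xi> i k s * (\<xi> ^ Suc n * (u + X + E n s) - \<xi> ^ n * u) + sum_factor \<xi> i k s * \<xi> * \<xi> ^ n * X
         = \<xi> ^ n * u * (1 - sum_factor \<xi> i k s * (\<xi> - 1)) - sum_factor \<xi> i k s * (\<xi> * (\<xi> ^ n * E n s))"
        by (simp add: algebra_simps)
      then show "- (sum_factor \<xi> i k s * (\<xi> * (\<xi> ^ n * E n s))) =
           \<xi> ^ n * of_nat n powr (of_int k - prefix_sum i s) - sum_factor \<xi> i k s *
           (\<xi> ^ Suc n * of_nat (Suc n) powr (of_int k' - prefix_sum i s) - \<xi> ^ n * of_nat n powr (of_int k' - prefix_sum i s)) -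
           (\<Sum>j = 1..J. b j s * (osc \<xi> i (k - int j) n s))"
        unfolding Suc_pow bX sfv using u_def X_def by simp
    qed
    ultimately show ?thesis using that unfolding k'_def by blast
  next
    case True
    have k': "k' = k + 1" using True by (simp add: k'_def one_ind_def)
    \<comment> \<open>For \<xi> = 1 the zeroth term cancels, and the term j = 1, with coefficient
      \<open>\<beta> s\<close> and exponent k' - 1 = k, becomes the main one. The corrections
      therefore use \<open>Suc j\<close> and stop at J - 1.\<close>
    define b where "b j s = - (sum_factor \<xi> i k s * (\<beta> s gchoose Suc j))" for j s
    have bq: "mero_bigo d K 0 (\<lambda>n. b j)" for j
      unfolding b_def by (intro mero_bigo_uminus mero_bigo_mult0[OF sf] gc)
    \<comment> \<open>Up to sign, \<open>sum_factor\<close> is the inverse of this form. At its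
      zeros the inverse is 0 by convention and the identity may fail, so they are absorbed into the
      denominator.\<close>
    have lp: "form_product d (\<lambda>s. - of_int k' + (\<Sum>p\<in>{..<i}. s ! p))"
      by (rule form_product_form) (use assms in \<open>auto simp: lessThan_empty_iff\<close>)
    have "mero_bigo d K M (\<lambda>n s. osc \<xi> i k n s
       - sum_factor \<xi> i k s * (\<xi> ^ Suc n * of_nat (Suc n) powr (of_int k' - prefix_sum i s)
            - \<xi> ^ n * of_nat n powr (of_int k' - prefix_sum i s))
       - (\<Sum>j=1..J-1. b j s * (osc \<xi> i (k - int j) n s)))"
    proof (rule mero_bigo_cong_off_form_zeros[OF res lp])
      fix n :: nat and s :: "complex list" assume nz: "- of_int k' + (\<Sum>p\<in>{..<i}. s ! p) \<noteq> 0"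
      define X where "X = (\<Sum>j=1..J-1. (\<beta> s gchoose Suc j) * of_nat n powr (of_int (k - int j) - prefix_sum i s))"
      have bX: "(\<Sum>j=1..J-1. b j s * (osc \<xi> i (k - int j) n s))
          = - sum_factor \<xi> i k s * X"
        unfolding X_def b_def sum_distrib_left using True by (intro sum.cong) auto
      have \<beta>0: "\<beta> s \<noteq> 0" using nz by (simp add: \<beta>_def prefix_sum_def)
      have sfv: "sum_factor \<xi> i k s * \<beta> s = 1" using True \<beta>0 by (simp add: sum_factor_def \<beta>_def k')
      have "{1..J} = insert 1 (Suc ` {1..J-1})"
        using J by (auto simp: image_Suc_atLeastAtMost)
      then have S: "(\<Sum>j=1..J. (\<beta> s gchoose j) * of_nat n powr (of_int (k' - int j) - prefix_sum i s))
          = \<beta> s * of_nat n powr (of_int k - prefix_sum i s) + X"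
      proof -
        have "(\<Sum>j\<in>Suc ` {1..J-1}. (\<beta> s gchoose j) * of_nat n powr (of_int (k' - int j) - prefix_sum i s)) = X"
          unfolding X_def by (subst sum.reindex) (simp_all add: k')
        then show ?thesis
          unfolding \<open>{1..J} = insert 1 (Suc ` {1..J-1})\<close> by (subst sum.insert) (auto simp: k')
      qed
      show "- (sum_factor \<xi> i k s * (\<xi> * (\<xi> ^ n * E n s))) =
           \<xi> ^ n * of_nat n powr (of_int k - prefix_sum i s) - sum_factor \<xi> i k s *
           (\<xi> ^ Suc n * of_nat (Suc n) powr (of_int k' - prefix_sum i s) - \<xi> ^ n * of_nat n powr (of_int k' - prefix_sum i s)) -
           (\<Sum>j = 1..J-1. b j s * (osc \<xi> i (k - int j) n s))"
        unfolding Suc_pow bX S using sfv True by (simp add: algebra_simps)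
    qed
    then show ?thesis using that bq unfolding k'_def by blast
  qed
qed

text \<open>\<open>difference_step\<close> reduces the sum to a telescoping one and to sums with
  smaller k. The recursion on k stops once the terms decay fast enough for
  \<open>mero_bigo_suminf\<close>.\<close>

lemma sum_power_expansion:
  assumes i: "1 \<le> i" "i \<le> d" and M: "M \<ge> 0" and K: "K > 0" and \<xi>: "cmod \<xi> = 1"
  shows "\<exists>Z. mero_bigo d K 0 (\<lambda>n. Z) \<and> expansion d K M \<xi> i (k + one_ind \<xi>) (sum_factor \<xi> i k)
     (\<lambda>N s. (\<Sum>n=1..<N. osc \<xi> i k n s) - Z s)"
proof -
  \<comment> \<open>For k \<le> -B the terms are O(n^-(M + 2)) throughout the polydisc, and even the
    raised leading power with k + 1 is within the error.\<close>
  define B where "B = nat \<lceil>real i * K + M + 2\<rceil>"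
  have B: "real B \<ge> real i * K + M + 2" unfolding B_def by linarith
  show ?thesis
  proof (induction "nat (k + int B)" arbitrary: k rule: less_induct)
    case (less k)
    show ?case
    proof (cases "k \<le> - int B")
      case True
      then have kB: "real_of_int k \<le> - real B" by linarith
      have "mero_bigo d K (M + 2) (\<lambda>n s. osc \<xi> i k n s)"
        by (rule mero_bigo_mult0[OF mero_bigo_unit[OF \<xi>] mero_bigo_powr[OF i(2)]]) (use B kB in auto)
      then obtain Z where Z: "mero_bigo d K 0 (\<lambda>n. Z)"
        "mero_bigo d K M (\<lambda>N s. (\<Sum>n=1..<N. osc \<xi> i k n s) - Z s)"
        using mero_bigo_suminf[OF _ M] by blast
      have "expansion d K M \<xi> i (k + one_ind \<xi>) (sum_factor \<xi> i k)
         (\<lambda>N s. (\<Sum>n=1..<N. osc \<xi> i k n s) - Z s)"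
        by (rule expansion_mero_bigo_lead[OF Z(2) mero_bigo_sum_factor[OF i] \<xi> i(2)])
           (use B kB in \<open>auto simp: one_ind_def\<close>)
      with Z show ?thesis by blast
    next
      case False
      obtain J b where b: "\<And>j. mero_bigo d K 0 (\<lambda>n. b j)"
        "mero_bigo d K (M + 2) (\<lambda>n s. osc \<xi> i k n s
           - sum_factor \<xi> i k s * (osc \<xi> i (k + one_ind \<xi>) (Suc n) s
                - osc \<xi> i (k + one_ind \<xi>) n s)
           - (\<Sum>j=1..J. b j s * (osc \<xi> i (k - int j) n s)))"
        by (rule difference_step[OF i _ K \<xi>, of "M + 2" k]) (use M in simp, blast)
      define rem where "rem n s = osc \<xi> i k n s
           - sum_factor \<xi> i k s * (osc \<xi> i (k + one_ind \<xi>) (Suc n) s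
                - osc \<xi> i (k + one_ind \<xi>) n s)
           - (\<Sum>j=1..J. b j s * (osc \<xi> i (k - int j) n s))" for n s
      obtain Zr where Zr: "mero_bigo d K 0 (\<lambda>n. Zr)" "mero_bigo d K M (\<lambda>N s. (\<Sum>n=1..<N. rem n s) - Zr s)"
        using mero_bigo_suminf[OF b(2) M] unfolding rem_def by blast
      have "\<forall>j\<in>{1..J}. \<exists>Z. mero_bigo d K 0 (\<lambda>n. Z) \<and> expansion d K M \<xi> i (k - int j + one_ind \<xi>) (sum_factor \<xi> i (k - int j))
         (\<lambda>N s. (\<Sum>n=1..<N. osc \<xi> i (k - int j) n s) - Z s)"
      proof
        fix j assume "j \<in> {1..J}"
        then have "nat (k - int j + int B) < nat (k + int B)" using False by auto
        then show "\<exists>Z. mero_bigo d K 0 (\<lambda>n. Z) \<and> expansion d K M \<xi> i (k - int j + one_ind \<xi>) (sum_factor \<xi> i (k - int j))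
         (\<lambda>N s. (\<Sum>n=1..<N. osc \<xi> i (k - int j) n s) - Z s)"
          by (rule less.hyps)
      qed
      from bchoice[OF this] obtain Zj where Zj: "\<And>j. j \<in> {1..J} \<Longrightarrow> mero_bigo d K 0 (\<lambda>n. Zj j)"
        "\<And>j. j \<in> {1..J} \<Longrightarrow> expansion d K M \<xi> i (k - int j + one_ind \<xi>) (sum_factor \<xi> i (k - int j))
         (\<lambda>N s. (\<Sum>n=1..<N. osc \<xi> i (k - int j) n s) - Zj j s)"
        by blast
      \<comment> \<open>The term with \<xi> is the lower end of the telescoping sum, at n = 1; the
        others are the constants left by the smaller sums and by the remainder.\<close>
      define Z where "Z s = - (sum_factor \<xi> i k s * \<xi>) + (\<Sum>j=1..J. b j s * Zj j s) + Zr s" for s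
      have Zq: "mero_bigo d K 0 (\<lambda>n. Z)"
        unfolding Z_def
        by (intro mero_bigo_add mero_bigo_uminus mero_bigo_mult0 mero_bigo_sum mero_bigo_const mero_bigo_sum_factor i b Zj Zr)
      have e1: "expansion d K M \<xi> i (k + one_ind \<xi>) (sum_factor \<xi> i k) (\<lambda>N s. sum_factor \<xi> i k s * (osc \<xi> i (k + one_ind \<xi>) N s))"
        by (rule expansion_term[OF mero_bigo_sum_factor[OF i]])
      have e2: "expansion d K M \<xi> i (k + one_ind \<xi>) (\<lambda>s. \<Sum>j=1..J. 0) (\<lambda>N s. \<Sum>j=1..J.
          b j s * ((\<Sum>n=1..<N. osc \<xi> i (k - int j) n s) - Zj j s))"
      proof (rule expansion_sum)
        fix j assume j: "j \<in> {1..J}"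
        have "expansion d K M \<xi> i (k + one_ind \<xi> - int j) (\<lambda>s. b j s * sum_factor \<xi> i (k - int j) s) (\<lambda>N s.
          b j s * ((\<Sum>n=1..<N. osc \<xi> i (k - int j) n s) - Zj j s))"
          using expansion_mult[OF b(1) Zj(2)[OF j], of j] by (simp add: algebra_simps)
        then show "expansion d K M \<xi> i (k + one_ind \<xi>) (\<lambda>s. 0) (\<lambda>N s.
          b j s * ((\<Sum>n=1..<N. osc \<xi> i (k - int j) n s) - Zj j s))"
          by (rule expansion_shift) (use j in auto)
      qed
      have e3: "expansion d K M \<xi> i (k + one_ind \<xi>) (\<lambda>s. 0) (\<lambda>N s. (\<Sum>n=1..<N. rem n s) - Zr s)"
        by (rule expansion_mero_bigo[OF Zr(2)])
      have "expansion d K M \<xi> i (k + one_ind \<xi>) (sum_factor \<xi> i k)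
         (\<lambda>N s. (\<Sum>n=1..<N. osc \<xi> i k n s) - Z s)"
      proof (rule expansion_cong)
        show "expansion d K M \<xi> i (k + one_ind \<xi>) (sum_factor \<xi> i k) (\<lambda>N s.
          sum_factor \<xi> i k s * (osc \<xi> i (k + one_ind \<xi>) N s)
          + (\<Sum>j=1..J. b j s * ((\<Sum>n=1..<N. osc \<xi> i (k - int j) n s) - Zj j s))
          + ((\<Sum>n=1..<N. rem n s) - Zr s))"
          using expansion_add[OF expansion_add[OF e1 e2] e3] by simp
        fix N :: nat and s assume N: "N \<ge> 1"
        let ?v = "\<lambda>n. osc \<xi> i (k + one_ind \<xi>) n s"
        have "(\<Sum>n=1..<N. osc \<xi> i k n s) =
          (\<Sum>n=1..<N. sum_factor \<xi> i k s * (?v (Suc n) - ?v n)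
             + (\<Sum>j=1..J. b j s * (osc \<xi> i (k - int j) n s)) + rem n s)"
          unfolding rem_def by (intro sum.cong) auto
        also have "\<dots> = sum_factor \<xi> i k s * (\<Sum>n=1..<N. ?v (Suc n) - ?v n)
             + (\<Sum>j=1..J. b j s * (\<Sum>n=1..<N. osc \<xi> i (k - int j) n s))
             + (\<Sum>n=1..<N. rem n s)"
          unfolding sum.distrib sum_distrib_left by (subst (2) sum.swap) simp
        also have "(\<Sum>n=1..<N. ?v (Suc n) - ?v n) = ?v N - \<xi>"
          using sum_Suc_diff'[of 1 N ?v] N by simp
        finally show "sum_factor \<xi> i k s * (osc \<xi> i (k + one_ind \<xi>) N s)
          + (\<Sum>j=1..J. b j s * ((\<Sum>n=1..<N. osc \<xi> i (k - int j) n s) - Zj j s))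
          + ((\<Sum>n=1..<N. rem n s) - Zr s)
          = (\<Sum>n=1..<N. osc \<xi> i k n s) - Z s"
          unfolding Z_def by (simp add: algebra_simps sum_subtractf)
      qed
      with Zq show ?thesis by blast
    qed
  qed
qed

text \<open>Only the term m = 0 reaches the new leading exponent; the sums of the terms with m \<ge>
  1 start lower. So the leading coefficient is simply multiplied by
  \<open>sum_factor \<xi> i k\<close>.\<close>

lemma expansion_summation:
  assumes i: "1 \<le> i" "i \<le> d" and M: "M \<ge> 0" and K: "K > 0" and \<xi>: "cmod \<xi> = 1"
    and f: "expansion d K (M + 2) \<xi> i k l f"
  obtains Z where "mero_bigo d K 0 (\<lambda>n. Z)" "expansion d K M \<xi> i (k + one_ind \<xi>) (\<lambda>s. l s * sum_factor \<xi> i k s)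
     (\<lambda>N s. (\<Sum>n=1..<N. f n s) - Z s)"
proof -
  obtain J c where "expansion_rep d K (M + 2) \<xi> i k l f J c"
    by (rule expansionE[OF f])
  note c = expansion_repD[OF this]
  define rem where "rem n s = f n s - (\<Sum>m\<le>J. c m s * (osc \<xi> i (k - int m) n s))" for n s
  obtain Zr where Zr: "mero_bigo d K 0 (\<lambda>n. Zr)" "mero_bigo d K M (\<lambda>N s. (\<Sum>n=1..<N. rem n s) - Zr s)"
    using mero_bigo_suminf[OF c(4)[of J] M] unfolding rem_def by blast
  obtain Zm where Zm: "\<And>m. mero_bigo d K 0 (\<lambda>n. Zm m)"
    "\<And>m. expansion d K M \<xi> i (k - int m + one_ind \<xi>) (sum_factor \<xi> i (k - int m))
     (\<lambda>N s. (\<Sum>n=1..<N. osc \<xi> i (k - int m) n s) - Zm m s)"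
    using choice[OF allI, of "\<lambda>m Z. mero_bigo d K 0 (\<lambda>n. Z) \<and> expansion d K M \<xi> i (k - int m + one_ind \<xi>) (sum_factor \<xi> i (k - int m))
     (\<lambda>N s. (\<Sum>n=1..<N. osc \<xi> i (k - int m) n s) - Z s)",
      OF sum_power_expansion[OF i M K \<xi>]] by blast
  define Z where "Z s = (\<Sum>m\<le>J. c m s * Zm m s) + Zr s" for s
  have Zq: "mero_bigo d K 0 (\<lambda>n. Z)"
    unfolding Z_def by (intro mero_bigo_add mero_bigo_mult0 mero_bigo_sum c Zm Zr)
  have e0: "expansion d K M \<xi> i (k - int m + one_ind \<xi>) (\<lambda>s. c m s * sum_factor \<xi> i (k - int m) s) (\<lambda>N s.
      c m s * ((\<Sum>n=1..<N. osc \<xi> i (k - int m) n s) - Zm m s))" for m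
    by (rule expansion_mult[OF c(1) Zm(2)])
  have e2: "expansion d K M \<xi> i (k + one_ind \<xi>) (\<lambda>s. \<Sum>m\<le>J. if m = 0 then l s * sum_factor \<xi> i k s else 0) (\<lambda>N s. \<Sum>m\<le>J.
      c m s * ((\<Sum>n=1..<N. osc \<xi> i (k - int m) n s) - Zm m s))"
  proof (rule expansion_sum)
    fix m
    show "expansion d K M \<xi> i (k + one_ind \<xi>) (\<lambda>s. if m = 0 then l s * sum_factor \<xi> i k s else 0) (\<lambda>N s.
      c m s * ((\<Sum>n=1..<N. osc \<xi> i (k - int m) n s) - Zm m s))"
    proof (cases "m = 0")
      case True then show ?thesis using e0[of 0] c(3) by simp
    next
      case False
      have "expansion d K M \<xi> i (k + one_ind \<xi> - int m) (\<lambda>s. c m s * sum_factor \<xi> i (k - int m) s) (\<lambda>N s.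
          c m s * ((\<Sum>n=1..<N. osc \<xi> i (k - int m) n s) - Zm m s))"
        using e0[of m] by (simp add: algebra_simps)
      from expansion_shift[OF this] False show ?thesis by simp
    qed
  qed
  have e3: "expansion d K M \<xi> i (k + one_ind \<xi>) (\<lambda>s. 0) (\<lambda>N s. (\<Sum>n=1..<N. rem n s) - Zr s)"
    by (rule expansion_mero_bigo[OF Zr(2)])
  have "expansion d K M \<xi> i (k + one_ind \<xi>) (\<lambda>s. l s * sum_factor \<xi> i k s) (\<lambda>N s. (\<Sum>n=1..<N. f n s) - Z s)"
  proof (rule expansion_cong)
    show "expansion d K M \<xi> i (k + one_ind \<xi>) (\<lambda>s. l s * sum_factor \<xi> i k s) (\<lambda>N s. (\<Sum>m\<le>J.
      c m s * ((\<Sum>n=1..<N. osc \<xi> i (k - int m) n s) - Zm m s))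
      + ((\<Sum>n=1..<N. rem n s) - Zr s))"
      using expansion_add[OF e2 e3] by (simp add: sum.delta)
    fix N :: nat and s assume N: "N \<ge> 1"
    have "(\<Sum>n=1..<N. f n s) =
      (\<Sum>n=1..<N. (\<Sum>m\<le>J. c m s * (osc \<xi> i (k - int m) n s)) + rem n s)"
      unfolding rem_def by (intro sum.cong) auto
    also have "\<dots> = (\<Sum>m\<le>J. c m s * (\<Sum>n=1..<N. osc \<xi> i (k - int m) n s))
         + (\<Sum>n=1..<N. rem n s)"
      unfolding sum.distrib sum_distrib_left by (subst sum.swap) simp
    finally show "(\<Sum>m\<le>J. c m s * ((\<Sum>n=1..<N. osc \<xi> i (k - int m) n s) - Zm m s))
      + ((\<Sum>n=1..<N. rem n s) - Zr s) = (\<Sum>n=1..<N. f n s) - Z s"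
      unfolding Z_def by (simp add: algebra_simps sum_subtractf)
  qed
  with Zq that show ?thesis by blast
qed

section \<open>Truncated multiple polylogarithms\<close>

text \<open>Exceptional sets of a known shape: they are closed under finite unions, since the
  products multiply, and the property implies \<open>generically\<close>.\<close>

definition off_form_zeros :: "nat \<Rightarrow> real \<Rightarrow> (complex list \<Rightarrow> bool) \<Rightarrow> bool" where
  "off_form_zeros d K P \<longleftrightarrow> (\<exists>Q. form_product d Q \<and> (\<forall>s\<in>disc0 d K. Q s \<noteq> 0 \<longrightarrow> P s))"

lemma off_form_zeros_conj:
  assumes "off_form_zeros d K P1" "off_form_zeros d K P2" shows "off_form_zeros d K (\<lambda>s. P1 s \<and> P2 s)"
proof -
  obtain Q1 Q2 where "form_product d Q1" "\<forall>s\<in>disc0 d K. Q1 s \<noteq> 0 \<longrightarrow> P1 s"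
    "form_product d Q2" "\<forall>s\<in>disc0 d K. Q2 s \<noteq> 0 \<longrightarrow> P2 s"
    using assms unfolding off_form_zeros_def by blast
  then show ?thesis
    unfolding off_form_zeros_def by (intro exI[of _ "\<lambda>s. Q1 s * Q2 s"]) (auto intro: form_product_mult)
qed

lemma off_form_zeros_mono: "off_form_zeros d K P \<Longrightarrow> (\<And>s. s \<in> disc0 d K \<Longrightarrow> P s \<Longrightarrow> P' s) \<Longrightarrow> off_form_zeros d K P'"
  unfolding off_form_zeros_def by blast

lemma off_form_zeros_I: "(\<And>s. s \<in> disc0 d K \<Longrightarrow> P s) \<Longrightarrow> off_form_zeros d K P"
  unfolding off_form_zeros_def using form_product.one by blast

lemma off_form_zeros_finite:
  "finite I \<Longrightarrow> (\<And>i. i \<in> I \<Longrightarrow> off_form_zeros d K (P i)) \<Longrightarrow> off_form_zeros d K (\<lambda>s. \<forall>i\<in>I. P i s)"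
proof (induction I rule: finite_induct)
  case empty then show ?case by (auto intro: off_form_zeros_I)
next
  case (insert i I)
  then have "off_form_zeros d K (\<lambda>s. P i s \<and> (\<forall>i\<in>I. P i s))" by (intro off_form_zeros_conj) auto
  then show ?case by simp
qed

lemma off_form_zeros_generically:
  assumes "off_form_zeros d K P" shows "generically (disc0 d K) P"
proof -
  obtain Q where Q: "form_product d Q" "\<forall>s\<in>disc0 d K. Q s \<noteq> 0 \<longrightarrow> P s"
    using assms unfolding off_form_zeros_def by blast
  have "generically (disc0 d K) (\<lambda>s. Q s \<noteq> 0)"
    by (rule form_product_generically[OF Q(1)]) (simp add: disc0_iff)
  then show ?thesis by (rule generically_mono) (use Q in auto)
qed

fun Li_partial :: "complex list \<Rightarrow> complex list \<Rightarrow> nat \<Rightarrow> complex" where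
  "Li_partial [] s N = 1"
| "Li_partial (w # ws) s N = (\<Sum>n=1..<N. w ^ n * of_nat n powr (- (s ! 0)) * Li_partial ws (drop 1 s) n)"

text \<open>The index set of \<open>reg_partial\<close>, named so that it can be split along its
  first and largest entry.\<close>

definition dec_tuples :: "nat \<Rightarrow> nat \<Rightarrow> nat list set" where
  "dec_tuples r N = {ns. length ns = r \<and> sorted_wrt (\<lambda>x y. x > y) ns \<and> (\<forall>n\<in>set ns. 0 < n \<and> n < N)}"

lemma dec_tuples_0: "dec_tuples 0 N = {[]}"
  by (auto simp: dec_tuples_def)

lemma dec_tuples_Suc:
  "dec_tuples (Suc r) N = (\<lambda>(n, ns). n # ns) ` (SIGMA n:{1..<N}. dec_tuples r n)"
proof (intro set_eqI iffI)
  fix xs assume "xs \<in> dec_tuples (Suc r) N"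
  then show "xs \<in> (\<lambda>(n, ns). n # ns) ` (SIGMA n:{1..<N}. dec_tuples r n)"
    by (cases xs) (auto simp: dec_tuples_def image_iff)
next
  fix xs assume "xs \<in> (\<lambda>(n, ns). n # ns) ` (SIGMA n:{1..<N}. dec_tuples r n)"
  then show "xs \<in> dec_tuples (Suc r) N"
    by (fastforce simp: dec_tuples_def)
qed

lemma finite_dec_tuples: "finite (dec_tuples r N)"
  by (induction r arbitrary: N) (auto simp: dec_tuples_0 dec_tuples_Suc)

lemma sum_dec_tuples_Suc:
  fixes f :: "nat list \<Rightarrow> complex"
  shows "(\<Sum>ns\<in>dec_tuples (Suc r) N. f ns) = (\<Sum>n=1..<N. \<Sum>ns\<in>dec_tuples r n. f (n # ns))"
proof -
  have "inj_on (\<lambda>(n, ns). n # ns) A" for A :: "(nat \<times> nat list) set"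
    by (auto simp: inj_on_def)
  then show ?thesis
    unfolding dec_tuples_Suc by (subst sum.reindex) (auto simp: sum.Sigma finite_dec_tuples intro!: sum.cong)
qed

lemma Li_partial_eq_sum:
  "length s = length z \<Longrightarrow> Li_partial z s N = (\<Sum>ns\<in>dec_tuples (length z) N.
     \<Prod>j<length z. z ! j ^ (ns ! j) * of_nat (ns ! j) powr (- (s ! j)))"
proof (induction z arbitrary: s N)
  case Nil then show ?case by (simp add: dec_tuples_0)
next
  case (Cons w ws)
  then obtain a s' where s: "s = a # s'" "length s' = length ws" by (cases s) auto
  show ?case
    unfolding list.size add_0_right add_Suc_right
    by (subst sum_dec_tuples_Suc)
       (simp add: s Cons.IH prod.lessThan_Suc_shift sum_distrib_left del: prod.lessThan_Suc)
qed

definition prefix_prod :: "complex list \<Rightarrow> nat \<Rightarrow> complex" where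
  "prefix_prod z i = (\<Prod>p<i. z ! p)"

text \<open>The number of \<open>k \<le> i\<close> with \<open>zprod z k i = 1\<close>, see \<open>exp_shift_unroll\<close>.\<close>

fun exp_shift :: "complex list \<Rightarrow> nat \<Rightarrow> int" where
  "exp_shift z 0 = 0"
| "exp_shift z (Suc i) = exp_shift (drop 1 z) i + one_ind (prefix_prod z (Suc i))"

text \<open>On the index set this is \<open>(-1)^i\<close> over the product of the factors \<open>Hfun\<close>, see \<open>lead_factor_eq_Hfun\<close>.\<close>

fun lead_factor :: "complex list \<Rightarrow> nat \<Rightarrow> complex list \<Rightarrow> complex" where
  "lead_factor z 0 s = 1"
| "lead_factor z (Suc i) s = lead_factor (drop 1 z) i (drop 1 s) * sum_factor (prefix_prod z (Suc i)) (Suc i) (exp_shift (drop 1 z) i) s"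

text \<open>Describes the continued polylogarithm by truncated sums. The limit is required on the
  open set where all real parts exceed 1, from which the identity theorem determines \<Lambda>, and
  only away from zeros of forms, because \<open>mero_bigo\<close> leaves \<Lambda> unspecified
  there.\<close>

definition Li_cont :: "real \<Rightarrow> complex list \<Rightarrow> (complex list \<Rightarrow> complex) \<Rightarrow> bool" where
  "Li_cont K w \<Lambda> \<longleftrightarrow> mero_bigo (length w) K 0 (\<lambda>n. \<Lambda>) \<and>
     off_form_zeros (length w) K (\<lambda>s. (\<forall>j<length w. Re (s ! j) > 1) \<longrightarrow> (\<lambda>N. Li_partial w s N) \<longlonglongrightarrow> \<Lambda> s)"

lemma exp_shift_le: "exp_shift z i \<le> int i"
proof (induction i arbitrary: z)
  case (Suc i)
  show ?case using Suc[of "drop 1 z"] by (simp add: one_ind_def)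
qed simp

lemma cmod_prefix_prod: "(\<And>x. x \<in> set z \<Longrightarrow> cmod x = 1) \<Longrightarrow> i \<le> length z \<Longrightarrow> cmod (prefix_prod z i) = 1"
  unfolding prefix_prod_def prod_norm[symmetric] by (intro prod.neutral) auto

lemma prefix_prod_Cons: "prefix_prod (w # ws) (Suc i) = w * prefix_prod ws i"
  unfolding prefix_prod_def by (simp add: prod.lessThan_Suc_shift del: prod.lessThan_Suc)

lemma prefix_sum_Suc: "s \<noteq> [] \<Longrightarrow> prefix_sum (Suc i) s = s ! 0 + prefix_sum i (drop 1 s)"
  unfolding prefix_sum_def by (cases s) (simp_all add: sum.lessThan_Suc_shift del: sum.lessThan_Suc)

lemma mero_bigo_tl: "mero_bigo d K M f \<Longrightarrow> mero_bigo (Suc d) K M (\<lambda>n s. f n (drop 1 s))"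
  using mero_bigo_drop[of d K M f 1] by simp

text \<open>The new factor prepends w to the prefix product and \<open>s ! 0\<close> to the prefix
  sum. On the polydisc it can grow like n^K, hence the loss of K in the error.\<close>

lemma expansion_lift:
  assumes f: "expansion d K M \<xi> i k l f" and w: "cmod w = 1" and i: "i \<le> d"
  shows "expansion (Suc d) K (M - K) (w * \<xi>) (Suc i) k (\<lambda>s. l (drop 1 s))
     (\<lambda>n s. w ^ n * of_nat n powr (- (s ! 0)) * f n (drop 1 s))"
proof -
  obtain J c where "expansion_rep d K M \<xi> i k l f J c"
    by (rule expansionE[OF f])
  note c = expansion_repD[OF this]
  have p: "mero_bigo (Suc d) K (- K) (\<lambda>n s. of_nat n powr (of_int 0 - prefix_sum 1 s))"
    by (rule mero_bigo_powr) auto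
  have q: "mero_bigo (Suc d) K (M - K) (\<lambda>N s. (osc w 1 0 N s) *
      (f N (drop 1 s) - (\<Sum>m\<le>J. c m (drop 1 s) * (osc \<xi> i (k - int m) N (drop 1 s)))))"
    using mero_bigo_mult[OF mero_bigo_mult0[OF mero_bigo_unit[OF w] p] mero_bigo_tl[OF c(4)[OF order_refl]]] by simp
  show ?thesis
    unfolding expansion_def
  proof (intro exI[of _ J] exI[of _ "\<lambda>m s. c m (drop 1 s)"] conjI allI impI)
    show "mero_bigo (Suc d) K 0 (\<lambda>n s. c m (drop 1 s))" for m
      by (rule mero_bigo_tl[OF c(1)])
    show "mero_bigo (Suc d) K (M - K) (\<lambda>N s. w ^ N * of_nat N powr (- (s ! 0)) * f N (drop 1 s) -
        (\<Sum>m\<le>J. c m (drop 1 s) * (osc (w * \<xi>) (Suc i) (k - int m) N s)))"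
    proof (rule mero_bigo_cong[OF q])
      fix n :: nat and s :: "complex list" assume "s \<in> disc0 (Suc d) K"
      then have ne: "s \<noteq> []" by (auto dest: polydisc_length)
      have e: "of_nat n powr (of_int (k - int m) - prefix_sum (Suc i) s)
         = of_nat n powr (- (s ! 0)) * of_nat n powr (of_int (k - int m) - prefix_sum i (drop 1 s))" for m
        unfolding powr_add[symmetric] prefix_sum_Suc[OF ne] by (simp add: algebra_simps)
      show "(osc w 1 0 n s) *
        (f n (drop 1 s) - (\<Sum>m\<le>J. c m (drop 1 s) * (osc \<xi> i (k - int m) n (drop 1 s))))
        = w ^ n * of_nat n powr (- (s ! 0)) * f n (drop 1 s) -
        (\<Sum>m\<le>J. c m (drop 1 s) * (osc (w * \<xi>) (Suc i) (k - int m) n s))"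
        unfolding e right_diff_distrib sum_distrib_left
        by (intro arg_cong2[of _ _ _ _ "(-)"] sum.cong) (simp_all add: prefix_sum_def power_mult_distrib)
    qed
  qed (use c in auto)
qed

lemma mero_bigo_tendsto_0:
  assumes f: "mero_bigo d K M f" and M: "M > 0"
  shows "off_form_zeros d K (\<lambda>s. (\<lambda>N. f N s) \<longlonglongrightarrow> 0)"
proof -
  obtain Q g C where "mero_bigo_rep d K M f Q g C"
    by (rule mero_bigoE[OF f])
  note 1 = mero_bigo_repD[OF this]
  have p: "(\<lambda>n. real n powr (- M)) \<longlonglongrightarrow> 0"
    using M by real_asymp
  show ?thesis
    unfolding off_form_zeros_def
  proof (intro exI[of _ Q] conjI ballI impI 1(1))
    fix s assume s: "s \<in> disc0 d K" "Q s \<noteq> 0"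
    have "(\<lambda>n. C / cmod (Q s) * real n powr (- M)) \<longlonglongrightarrow> 0"
      using tendsto_mult_right_zero[OF p] by blast
    then show "(\<lambda>N. f N s) \<longlonglongrightarrow> 0"
    proof (rule Lim_null_comparison[rotated])
      show "\<forall>\<^sub>F n in sequentially. cmod (f n s) \<le> C / cmod (Q s) * real n powr (- M)"
        using eventually_ge_at_top[of 1]
      proof eventually_elim
        case (elim n)
        then show ?case
          using 1(4)[OF elim s(1)] 1(5)[OF elim s] s by (simp add: norm_divide divide_right_mono)
      qed
    qed
  qed
qed

lemma npowr_tendsto_0:
  assumes "cmod \<xi> = 1" "Re w < 0"
  shows "(\<lambda>N. \<xi> ^ N * of_nat N powr w) \<longlonglongrightarrow> 0"
proof -
  have "(\<lambda>n. real n powr Re w) \<longlonglongrightarrow> 0" using assms by real_asymp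
  then show ?thesis
  proof (rule Lim_null_comparison[rotated])
    show "\<forall>\<^sub>F n in sequentially. cmod (\<xi> ^ n * of_nat n powr w) \<le> real n powr Re w"
      using eventually_ge_at_top[of 1]
      by eventually_elim (use assms in \<open>simp add: norm_mult norm_power norm_of_nat_powr\<close>)
  qed
qed

lemma expansion_tendsto_0:
  assumes f: "expansion d K M \<xi> i k l f" and M: "M > 0" and \<xi>: "cmod \<xi> = 1"
  shows "off_form_zeros d K (\<lambda>s. Re (prefix_sum i s) > of_int k \<longrightarrow> (\<lambda>N. f N s) \<longlonglongrightarrow> 0)"
proof -
  obtain J c where "expansion_rep d K M \<xi> i k l f J c"
    by (rule expansionE[OF f])
  note c = expansion_repD[OF this]
  show ?thesis
  proof (rule off_form_zeros_mono[OF mero_bigo_tendsto_0[OF c(4)[OF order_refl] M]], intro impI)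
    fix s assume 1: "(\<lambda>N. f N s - (\<Sum>m\<le>J. c m s * (osc \<xi> i (k - int m) N s))) \<longlonglongrightarrow> 0"
      and 2: "of_int k < Re (prefix_sum i s)"
    have "(\<lambda>N. \<Sum>m\<le>J. c m s * (osc \<xi> i (k - int m) N s)) \<longlonglongrightarrow> (\<Sum>m\<le>J. c m s * 0)"
      by (intro tendsto_sum tendsto_mult_left npowr_tendsto_0 \<xi>) (use 2 in auto)
    from tendsto_add[OF 1 this] show "(\<lambda>N. f N s) \<longlonglongrightarrow> 0" by simp
  qed
qed

text \<open>Prepending w and summing turns the i-th term for the tail into the (i + 1)-st. The
  constants set free by the summations add up to the new term 0, which is the continued
  polylogarithm because every other term tends to 0 where all real parts exceed 1.\<close>

lemma Li_partial_expansion: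
  assumes K: "K > 0"
  shows "(\<And>x. x \<in> set z \<Longrightarrow> cmod x = 1) \<Longrightarrow> M \<ge> 1 \<Longrightarrow>
   \<exists>Lm X. (\<forall>i\<le>length z. Li_cont K (drop i z) (Lm i) \<and>
      expansion (length z) K M (prefix_prod z i) i (exp_shift z i) (\<lambda>s. Lm i (drop i s) * lead_factor z i s) (X i)) \<and>
     mero_bigo (length z) K M (\<lambda>N s. Li_partial z s N - (\<Sum>i\<le>length z. X i N s))"
proof (induction z arbitrary: M)
  case Nil
  have "expansion 0 K M 1 0 0 (\<lambda>s. 1) (\<lambda>N s. 1)"
    by (rule expansion_cong[OF expansion_term[OF mero_bigo_const, of 0 K M 1 0 0 1]]) (auto simp: prefix_sum_def)
  then show ?case
    by (intro exI[of _ "\<lambda>i s. 1"] exI[of _ "\<lambda>i N s. 1"])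
       (auto simp: Li_cont_def prefix_prod_def mero_bigo_zero intro: mero_bigo_const off_form_zeros_I)
next
  case (Cons w ws)
  define d where "d = length ws"
  \<comment> \<open>Pays K for \<open>expansion_lift\<close> and 2 for
    \<open>expansion_summation\<close>.\<close>
  define M' where "M' = M + 2 + K"
  have w: "cmod w = 1" and ws: "\<And>x. x \<in> set ws \<Longrightarrow> cmod x = 1" using Cons.prems by auto
  have M: "M \<ge> 1" using Cons.prems by auto
  obtain Lm' X' where IH: "\<And>i. i \<le> d \<Longrightarrow> Li_cont K (drop i ws) (Lm' i)"
      "\<And>i. i \<le> d \<Longrightarrow> expansion d K M' (prefix_prod ws i) i (exp_shift ws i) (\<lambda>s. Lm' i (drop i s) * lead_factor ws i s) (X' i)"
      "mero_bigo d K M' (\<lambda>N s. Li_partial ws s N - (\<Sum>i\<le>d. X' i N s))"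
    using Cons.IH[OF ws, of M'] M K unfolding d_def M'_def by auto
  define f where "f i n s = w ^ n * of_nat n powr (- (s ! 0)) * X' i n (drop 1 s)" for i n s
  have ef: "expansion (Suc d) K (M + 2) (prefix_prod (w # ws) (Suc i)) (Suc i) (exp_shift ws i)
      (\<lambda>s. Lm' i (drop i (drop 1 s)) * lead_factor ws i (drop 1 s)) (f i)" if "i \<le> d" for i
    using expansion_lift[OF IH(2)[OF that] w that] unfolding f_def[abs_def] prefix_prod_Cons M'_def by simp
  have pzn: "cmod (prefix_prod (w # ws) i) = 1" if "i \<le> Suc d" for i
    using cmod_prefix_prod[of "w # ws" i] Cons.prems that by (auto simp: d_def)
  have "\<forall>i\<in>{..d}. \<exists>Z. mero_bigo (Suc d) K 0 (\<lambda>n. Z) \<and> expansion (Suc d) K M (prefix_prod (w # ws) (Suc i)) (Suc i)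
      (exp_shift ws i + one_ind (prefix_prod (w # ws) (Suc i)))
      (\<lambda>s. Lm' i (drop i (drop 1 s)) * lead_factor ws i (drop 1 s) * sum_factor (prefix_prod (w # ws) (Suc i)) (Suc i) (exp_shift ws i) s)
      (\<lambda>N s. (\<Sum>n=1..<N. f i n s) - Z s)"
  proof
    fix i assume "i \<in> {..d}"
    then have i: "i \<le> d" by simp
    show "\<exists>Z. mero_bigo (Suc d) K 0 (\<lambda>n. Z) \<and> expansion (Suc d) K M (prefix_prod (w # ws) (Suc i)) (Suc i)
      (exp_shift ws i + one_ind (prefix_prod (w # ws) (Suc i)))
      (\<lambda>s. Lm' i (drop i (drop 1 s)) * lead_factor ws i (drop 1 s) * sum_factor (prefix_prod (w # ws) (Suc i)) (Suc i) (exp_shift ws i) s)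
      (\<lambda>N s. (\<Sum>n=1..<N. f i n s) - Z s)"
      by (rule expansion_summation[OF _ _ _ K pzn ef[OF i]]) (use i M in auto)
  qed
  from bchoice[OF this] obtain Z where Z: "\<And>i. i \<le> d \<Longrightarrow> mero_bigo (Suc d) K 0 (\<lambda>n. Z i)"
    "\<And>i. i \<le> d \<Longrightarrow> expansion (Suc d) K M (prefix_prod (w # ws) (Suc i)) (Suc i)
      (exp_shift ws i + one_ind (prefix_prod (w # ws) (Suc i)))
      (\<lambda>s. Lm' i (drop i (drop 1 s)) * lead_factor ws i (drop 1 s) * sum_factor (prefix_prod (w # ws) (Suc i)) (Suc i) (exp_shift ws i) s)
      (\<lambda>N s. (\<Sum>n=1..<N. f i n s) - Z i s)"
    unfolding Ball_def atMost_iff by blast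
  \<comment> \<open>The error of the expansion of the tail. After multiplication by the new factor
    it is still O(n^-(M + 2)), so its sum converges and adds one more constant.\<close>
  define rem where "rem n s = w ^ n * of_nat n powr (- (s ! 0)) *
      (Li_partial ws (drop 1 s) n - (\<Sum>i\<le>d. X' i n (drop 1 s)))" for n s
  have "mero_bigo (Suc d) K (M + 2) rem"
  proof -
    have p: "mero_bigo (Suc d) K (- K) (\<lambda>n s. of_nat n powr (of_int 0 - prefix_sum 1 s))"
      by (rule mero_bigo_powr) auto
    have "mero_bigo (Suc d) K (M + 2) (\<lambda>n s. (osc w 1 0 n s) *
      (Li_partial ws (drop 1 s) n - (\<Sum>i\<le>d. X' i n (drop 1 s))))"
      using mero_bigo_mult[OF mero_bigo_mult0[OF mero_bigo_unit[OF w] p] mero_bigo_tl[OF IH(3)]]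
      by (simp add: M'_def)
    then show ?thesis by (simp add: rem_def[abs_def] prefix_sum_def)
  qed
  then obtain Zr where Zr: "mero_bigo (Suc d) K 0 (\<lambda>n. Zr)"
      "mero_bigo (Suc d) K M (\<lambda>N s. (\<Sum>n=1..<N. rem n s) - Zr s)"
    using mero_bigo_suminf[of "Suc d" K M rem] M by auto
  define \<Lambda> where "\<Lambda> s = (\<Sum>i\<le>d. Z i s) + Zr s" for s
  have \<Lambda>q: "mero_bigo (Suc d) K 0 (\<lambda>n. \<Lambda>)"
    unfolding \<Lambda>_def by (intro mero_bigo_add mero_bigo_sum Z Zr) auto
  define Lm where "Lm i = (case i of 0 \<Rightarrow> \<Lambda> | Suc i \<Rightarrow> Lm' i)" for i
  define X where "X i = (case i of 0 \<Rightarrow> (\<lambda>N. \<Lambda>) | Suc i \<Rightarrow> (\<lambda>N s. (\<Sum>n=1..<N. f i n s) - Z i s))" for i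
  have X0: "expansion (Suc d) K M (prefix_prod (w # ws) 0) 0 (exp_shift (w # ws) 0) (\<lambda>s. Lm 0 (drop 0 s) * lead_factor (w # ws) 0 s) (X 0)"
    using expansion_cong[OF expansion_term[OF \<Lambda>q, of M 1 0 0], of "\<lambda>N. \<Lambda>"]
    by (simp add: Lm_def X_def prefix_prod_def prefix_sum_def)
  have XS: "expansion (Suc d) K M (prefix_prod (w # ws) (Suc i)) (Suc i) (exp_shift (w # ws) (Suc i))
      (\<lambda>s. Lm (Suc i) (drop (Suc i) s) * lead_factor (w # ws) (Suc i) s) (X (Suc i))" if "i \<le> d" for i
    using Z(2)[OF that] by (simp add: Lm_def X_def mult.assoc)
  have main: "mero_bigo (Suc d) K M (\<lambda>N s. Li_partial (w # ws) s N - (\<Sum>i\<le>Suc d. X i N s))"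
  proof (rule mero_bigo_cong[OF Zr(2)])
    fix N :: nat and s :: "complex list"
    have "Li_partial (w # ws) s N = (\<Sum>n=1..<N. (\<Sum>i\<le>d. f i n s) + rem n s)"
      unfolding Li_partial.simps rem_def f_def by (intro sum.cong refl) (simp add: algebra_simps sum_distrib_left)
    also have "\<dots> = (\<Sum>i\<le>d. \<Sum>n=1..<N. f i n s) + (\<Sum>n=1..<N. rem n s)"
      unfolding sum.distrib by (subst sum.swap) simp
    also have "\<dots> = (\<Sum>i\<le>Suc d. X i N s) + ((\<Sum>n=1..<N. rem n s) - Zr s)"
      unfolding sum.atMost_Suc_shift by (simp add: X_def \<Lambda>_def sum_subtractf)
    finally show "(\<Sum>n=1..<N. rem n s) - Zr s = Li_partial (w # ws) s N - (\<Sum>i\<le>Suc d. X i N s)" by simp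
  qed
  have lim: "off_form_zeros (Suc d) K (\<lambda>s. (\<forall>j<Suc d. Re (s ! j) > 1) \<longrightarrow> (\<lambda>N. Li_partial (w # ws) s N) \<longlonglongrightarrow> \<Lambda> s)"
  proof -
    have a1: "off_form_zeros (Suc d) K (\<lambda>s. \<forall>i\<in>{..d}. Re (prefix_sum (Suc i) s) > of_int (exp_shift (w # ws) (Suc i)) \<longrightarrow>
        (\<lambda>N. X (Suc i) N s) \<longlonglongrightarrow> 0)"
      by (intro off_form_zeros_finite expansion_tendsto_0[OF XS] pzn) (use M in auto)
    have a2: "off_form_zeros (Suc d) K (\<lambda>s. (\<lambda>N. Li_partial (w # ws) s N - (\<Sum>i\<le>Suc d. X i N s)) \<longlonglongrightarrow> 0)"
      by (rule mero_bigo_tendsto_0[OF main]) (use M in auto)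
    show ?thesis
    proof (rule off_form_zeros_mono[OF off_form_zeros_conj[OF a1 a2]], elim conjE, intro impI)
      fix s :: "complex list"
      assume 1: "\<forall>i\<in>{..d}. Re (prefix_sum (Suc i) s) > of_int (exp_shift (w # ws) (Suc i)) \<longrightarrow> (\<lambda>N. X (Suc i) N s) \<longlonglongrightarrow> 0"
        and 2: "(\<lambda>N. Li_partial (w # ws) s N - (\<Sum>i\<le>Suc d. X i N s)) \<longlonglongrightarrow> 0"
        and 3: "\<forall>j<Suc d. 1 < Re (s ! j)"
      have "(\<lambda>N. X (Suc i) N s) \<longlonglongrightarrow> 0" if "i \<le> d" for i
      proof -
        \<comment> \<open>Each prefix sum has real part above its length, and
          \<open>exp_shift\<close> is at most that length, so all exponents of the term are
          negative.\<close>
        have "real (Suc i) = (\<Sum>p<Suc i. 1)" by simp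
        also have "\<dots> < (\<Sum>p<Suc i. Re (s ! p))"
          by (rule sum_strict_mono) (use 3 that in auto)
        also have "\<dots> = Re (prefix_sum (Suc i) s)" by (simp add: prefix_sum_def)
        finally have "real_of_int (exp_shift (w # ws) (Suc i)) < Re (prefix_sum (Suc i) s)"
          using exp_shift_le[of "w # ws" "Suc i"] by linarith
        then show ?thesis using 1 that by blast
      qed
      then have "(\<lambda>N. \<Sum>i\<le>d. X (Suc i) N s) \<longlonglongrightarrow> (\<Sum>i\<le>d. 0)"
        by (intro tendsto_sum) auto
      from tendsto_add[OF 2 tendsto_add[OF tendsto_const[of "\<Lambda> s"] this]]
      have "(\<lambda>N. (Li_partial (w # ws) s N - (\<Sum>i\<le>Suc d. X i N s)) + (\<Lambda> s + (\<Sum>i\<le>d. X (Suc i) N s))) \<longlonglongrightarrow> \<Lambda> s"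
        by simp
      then show "(\<lambda>N. Li_partial (w # ws) s N) \<longlonglongrightarrow> \<Lambda> s"
        unfolding sum.atMost_Suc_shift by (simp add: X_def)
    qed
  qed
  have "Li_cont K (drop i (w # ws)) (Lm i) \<and>
      expansion (Suc d) K M (prefix_prod (w # ws) i) i (exp_shift (w # ws) i) (\<lambda>s. Lm i (drop i s) * lead_factor (w # ws) i s) (X i)"
    if "i \<le> Suc d" for i
  proof (cases i)
    case 0
    have "Li_cont K (w # ws) \<Lambda>"
      unfolding Li_cont_def list.size add_0_right add_Suc_right d_def[symmetric]
      by (rule conjI[OF \<Lambda>q lim])
    then show ?thesis using X0 0 by (simp add: Lm_def)
  next
    case (Suc i')
    then show ?thesis using XS[of i'] IH(1)[of i'] that by (simp add: Lm_def)
  qed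
  with main show ?case unfolding list.size add_0_right add_Suc_right d_def by blast
qed

section \<open>Taylor coefficients in several variables\<close>

lemma multi_idx_0: "multi_idx 0 = {[]}"
  by (auto simp: multi_idx_def)

lemma multi_idx_Suc: "multi_idx (Suc r) = (\<lambda>(k, ks). k # ks) ` (SIGMA k:UNIV. multi_idx r)"
proof (intro set_eqI iffI)
  fix xs :: "nat list" assume "xs \<in> multi_idx (Suc r)"
  then show "xs \<in> (\<lambda>(k, ks). k # ks) ` (SIGMA k:UNIV. multi_idx r)"
    by (cases xs) (auto simp: multi_idx_def image_iff)
qed (auto simp: multi_idx_def)

lemma has_sum_multi_idx_Suc:
  "(f has_sum S) (multi_idx (Suc r)) \<longleftrightarrow> ((\<lambda>(k, ks). f (k # ks)) has_sum S) (SIGMA k:UNIV. multi_idx r)"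
proof -
  have "inj_on (\<lambda>(k, ks). k # ks) (SIGMA k:UNIV. multi_idx r)"
    by (auto simp: inj_on_def)
  from has_sum_reindex[OF this, of f S] show ?thesis
    unfolding multi_idx_Suc by (simp add: o_def case_prod_unfold)
qed

lemma summable_on_multi_idx_Suc:
  "f summable_on (multi_idx (Suc r)) \<longleftrightarrow> (\<lambda>(k, ks). f (k # ks)) summable_on (SIGMA k:UNIV. multi_idx r)"
  unfolding summable_on_def has_sum_multi_idx_Suc ..

text \<open>Serves both the geometric majorants of power series and the absolute convergence of
  \<open>Li_series\<close>.\<close>

lemma summable_on_multi_idx_prod:
  fixes f :: "nat \<Rightarrow> nat \<Rightarrow> real"
  assumes "\<And>j n. f j n \<ge> 0" "\<And>j. j < r \<Longrightarrow> f j summable_on UNIV"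
  shows "(\<lambda>ks. \<Prod>j<r. f j (ks ! j)) summable_on multi_idx r"
  using assms
proof (induction r arbitrary: f)
  case 0
  then show ?case by (simp add: multi_idx_0)
next
  case (Suc r)
  let ?g = "\<lambda>ks. \<Prod>j<r. f (Suc j) (ks ! j)"
  have IH: "?g summable_on multi_idx r"
    by (rule Suc.IH) (use Suc.prems in auto)
  have "(\<lambda>(k, ks). f 0 k * ?g ks) summable_on (SIGMA k:UNIV. multi_idx r)"
  proof (rule summable_on_SigmaI)
    show "((\<lambda>ks. case (k, ks) of (k, ks) \<Rightarrow> f 0 k * ?g ks) has_sum f 0 k * infsum ?g (multi_idx r)) (multi_idx r)" for k
      using has_sum_cmult_right[OF has_sum_infsum[OF IH], of "f 0 k"] by simp
    show "(\<lambda>k. f 0 k * infsum ?g (multi_idx r)) summable_on UNIV"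
      by (intro summable_on_cmult_left Suc.prems) auto
  qed (use Suc.prems in \<open>auto intro!: mult_nonneg_nonneg prod_nonneg\<close>)
  then show ?case
    unfolding summable_on_multi_idx_Suc by (simp add: prod.lessThan_Suc_shift del: prod.lessThan_Suc)
qed

lemma power_sum_list: "(t::'a::comm_semiring_1) ^ sum_list ks = (\<Prod>j<length ks. t ^ (ks ! j))"
  by (induction ks) (simp_all add: power_add prod.lessThan_Suc_shift del: prod.lessThan_Suc)

lemma summable_on_multi_idx_geometric:
  assumes "0 \<le> t" "t < (1::real)"
  shows "(\<lambda>ks. t ^ sum_list ks) summable_on multi_idx r"
proof -
  have "(\<lambda>n. t ^ n) summable_on UNIV"
    using assms by (intro norm_summable_imp_summable_on) (simp add: summable_geometric)
  then have "(\<lambda>ks. \<Prod>j<r. t ^ (ks ! j)) summable_on multi_idx r"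
    by (intro summable_on_multi_idx_prod) (use assms in auto)
  then show ?thesis
    by (rule summable_on_cong[THEN iffD1, rotated]) (simp add: power_sum_list multi_idx_def)
qed

section \<open>Taylor expansion, one variable at a time\<close>

definition taylor_hd :: "complex \<Rightarrow> nat \<Rightarrow> (complex list \<Rightarrow> complex) \<Rightarrow> complex list \<Rightarrow> complex" where
  "taylor_hd a k f x = (deriv ^^ k) (\<lambda>w. f (w # x)) a / fact k"

text \<open>The coefficient of the monomial with exponents ks at the given centre. Recursion over
  the variables makes one-variable results about \<open>deriv\<close> available at each stage. The
  value 0 for a list of exponents that is too short is a default.\<close>

fun taylor_coeff :: "complex list \<Rightarrow> nat list \<Rightarrow> (complex list \<Rightarrow> complex) \<Rightarrow> complex" where
  "taylor_coeff (a # as) (k # ks) f = taylor_coeff as ks (taylor_hd a k f)"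
| "taylor_coeff (a # as) [] f = 0"
| "taylor_coeff [] ks f = f []"

lemma Cons_polydisc: "w # x \<in> polydisc (a # as) e \<longleftrightarrow> cmod (w - a) < e \<and> x \<in> polydisc as e"
  by (auto simp: polydisc_def nth_Cons split: nat.splits)

lemma holo_on_Cons:
  assumes f: "holo_on (polydisc (a # as) e) f" and w: "cmod (w - a) < e"
  shows "holo_on (polydisc as e) (\<lambda>x. f (w # x))"
  unfolding holo_on_def
proof (intro conjI ballI allI impI)
  fix x and e' :: real assume x: "x \<in> polydisc as e" and "e' > 0"
  then obtain d where d: "d > 0" "\<forall>q\<in>polydisc (a # as) e \<inter> polydisc (w # x) d. cmod (f q - f (w # x)) < e'"
    using f w unfolding holo_on_def by (meson Cons_polydisc)
  then show "\<exists>d>0. \<forall>q\<in>polydisc as e \<inter> polydisc x d. cmod (f (w # q) - f (w # x)) < e'"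
    using w by (intro exI[of _ d]) (auto simp: Cons_polydisc)
next
  fix x j assume x: "x \<in> polydisc as e" and j: "j < length x"
  then show "(\<lambda>v. f (w # x[j := v])) field_differentiable at (x ! j)"
    using holo_onD_diff[OF f, of "w # x" "Suc j"] w by (simp add: Cons_polydisc)
qed

lemma holo_on_hd_holomorphic:
  assumes f: "holo_on (polydisc (a # as) e) f" and x: "x \<in> polydisc as e"
  shows "(\<lambda>w. f (w # x)) holomorphic_on ball a e"
  using holo_on_holomorphic[OF f, of "ball a e" "a # x" 0] x
  by (simp add: Cons_polydisc dist_norm norm_minus_commute)

text \<open>Rewrites derivatives with parameters as iterates of \<open>deriv_hd\<close>;
  \<open>holo_on_deriv_hd\<close> then gives joint holomorphy in the remaining variables.\<close>

lemma higher_deriv_hd: "(deriv ^^ k) (\<lambda>w. f (w # x)) = (\<lambda>w. (deriv_hd ^^ k) f (w # x))"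
  by (induction k) (simp_all add: deriv_hd_def)

lemma holo_on_taylor_hd:
  assumes f: "holo_on (polydisc (a # as) e) f" and e: "e > 0"
  shows "holo_on (polydisc as e) (taylor_hd a k f)"
proof -
  have "holo_on (polydisc (a # as) e) ((deriv_hd ^^ k) f)"
  proof (induction k)
    case (Suc k)
    have "s \<noteq> []" if "s \<in> polydisc (a # as) e" for s
      using polydisc_length[OF that] by auto
    then show ?case using holo_on_deriv_hd[OF Suc polydisc_open_polydisc] by simp
  qed (use f in simp)
  then have "holo_on (polydisc as e) (\<lambda>x. (deriv_hd ^^ k) f (a # x) * (1 / fact k))"
    by (intro holo_on_mult holo_on_const holo_on_Cons) (use e in auto)
  then show ?thesis by (simp add: taylor_hd_def[abs_def] higher_deriv_hd)
qed

lemma taylor_hd_cong: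
  assumes "e > 0" "\<And>s. s \<in> polydisc (a # as) e \<Longrightarrow> f s = g s" "x \<in> polydisc as e"
  shows "taylor_hd a k f x = taylor_hd a k g x"
proof -
  have "\<forall>\<^sub>F w in nhds a. f (w # x) = g (w # x)"
    unfolding eventually_nhds_metric
    using assms by (intro exI[of _ e]) (auto simp: Cons_polydisc dist_norm)
  then show ?thesis unfolding taylor_hd_def by (subst higher_deriv_cong_ev) auto
qed

lemma taylor_coeff_cong:
  assumes "e > 0" "\<And>s. s \<in> polydisc a e \<Longrightarrow> f s = g s"
  shows "taylor_coeff a ks f = taylor_coeff a ks g"
  using assms
proof (induction a ks f arbitrary: g rule: taylor_coeff.induct)
  case (1 a as k ks f)
  have "taylor_coeff as ks (taylor_hd a k f) = taylor_coeff as ks (taylor_hd a k g)"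
    by (rule "1.IH"[OF "1.prems"(1)]) (rule taylor_hd_cong[OF "1.prems"])
  then show ?case by simp
qed (auto simp: polydisc_def)

lemma taylor_coeff_add:
  assumes "e > 0" "holo_on (polydisc a e) f" "holo_on (polydisc a e) g" "length ks = length a"
  shows "taylor_coeff a ks (\<lambda>s. f s + g s) = taylor_coeff a ks f + taylor_coeff a ks g"
  using assms(2-)
proof (induction a arbitrary: ks f g)
  case (Cons a as)
  then obtain k ks' where ks: "ks = k # ks'" "length ks' = length as" by (cases ks) auto
  have "taylor_hd a k (\<lambda>s. f s + g s) x = taylor_hd a k f x + taylor_hd a k g x" if "x \<in> polydisc as e" for x
    unfolding taylor_hd_def using assms(1)
    by (subst higher_deriv_add[OF holo_on_hd_holomorphic[OF Cons.prems(1) that]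
          holo_on_hd_holomorphic[OF Cons.prems(2) that]]) (auto simp: add_divide_distrib)
  then have "taylor_coeff (a # as) ks (\<lambda>s. f s + g s) = taylor_coeff as ks' (\<lambda>x. taylor_hd a k f x + taylor_hd a k g x)"
    unfolding ks taylor_coeff.simps by (rule taylor_coeff_cong[OF assms(1)])
  then show ?case
    using Cons.IH[OF holo_on_taylor_hd[OF Cons.prems(1) assms(1)] holo_on_taylor_hd[OF Cons.prems(2) assms(1)] ks(2), of k k] ks
    by simp
qed simp

lemma taylor_coeff_cmult:
  assumes "e > 0" "holo_on (polydisc a e) f" "length ks = length a"
  shows "taylor_coeff a ks (\<lambda>s. c * f s) = c * taylor_coeff a ks f"
  using assms(2-)
proof (induction a arbitrary: ks f)
  case (Cons a as)
  then obtain k ks' where ks: "ks = k # ks'" "length ks' = length as" by (cases ks) auto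
  have "taylor_hd a k (\<lambda>s. c * f s) x = c * taylor_hd a k f x" if "x \<in> polydisc as e" for x
    unfolding taylor_hd_def using assms(1)
    by (subst higher_deriv_cmult[OF holo_on_hd_holomorphic[OF Cons.prems(1) that]]) auto
  then have "taylor_coeff (a # as) ks (\<lambda>s. c * f s) = taylor_coeff as ks' (\<lambda>x. c * taylor_hd a k f x)"
    unfolding ks taylor_coeff.simps by (rule taylor_coeff_cong[OF assms(1)])
  then show ?case
    using Cons.IH[OF holo_on_taylor_hd[OF Cons.prems(1) assms(1)] ks(2), of k] ks by simp
qed simp

lemma taylor_coeff_zero:
  assumes "length ks = length a" shows "taylor_coeff a ks (\<lambda>s. 0) = 0"
  using taylor_coeff_cmult[of 1 a "\<lambda>s. 0" ks 0] assms holo_on_const by simp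

lemma taylor_coeff_sum:
  assumes "e > 0" "\<And>i. i \<in> I \<Longrightarrow> holo_on (polydisc a e) (f i)" "length ks = length a"
  shows "taylor_coeff a ks (\<lambda>s. \<Sum>i\<in>I. f i s) = (\<Sum>i\<in>I. taylor_coeff a ks (f i))"
  using assms(2)
proof (induction I rule: infinite_finite_induct)
  case (insert i I)
  then show ?case
    using taylor_coeff_add[OF assms(1) _ holo_on_sum[of I] assms(3), of "f i" f] by simp
qed (simp_all add: taylor_coeff_zero assms)

lemma taylor_hd_bound:
  assumes "holo_on (polydisc (a # as) e) f" "0 < \<rho>" "\<rho> < e"
    and "\<And>s. s \<in> polydisc (a # as) e \<Longrightarrow> cmod (f s) \<le> B" and x: "x \<in> polydisc as e"
  shows "cmod (taylor_hd a k f x) \<le> B / \<rho> ^ k"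
proof -
  have hol: "(\<lambda>w. f (w # x)) holomorphic_on ball a e"
    by (rule holo_on_hd_holomorphic[OF assms(1) x])
  have "cmod ((deriv ^^ k) (\<lambda>w. f (w # x)) a) \<le> fact k * B / \<rho> ^ k"
  proof (rule Cauchy_inequality)
    show "(\<lambda>w. f (w # x)) holomorphic_on ball a \<rho>"
      by (rule holomorphic_on_subset[OF hol]) (use assms in auto)
    show "continuous_on (cball a \<rho>) (\<lambda>w. f (w # x))"
      by (rule holomorphic_on_imp_continuous_on[OF holomorphic_on_subset[OF hol]]) (use assms in auto)
    show "cmod (f (w # x)) \<le> B" if "cmod (a - w) = \<rho>" for w
      using that assms by (intro assms(4)) (auto simp: Cons_polydisc norm_minus_commute)
  qed (use assms in auto)
  then show ?thesis by (simp add: taylor_hd_def norm_divide divide_le_eq mult_ac)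
qed

lemma taylor_coeff_bound:
  assumes "holo_on (polydisc a e) f" "0 < \<rho>" "\<rho> < e"
    and "\<And>s. s \<in> polydisc a e \<Longrightarrow> cmod (f s) \<le> B" and "length ks = length a"
  shows "cmod (taylor_coeff a ks f) \<le> B / \<rho> ^ sum_list ks"
  using assms
proof (induction a arbitrary: ks f B)
  case Nil
  then show ?case by (auto simp: polydisc_def)
next
  case (Cons a as)
  then obtain k ks' where ks: "ks = k # ks'" "length ks' = length as" by (cases ks) auto
  have "cmod (taylor_coeff as ks' (taylor_hd a k f)) \<le> (B / \<rho> ^ k) / \<rho> ^ sum_list ks'"
    using Cons.prems ks by (intro Cons.IH holo_on_taylor_hd taylor_hd_bound) auto
  then show ?case by (simp add: ks power_add)
qed

definition monomial_at :: "complex list \<Rightarrow> complex list \<Rightarrow> nat list \<Rightarrow> complex" where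
  "monomial_at a s ks = (\<Prod>j<length ks. (s ! j - a ! j) ^ (ks ! j))"

lemma monomial_at_Cons: "monomial_at (a # as) (w # x) (k # ks) = (w - a) ^ k * monomial_at as x ks"
  by (simp add: monomial_at_def prod.lessThan_Suc_shift del: prod.lessThan_Suc)

lemma monomial_at_bound:
  assumes "\<And>j. j < length a \<Longrightarrow> cmod (s ! j - a ! j) \<le> r" "length ks = length a"
  shows "cmod (monomial_at a s ks) \<le> r ^ sum_list ks"
  unfolding monomial_at_def power_sum_list prod_norm[symmetric]
  by (intro prod_mono) (use assms in \<open>auto simp: norm_power intro: power_mono\<close>)

text \<open>By induction the inner sum over the remaining exponents is a coefficient in the first
  variable, and the one-variable power series sums these. The geometric majorant with ratio r /
  \<rho> makes the double sum absolutely convergent, so it may be taken over all multi-indices at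
  once.\<close>

lemma taylor_coeff_has_sum:
  assumes "holo_on (polydisc a e) f" "0 \<le> r" "r < \<rho>" "\<rho> < e"
    and "\<And>s. s \<in> polydisc a e \<Longrightarrow> cmod (f s) \<le> B"
    and "length s = length a" "\<And>j. j < length a \<Longrightarrow> cmod (s ! j - a ! j) \<le> r"
  shows "((\<lambda>ks. taylor_coeff a ks f * monomial_at a s ks) has_sum f s) (multi_idx (length a))"
  using assms
proof (induction a arbitrary: f B s)
  case Nil
  then show ?case by (simp add: multi_idx_0 monomial_at_def has_sum_finite_iff)
next
  case (Cons a as)
  then obtain w x where s: "s = w # x" "length x = length as" by (cases s) auto
  have xr: "cmod (x ! j - as ! j) \<le> r" if "j < length as" for j
    using Cons.prems(7)[of "Suc j"] that s by simp
  have wr: "cmod (w - a) \<le> r" using Cons.prems(7)[of 0] s by simp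
  have xp: "x \<in> polydisc as e" using xr s Cons.prems by (force simp: polydisc_def)
  define t where "t = r / \<rho>"
  have t: "0 \<le> t" "t < 1" using Cons.prems by (auto simp: t_def)
  have B: "B \<ge> 0"
  proof -
    have "a # as \<in> polydisc (a # as) e" using Cons.prems by (intro polydisc_center) auto
    from order_trans[OF norm_ge_zero Cons.prems(5)[OF this]] show ?thesis .
  qed
  have S: "((\<lambda>(k, ks). taylor_coeff (a # as) (k # ks) f * monomial_at (a # as) s (k # ks)) has_sum f s)
      (SIGMA k:UNIV. multi_idx (length as))"
  proof (rule has_sum_SigmaI)
    show "((\<lambda>ks. case (k, ks) of (k, ks) \<Rightarrow> taylor_coeff (a # as) (k # ks) f * monomial_at (a # as) s (k # ks))
        has_sum (w - a) ^ k * taylor_hd a k f x) (multi_idx (length as))" for k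
    proof -
      have "((\<lambda>ks. taylor_coeff as ks (taylor_hd a k f) * monomial_at as x ks) has_sum taylor_hd a k f x) (multi_idx (length as))"
        using Cons.prems s xr taylor_hd_bound[OF Cons.prems(1), of \<rho> B _ k]
        by (intro Cons.IH[where B = "B / \<rho> ^ k"] holo_on_taylor_hd) auto
      from has_sum_cmult_right[OF this, of "(w - a) ^ k"] show ?thesis
        by (simp add: s monomial_at_Cons mult_ac)
    qed
    show "((\<lambda>k. (w - a) ^ k * taylor_hd a k f x) has_sum f s) UNIV"
    proof (rule norm_summable_imp_has_sum)
      have "w \<in> ball a e" using wr Cons.prems by (auto simp: dist_norm norm_minus_commute)
      from holomorphic_power_series[OF holo_on_hd_holomorphic[OF Cons.prems(1) xp] this]
      show "(\<lambda>k. (w - a) ^ k * taylor_hd a k f x) sums f s"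
        by (simp add: taylor_hd_def s mult_ac)
      show "summable (\<lambda>k. norm ((w - a) ^ k * taylor_hd a k f x))"
      proof (rule summable_comparison_test'[of "\<lambda>k. B * t ^ k" 0])
        show "summable (\<lambda>k. B * t ^ k)" using t by (intro summable_mult summable_geometric) auto
        fix k
        have "cmod ((w - a) ^ k * taylor_hd a k f x) \<le> r ^ k * (B / \<rho> ^ k)"
          unfolding norm_mult norm_power using Cons.prems xp wr
          by (intro mult_mono taylor_hd_bound power_mono) auto
        then show "norm (norm ((w - a) ^ k * taylor_hd a k f x)) \<le> B * t ^ k"
          by (simp add: t_def power_divide mult_ac)
      qed
    qed
    have "(\<lambda>ks. taylor_coeff (a # as) ks f * monomial_at (a # as) s ks) summable_on multi_idx (Suc (length as))"
    proof (rule abs_summable_summable, rule Infinite_Sum.abs_summable_on_comparison_test')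
      show "(\<lambda>ks. B * t ^ sum_list ks) summable_on multi_idx (Suc (length as))"
        by (intro summable_on_cmult_right summable_on_multi_idx_geometric t)
      fix ks assume "ks \<in> multi_idx (Suc (length as))"
      then have l: "length ks = length (a # as)" by (simp add: multi_idx_def)
      have "cmod (taylor_coeff (a # as) ks f * monomial_at (a # as) s ks) \<le> (B / \<rho> ^ sum_list ks) * r ^ sum_list ks"
        unfolding norm_mult using Cons.prems l B
        by (intro mult_mono taylor_coeff_bound[where e = e] monomial_at_bound) auto
      then show "cmod (taylor_coeff (a # as) ks f * monomial_at (a # as) s ks) \<le> B * t ^ sum_list ks"
        by (simp add: t_def power_divide)
    qed
    then show "(\<lambda>(k, ks). taylor_coeff (a # as) (k # ks) f * monomial_at (a # as) s (k # ks)) summable_on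
        (SIGMA k:UNIV. multi_idx (length as))"
      unfolding summable_on_multi_idx_Suc .
  qed
  then show ?case unfolding list.size add_0_right add_Suc_right has_sum_multi_idx_Suc .
qed

lemma taylor_hd_coord_mult:
  assumes "(\<lambda>w. f (w # x)) holomorphic_on ball a e" "e > 0"
  shows "taylor_hd a k (\<lambda>s. (s ! 0 - a) * f s) x = (if k = 0 then 0 else taylor_hd a (k - 1) f x)"
proof -
  \<comment> \<open>Of the derivatives of w - a at a only the first is nonzero, so Leibniz's rule
    leaves a single term.\<close>
  have d: "(deriv ^^ i) (\<lambda>w. w - a) a = (if i = 1 then 1 else 0)" for i
    by (subst higher_deriv_diff[where S = UNIV]) (auto intro!: holomorphic_intros)
  have "(deriv ^^ k) (\<lambda>w. (w - a) * f (w # x)) a =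
      (\<Sum>i = 0..k. of_nat (k choose i) * (deriv ^^ i) (\<lambda>w. w - a) a * (deriv ^^ (k - i)) (\<lambda>w. f (w # x)) a)"
    by (rule higher_deriv_mult[OF _ assms(1)]) (use assms in \<open>auto intro!: holomorphic_intros\<close>)
  also have "\<dots> = (\<Sum>i = 0..k. if i = 1 then of_nat (k choose i) * (deriv ^^ (k - i)) (\<lambda>w. f (w # x)) a else 0)"
    by (intro sum.cong) (auto simp: d)
  also have "\<dots> = (if k = 0 then 0 else of_nat k * (deriv ^^ (k - 1)) (\<lambda>w. f (w # x)) a)"
    by (auto simp: sum.delta)
  finally have D: "(deriv ^^ k) (\<lambda>w. (w - a) * f (w # x)) a =
      (if k = 0 then 0 else of_nat k * (deriv ^^ (k - 1)) (\<lambda>w. f (w # x)) a)" .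
  show ?thesis
  proof (cases k)
    case (Suc n)
    have "of_nat (Suc n) * (deriv ^^ n) (\<lambda>w. f (w # x)) a / fact (Suc n) = (deriv ^^ n) (\<lambda>w. f (w # x)) a / fact n"
      unfolding fact_Suc by (rule nonzero_mult_divide_mult_cancel_left) (simp del: of_nat_Suc)
    then show ?thesis unfolding taylor_hd_def nth_Cons_0 D using Suc by simp
  qed (simp add: taylor_hd_def)
qed

lemma taylor_coeff_coord_mult:
  assumes "e > 0" "holo_on (polydisc a e) f" "length ks = length a" "p < length a"
  shows "taylor_coeff a ks (\<lambda>s. (s ! p - a ! p) * f s) = (if ks ! p = 0 then 0 else taylor_coeff a (ks[p := ks ! p - 1]) f)"
  using assms(2-)
proof (induction a arbitrary: ks f p)
  case (Cons a as)
  then obtain k ks' where ks: "ks = k # ks'" "length ks' = length as" by (cases ks) auto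
  show ?case
  proof (cases p)
    case 0
    have "taylor_coeff as ks' (taylor_hd a k (\<lambda>s. (s ! 0 - a) * f s)) = taylor_coeff as ks' (\<lambda>x. if k = 0 then 0 else taylor_hd a (k - 1) f x)"
      by (intro taylor_coeff_cong[OF assms(1)] taylor_hd_coord_mult[OF holo_on_hd_holomorphic[OF Cons.prems(1)]] assms)
    then show ?thesis using 0 ks by (cases k) (auto simp: taylor_coeff_zero)
  next
    case (Suc q)
    have "taylor_hd a k (\<lambda>s. (s ! p - (a # as) ! p) * f s) x = (x ! q - as ! q) * taylor_hd a k f x"
      if "x \<in> polydisc as e" for x
      unfolding taylor_hd_def Suc using assms(1)
      by (simp add: higher_deriv_cmult[OF holo_on_hd_holomorphic[OF Cons.prems(1) that]])
    then have "taylor_coeff as ks' (taylor_hd a k (\<lambda>s. (s ! p - (a # as) ! p) * f s)) = taylor_coeff as ks' (\<lambda>x. (x ! q - as ! q) * taylor_hd a k f x)"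
      by (rule taylor_coeff_cong[OF assms(1)])
    also have "\<dots> = (if ks' ! q = 0 then 0 else taylor_coeff as (ks'[q := ks' ! q - 1]) (taylor_hd a k f))"
      using Cons.prems Suc ks assms(1) by (intro Cons.IH holo_on_taylor_hd) auto
    finally show ?thesis by (simp add: ks Suc)
  qed
qed simp

lemma higher_deriv_exp_linear:
  "(deriv ^^ j) (\<lambda>w. exp (c * (w - a))) = (\<lambda>w. c ^ j * exp (c * (w - a :: complex)))"
proof (induction j)
  case (Suc j)
  have "deriv (\<lambda>w. c ^ j * exp (c * (w - a))) w = c ^ Suc j * exp (c * (w - a))" for w
    by (rule DERIV_imp_deriv) (auto intro!: derivative_eq_intros)
  moreover have "(deriv ^^ Suc j) (\<lambda>w. exp (c * (w - a))) = deriv (\<lambda>w. c ^ j * exp (c * (w - a)))"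
    by (simp only: funpow.simps o_apply Suc)
  ultimately show ?case by (simp add: fun_eq_iff)
qed simp

lemma taylor_hd_exp_mult:
  assumes "(\<lambda>w. f (w # x)) holomorphic_on ball a e" "e > 0"
  shows "taylor_hd a k (\<lambda>s. exp (c * (s ! 0 - a)) * f s) x = (\<Sum>j\<le>k. c ^ j / fact j * taylor_hd a (k - j) f x)"
proof -
  have "(deriv ^^ k) (\<lambda>w. exp (c * (w - a)) * f (w # x)) a =
      (\<Sum>i = 0..k. of_nat (k choose i) * (deriv ^^ i) (\<lambda>w. exp (c * (w - a))) a * (deriv ^^ (k - i)) (\<lambda>w. f (w # x)) a)"
    by (rule higher_deriv_mult[OF _ assms(1)]) (use assms in \<open>auto intro!: holomorphic_intros\<close>)
  then have "taylor_hd a k (\<lambda>s. exp (c * (s ! 0 - a)) * f s) x =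
     (\<Sum>i = 0..k. of_nat (k choose i) * c ^ i * (deriv ^^ (k - i)) (\<lambda>w. f (w # x)) a) / fact k"
    by (simp add: taylor_hd_def higher_deriv_exp_linear)
  also have "\<dots> = (\<Sum>j\<le>k. c ^ j / fact j * taylor_hd a (k - j) f x)"
    unfolding sum_divide_distrib atMost_atLeast0
  proof (intro sum.cong refl)
    fix j assume "j \<in> {0..k}"
    then have b: "(of_nat (k choose j) :: complex) = fact k / (fact j * fact (k - j))"
      by (intro binomial_fact) auto
    show "of_nat (k choose j) * c ^ j * (deriv ^^ (k - j)) (\<lambda>w. f (w # x)) a / fact k =
        c ^ j / fact j * taylor_hd a (k - j) f x"
      unfolding b taylor_hd_def by simp
  qed
  finally show ?thesis .
qed

text \<open>For c = -ln N the exponential is N to the power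
  \<open>prefix_sum i a - prefix_sum i s\<close>. Its own Taylor coefficients are powers of c over
  factorials, so the product has coefficients polynomial in ln N; at c = 0 only f remains.\<close>

lemma taylor_coeff_exp_prefix_sum:
  assumes "e > 0" "holo_on (polydisc a e) f" "length ks = length a" "i \<le> length a"
  shows "\<exists>P. poly P 0 = taylor_coeff a ks f \<and>
    (\<forall>c. taylor_coeff a ks (\<lambda>s. exp (c * (prefix_sum i s - prefix_sum i a)) * f s) = poly P c)"
  using assms(2-)
proof (induction a arbitrary: ks f i)
  case Nil
  then show ?case by (intro exI[of _ "[:f []:]"]) (simp add: prefix_sum_def)
next
  case (Cons a as)
  then obtain k ks' where ks: "ks = k # ks'" "length ks' = length as" by (cases ks) auto
  show ?case
  proof (cases i)
    case 0
    then show ?thesis by (intro exI[of _ "[:taylor_coeff (a # as) ks f:]"]) (simp add: prefix_sum_def)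
  next
    case (Suc i')
    have i': "i' \<le> length as" using Cons.prems Suc by simp
    have "\<exists>P. poly P 0 = taylor_coeff as ks' (taylor_hd a (k - j) f) \<and>
       (\<forall>c. taylor_coeff as ks' (\<lambda>s. exp (c * (prefix_sum i' s - prefix_sum i' as)) * taylor_hd a (k - j) f s) = poly P c)" for j
      by (rule Cons.IH[OF holo_on_taylor_hd[OF Cons.prems(1) assms(1)] ks(2) i'])
    then obtain P where P: "\<And>j. poly (P j) 0 = taylor_coeff as ks' (taylor_hd a (k - j) f)"
       "\<And>j c. taylor_coeff as ks' (\<lambda>s. exp (c * (prefix_sum i' s - prefix_sum i' as)) * taylor_hd a (k - j) f s) = poly (P j) c"
      by metis
    \<comment> \<open>The first variable contributes the exponential series cut off at k, the others
      contribute the polynomials of the induction hypothesis.\<close>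
    define R where "R = (\<Sum>j\<le>k. monom (1 / fact j) j * P j)"
    have eh: "holo_on (polydisc as e) (\<lambda>s. exp (c * (prefix_sum i' s - prefix_sum i' as)))" for c
    proof (rule holo_on_compose[of _ "\<lambda>s. c * (prefix_sum i' s - prefix_sum i' as)" exp])
      show "holo_on (polydisc as e) (\<lambda>s. c * (prefix_sum i' s - prefix_sum i' as))"
        by (intro holo_on_mult holo_on_diff holo_on_const prefix_sum_holo[OF i']) (auto dest: polydisc_length)
    qed (auto intro!: holomorphic_on_imp_differentiable_at[of _ UNIV] holomorphic_intros)
    have "taylor_coeff (a # as) ks (\<lambda>s. exp (c * (prefix_sum i s - prefix_sum i (a # as))) * f s) = poly R c" for c
    proof -
      have pcv: "taylor_hd a k (\<lambda>s. exp (c * (prefix_sum i s - prefix_sum i (a # as))) * f s) x =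
          (\<Sum>j\<le>k. c ^ j / fact j * (exp (c * (prefix_sum i' x - prefix_sum i' as)) * taylor_hd a (k - j) f x))"
        if x: "x \<in> polydisc as e" for x
      proof -
        define h where "h = exp (c * (prefix_sum i' x - prefix_sum i' as))"
        have hol: "(\<lambda>w. f (w # x)) holomorphic_on ball a e"
          by (rule holo_on_hd_holomorphic[OF Cons.prems(1) x])
        have e: "exp (c * (prefix_sum i (w # x) - prefix_sum i (a # as))) = h * exp (c * (w - a))" for w
          unfolding Suc h_def exp_add[symmetric] by (simp add: prefix_sum_Suc algebra_simps)
        have "taylor_hd a k (\<lambda>s. exp (c * (prefix_sum i s - prefix_sum i (a # as))) * f s) x
            = (deriv ^^ k) (\<lambda>w. h * (exp (c * (w - a)) * f (w # x))) a / fact k"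
          unfolding taylor_hd_def e by (simp add: mult.assoc)
        also have "\<dots> = h * taylor_hd a k (\<lambda>s. exp (c * (s ! 0 - a)) * f s) x"
          using assms(1) unfolding taylor_hd_def
          by (subst higher_deriv_cmult[where A = "ball a e"])
             (auto intro!: holomorphic_intros hol)
        also have "\<dots> = (\<Sum>j\<le>k. c ^ j / fact j * (h * taylor_hd a (k - j) f x))"
          unfolding taylor_hd_exp_mult[OF hol assms(1)] sum_distrib_left by (intro sum.cong) auto
        finally show ?thesis unfolding h_def .
      qed
      have "taylor_coeff (a # as) ks (\<lambda>s. exp (c * (prefix_sum i s - prefix_sum i (a # as))) * f s) =
        taylor_coeff as ks' (\<lambda>x. \<Sum>j\<le>k. c ^ j / fact j * (exp (c * (prefix_sum i' x - prefix_sum i' as)) * taylor_hd a (k - j) f x))"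
        unfolding ks taylor_coeff.simps by (intro taylor_coeff_cong[OF assms(1)] pcv)
      also have "\<dots> = (\<Sum>j\<le>k. taylor_coeff as ks' (\<lambda>x. c ^ j / fact j * (exp (c * (prefix_sum i' x - prefix_sum i' as)) * taylor_hd a (k - j) f x)))"
        by (intro taylor_coeff_sum[OF assms(1) _ ks(2)] holo_on_mult holo_on_const eh holo_on_taylor_hd[OF Cons.prems(1) assms(1)])
      also have "\<dots> = (\<Sum>j\<le>k. c ^ j / fact j * poly (P j) c)"
        unfolding P(2)[symmetric]
        by (intro sum.cong refl taylor_coeff_cmult[OF assms(1) _ ks(2)] holo_on_mult eh holo_on_taylor_hd[OF Cons.prems(1) assms(1)])
      also have "\<dots> = poly R c"
        unfolding R_def poly_sum by (simp add: poly_monom)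
      finally show ?thesis .
    qed
    moreover have "poly R 0 = taylor_coeff (a # as) ks f"
    proof -
      have "poly R 0 = (\<Sum>j\<le>k. if j = 0 then poly (P 0) 0 else 0)"
        unfolding R_def poly_sum by (intro sum.cong) (auto simp: poly_monom)
      also have "\<dots> = taylor_coeff (a # as) ks f" using P(1)[of 0] ks by (simp add: sum.delta)
      finally show ?thesis .
    qed
    ultimately show ?thesis by blast
  qed
qed

lemma taylor_coeff_prod:
  assumes "\<And>j. \<phi> j holomorphic_on UNIV" "length ks = length a"
  shows "taylor_coeff a ks (\<lambda>s. \<Prod>j<length a. \<phi> j (s ! j)) = (\<Prod>j<length a. (deriv ^^ (ks ! j)) (\<phi> j) (a ! j) / fact (ks ! j))"
  using assms
proof (induction a arbitrary: ks \<phi>)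
  case (Cons a as)
  then obtain k ks' where ks: "ks = k # ks'" "length ks' = length as" by (cases ks) auto
  define c where "c = (deriv ^^ k) (\<phi> 0) a / fact k"
  define g where "g x = (\<Prod>j<length as. \<phi> (Suc j) (x ! j))" for x :: "complex list"
  have gh: "holo_on (polydisc as 1) g"
    unfolding g_def
    by (intro holo_on_prod holo_on_compose[OF holo_on_coord])
       (use Cons.prems in \<open>auto dest!: polydisc_length intro: holomorphic_on_imp_differentiable_at[of _ UNIV]\<close>)
  have "taylor_hd a k (\<lambda>s. \<Prod>j<length (a # as). \<phi> j (s ! j)) x = c * g x" for x
  proof -
    have "taylor_hd a k (\<lambda>s. \<Prod>j<length (a # as). \<phi> j (s ! j)) x = (deriv ^^ k) (\<lambda>w. g x * \<phi> 0 w) a / fact k"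
      by (simp add: taylor_hd_def g_def prod.lessThan_Suc_shift mult.commute del: prod.lessThan_Suc)
    also have "\<dots> = c * g x"
      by (subst higher_deriv_cmult[where A = UNIV]) (use Cons.prems in \<open>auto simp: c_def\<close>)
    finally show ?thesis .
  qed
  then have "taylor_coeff (a # as) ks (\<lambda>s. \<Prod>j<length (a # as). \<phi> j (s ! j)) = taylor_coeff as ks' (\<lambda>x. c * g x)"
    unfolding ks taylor_coeff.simps by (intro taylor_coeff_cong[OF zero_less_one])
  also have "\<dots> = c * taylor_coeff as ks' g"
    by (rule taylor_coeff_cmult[OF zero_less_one gh ks(2)])
  also have "taylor_coeff as ks' g = (\<Prod>j<length as. (deriv ^^ (ks' ! j)) (\<phi> (Suc j)) (as ! j) / fact (ks' ! j))"
    unfolding g_def using Cons.prems ks by (intro Cons.IH) auto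
  finally show ?case
    by (simp add: ks c_def prod.lessThan_Suc_shift del: prod.lessThan_Suc)
qed simp

section \<open>Constant terms of expansions\<close>

abbreviation log_sum :: "complex list \<Rightarrow> nat \<Rightarrow> nat \<Rightarrow> (nat \<Rightarrow> nat \<Rightarrow> complex \<Rightarrow> complex) \<Rightarrow> nat \<Rightarrow> complex" where
  "log_sum z L M coef N \<equiv> (\<Sum>l\<le>L. \<Sum>m\<le>M. \<Sum>\<xi>\<in>monomials z.
      coef l m \<xi> * (\<xi>^N) * (of_real (ln (real N))) ^ l * (of_nat N) ^ m)"

text \<open>The relation inside the definite description of \<open>reg_val\<close>. As a relation it
  can be added and scaled before existence and uniqueness of the value are known.\<close>

definition reg_const :: "complex list \<Rightarrow> (nat \<Rightarrow> complex) \<Rightarrow> complex \<Rightarrow> bool" where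
  "reg_const z u c \<longleftrightarrow> (\<exists>(Lm::nat) (Mm::nat) (coef :: nat \<Rightarrow> nat \<Rightarrow> complex \<Rightarrow> complex).
      (\<lambda>N. u N - log_sum z Lm Mm coef N) \<longlonglongrightarrow> 0
      \<and> c = coef 0 0 1)"

lemma reg_val_eq: "reg_val z a k = (THE c. reg_const z (reg_partial z a k) c)"
  unfolding reg_val_def reg_const_def ..

text \<open>The functions y^l exp(y)^m are ordered by growth, lexicographically in (m, l). Dividing
  by the largest one with nonzero coefficient leaves that coefficient in the limit, although the
  whole quotient tends to 0.\<close>

lemma log_poly_independent:
  fixes d :: "nat \<Rightarrow> nat \<Rightarrow> complex" and y :: "nat \<Rightarrow> real"
  assumes y: "filterlim y at_top sequentially"
    and lim: "(\<lambda>n. \<Sum>l\<le>L. \<Sum>m\<le>M. d l m * of_real (y n) ^ l * of_real (exp (y n)) ^ m) \<longlonglongrightarrow> 0"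
    and l0: "l0 \<le> L" "m0 \<le> M"
  shows "d l0 m0 = 0"
proof (rule ccontr)
  assume nz: "d l0 m0 \<noteq> 0"
  define m1 where "m1 = Max {m. m \<le> M \<and> (\<exists>l\<le>L. d l m \<noteq> 0)}"
  have m1: "m1 \<le> M" "\<exists>l\<le>L. d l m1 \<noteq> 0"
  proof -
    have "m1 \<in> {m. m \<le> M \<and> (\<exists>l\<le>L. d l m \<noteq> 0)}"
      unfolding m1_def by (rule Max_in) (use nz l0 in auto)
    then show "m1 \<le> M" "\<exists>l\<le>L. d l m1 \<noteq> 0" by auto
  qed
  have m1_max: "d l m = 0" if "m > m1" "m \<le> M" "l \<le> L" for l m
    using Max_ge[of "{m. m \<le> M \<and> (\<exists>l\<le>L. d l m \<noteq> 0)}" m] that unfolding m1_def by fastforce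
  define l1 where "l1 = Max {l. l \<le> L \<and> d l m1 \<noteq> 0}"
  have l1: "l1 \<le> L" "d l1 m1 \<noteq> 0"
  proof -
    have "l1 \<in> {l. l \<le> L \<and> d l m1 \<noteq> 0}"
      unfolding l1_def by (rule Max_in) (use m1 in auto)
    then show "l1 \<le> L" "d l1 m1 \<noteq> 0" by auto
  qed
  have l1_max: "d l m1 = 0" if "l > l1" "l \<le> L" for l
    using Max_ge[of "{l. l \<le> L \<and> d l m1 \<noteq> 0}" l] that unfolding l1_def by fastforce
  define t where "t l m n = d l m * of_real (y n) ^ l * of_real (exp (y n)) ^ m /
      (of_real (y n) ^ l1 * of_real (exp (y n)) ^ m1)" for l m n
  have ev: "\<forall>\<^sub>F n in sequentially. y n \<ge> 1"
    using y by (simp add: filterlim_at_top)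
  have yt: "(\<lambda>n. 1 / y n) \<longlonglongrightarrow> 0"
    using tendsto_inverse_0_at_top[OF y] by (simp add: inverse_eq_divide)
  have tl: "t l m \<longlonglongrightarrow> (if l = l1 \<and> m = m1 then d l1 m1 else 0)" if lm: "l \<le> L" "m \<le> M" for l m
  proof -
    consider "d l m = 0" | "l = l1" "m = m1" | "m < m1" | "m = m1" "l < l1"
      using m1_max[of m l] l1_max[of l] lm by (metis linorder_neqE_nat)
    then show ?thesis
    proof cases
      case 1
      then have "t l m = (\<lambda>n. 0)" by (auto simp: t_def)
      then show ?thesis using 1 l1 by auto
    next
      case 2
      have "\<forall>\<^sub>F n in sequentially. t l m n = d l1 m1"
        using ev by eventually_elim (use 2 in \<open>auto simp: t_def\<close>)
      then show ?thesis using 2 tendsto_eventually by auto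
    next
      case 3
      have "((\<lambda>x. x ^ l / exp x) \<longlongrightarrow> 0) (at_top :: real filter)"
        by (rule tendsto_power_div_exp_0)
      from filterlim_compose[OF this y] have "(\<lambda>n. cmod (d l m) * (y n ^ l / exp (y n))) \<longlonglongrightarrow> 0"
        by (intro tendsto_mult_right_zero)
      then have "t l m \<longlonglongrightarrow> 0"
      proof (rule Lim_null_comparison[rotated])
        show "\<forall>\<^sub>F n in sequentially. cmod (t l m n) \<le> cmod (d l m) * (y n ^ l / exp (y n))"
          using ev
        proof eventually_elim
          case (elim n)
          have e: "exp (y n) ^ Suc m \<le> exp (y n) ^ m1"
            using 3 elim by (intro power_increasing) auto
          have "cmod (t l m n) = cmod (d l m) * (y n ^ l * exp (y n) ^ m / (y n ^ l1 * exp (y n) ^ m1))"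
            using elim by (simp add: t_def norm_mult norm_divide norm_power)
          also have "\<dots> \<le> cmod (d l m) * (y n ^ l * exp (y n) ^ m / (1 * exp (y n) ^ Suc m))"
            using elim e by (intro mult_left_mono divide_left_mono mult_mono one_le_power) auto
          finally show ?case by simp
        qed
      qed
      then show ?thesis using 3 by auto
    next
      case 4
      have "(\<lambda>n. cmod (d l m) * (1 / y n)) \<longlonglongrightarrow> 0"
        using tendsto_mult_right_zero[OF yt] .
      then have "t l m \<longlonglongrightarrow> 0"
      proof (rule Lim_null_comparison[rotated])
        show "\<forall>\<^sub>F n in sequentially. cmod (t l m n) \<le> cmod (d l m) * (1 / y n)"
          using ev
        proof eventually_elim
          case (elim n)
          have e: "y n ^ Suc l \<le> y n ^ l1"
            using 4 elim by (intro power_increasing) auto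
          have "cmod (t l m n) = cmod (d l m) * (y n ^ l / y n ^ l1)"
            using elim 4 by (simp add: t_def norm_mult norm_divide norm_power)
          also have "\<dots> \<le> cmod (d l m) * (y n ^ l / y n ^ Suc l)"
            using elim e by (intro mult_left_mono divide_left_mono) auto
          finally show ?case using elim by simp
        qed
      qed
      then show ?thesis using 4 by auto
    qed
  qed
  have "(\<lambda>n. \<Sum>l\<le>L. \<Sum>m\<le>M. t l m n) \<longlonglongrightarrow> (\<Sum>l\<le>L. \<Sum>m\<le>M. if l = l1 \<and> m = m1 then d l1 m1 else 0)"
    by (intro tendsto_sum tl) auto
  also have "(\<Sum>l\<le>L. \<Sum>m\<le>M. if l = l1 \<and> m = m1 then d l1 m1 else 0)
      = (\<Sum>l\<le>L. if l = l1 then (\<Sum>m\<le>M. if m = m1 then d l1 m1 else 0) else 0)"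
    by (intro sum.cong) auto
  also have "\<dots> = d l1 m1" using l1 m1 by (simp add: sum.delta)
  finally have T: "(\<lambda>n. \<Sum>l\<le>L. \<Sum>m\<le>M. t l m n) \<longlonglongrightarrow> d l1 m1" .
  have "(\<lambda>n. \<Sum>l\<le>L. \<Sum>m\<le>M. t l m n) \<longlonglongrightarrow> 0"
  proof (rule Lim_null_comparison[OF _ tendsto_norm_zero[OF lim]])
    show "\<forall>\<^sub>F n in sequentially. cmod (\<Sum>l\<le>L. \<Sum>m\<le>M. t l m n)
        \<le> cmod (\<Sum>l\<le>L. \<Sum>m\<le>M. d l m * of_real (y n) ^ l * of_real (exp (y n)) ^ m)"
      using ev
    proof eventually_elim
      case (elim n)
      \<comment> \<open>The dominating monomial is at least 1, so dividing by it preserves the limit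
        0.\<close>
      have "1 * 1 \<le> y n ^ l1 * exp (y n) ^ m1"
        using elim by (intro mult_mono one_le_power) auto
      moreover have "(\<Sum>l\<le>L. \<Sum>m\<le>M. t l m n) =
        (\<Sum>l\<le>L. \<Sum>m\<le>M. d l m * of_real (y n) ^ l * of_real (exp (y n)) ^ m) /
           of_real (y n ^ l1 * exp (y n) ^ m1)"
        by (simp add: t_def sum_divide_distrib)
      moreover have "x / w \<le> x" if "x \<ge> 0" "1 \<le> w" for x w :: real
        using divide_left_mono[of 1 w x] that by simp
      ultimately show ?case
        using elim by (simp only: norm_divide norm_of_real norm_ge_zero abs_of_nonneg mult_1)
    qed
  qed
  with T l1 show False using LIMSEQ_unique by blast
qed

lemma root_of_unity_norm: "root_of_unity x \<Longrightarrow> cmod x = 1"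
  unfolding root_of_unity_def
  by (metis norm_ge_zero norm_one norm_power power_eq_1_iff not_gr_zero)

text \<open>A common period of all sequences \<xi>^N. It makes oscillation disappear along residue
  classes and bounds the set of all \<xi>.\<close>

lemma monomials_period:
  assumes "\<forall>x\<in>set z. root_of_unity x"
  obtains M0 where "M0 > 0" "\<And>\<xi>. \<xi> \<in> monomials z \<Longrightarrow> \<xi> ^ M0 = 1"
proof -
  have "\<forall>j\<in>{..<length z}. \<exists>n>0. (z ! j) ^ n = 1"
    using assms by (auto simp: root_of_unity_def)
  from bchoice[OF this] obtain f where f: "\<And>j. j < length z \<Longrightarrow> f j > 0 \<and> (z ! j) ^ (f j) = 1"
    by auto
  define M0 where "M0 = (\<Prod>j<length z. f j)"
  have zj: "z ! j ^ M0 = 1" if "j < length z" for j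
  proof -
    have "f j dvd M0" unfolding M0_def using that by (intro dvd_prodI) auto
    then show ?thesis using f[OF that] by (auto simp: power_mult)
  qed
  have "\<xi> ^ M0 = 1" if "\<xi> \<in> monomials z" for \<xi>
    using that zj by (auto simp: monomials_def prod_power_distrib power_mult[symmetric] mult.commute[of _ M0])
      (simp add: power_mult zj)
  moreover have "M0 > 0" unfolding M0_def using f by (intro prod_pos) auto
  ultimately show ?thesis using that by blast
qed

text \<open>Gives the sums over \<open>monomials z\<close> their intended meaning: over an infinite
  set they would be 0.\<close>

lemma finite_monomials:
  assumes "\<forall>x\<in>set z. root_of_unity x" shows "finite (monomials z)"
proof -
  obtain M0 where M0: "M0 > 0" "\<And>\<xi>. \<xi> \<in> monomials z \<Longrightarrow> \<xi> ^ M0 = 1"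
    using monomials_period[OF assms] by blast
  have "finite {\<xi>::complex. \<xi> ^ M0 = 1}"
    using M0(1) by (intro finite_roots_unity) auto
  then show ?thesis by (rule finite_subset[rotated]) (use M0 in auto)
qed

lemma monomial_prefix_prod: "i \<le> length z \<Longrightarrow> prefix_prod z i \<in> monomials z"
proof -
  assume i: "i \<le> length z"
  have "(\<Prod>j<length z. z ! j ^ ((map (\<lambda>j. if j < i then 1 else 0) [0..<length z]) ! j))
     = (\<Prod>j<length z. if j \<in> {..<i} then z ! j else 1)"
    by (intro prod.cong) auto
  also have "\<dots> = (\<Prod>j\<in>{..<length z} \<inter> {..<i}. z ! j)"
    by (subst prod.inter_restrict) auto
  also have "{..<length z} \<inter> {..<i} = {..<i}" using i by auto
  finally show ?thesis unfolding monomials_def prefix_prod_def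
    by (intro CollectI exI[of _ "map (\<lambda>j. if j < i then 1 else 0) [0..<length z]"]) simp
qed

lemma one_monomial: "1 \<in> monomials z"
  using monomial_prefix_prod[of 0 z] by (simp add: prefix_prod_def)

text \<open>Coefficients outside the original range are set to 0, so that two expansions can be
  taken with common cut-offs.\<close>

lemma reg_const_pad:
  assumes "reg_const z u c"
  obtains L0 M0 coef where "c = coef 0 0 1"
    "\<And>L M. L \<ge> L0 \<Longrightarrow> M \<ge> M0 \<Longrightarrow> (\<lambda>N. u N - log_sum z L M coef N) \<longlonglongrightarrow> 0"
proof -
  obtain L0 M0 coef where 1: "(\<lambda>N. u N - log_sum z L0 M0 coef N) \<longlonglongrightarrow> 0"
     "c = coef 0 0 1"
    using assms unfolding reg_const_def by blast
  define coef' where "coef' l m \<xi> = (if l \<le> L0 \<and> m \<le> M0 then coef l m \<xi> else 0)" for l m \<xi>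
  have eq: "log_sum z L M coef' N
     = log_sum z L0 M0 coef N"
    if "L \<ge> L0" "M \<ge> M0" for L M N
  proof -
    have "log_sum z L M coef' N
        = log_sum z L0 M coef' N"
      by (rule sum.mono_neutral_right) (use that in \<open>auto simp: coef'_def\<close>)
    also have "\<dots> = log_sum z L0 M0 coef' N"
      by (rule sum.cong[OF refl], rule sum.mono_neutral_right) (use that in \<open>auto simp: coef'_def\<close>)
    also have "\<dots> = log_sum z L0 M0 coef N"
      by (intro sum.cong) (auto simp: coef'_def)
    finally show ?thesis .
  qed
  show ?thesis
    by (rule that[of coef' L0 M0]) (use 1 eq in \<open>auto simp: coef'_def\<close>)
qed

lemma reg_const_add:
  assumes "reg_const z u c" "reg_const z v d"
  shows "reg_const z (\<lambda>N. u N + v N) (c + d)"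
proof -
  obtain L1 M1 f where 1: "c = f 0 0 1"
    "\<And>L M. L \<ge> L1 \<Longrightarrow> M \<ge> M1 \<Longrightarrow> (\<lambda>N. u N - log_sum z L M f N) \<longlonglongrightarrow> 0"
    by (rule reg_const_pad[OF assms(1)]) blast
  obtain L2 M2 g where 2: "d = g 0 0 1"
    "\<And>L M. L \<ge> L2 \<Longrightarrow> M \<ge> M2 \<Longrightarrow> (\<lambda>N. v N - log_sum z L M g N) \<longlonglongrightarrow> 0"
    by (rule reg_const_pad[OF assms(2)]) blast
  show ?thesis
    unfolding reg_const_def
  proof (rule exI[of _ "max L1 L2"], rule exI[of _ "max M1 M2"], rule exI[of _ "\<lambda>l m \<xi>. f l m \<xi> + g l m \<xi>"], rule conjI)
    show "(\<lambda>N. u N + v N - (\<Sum>l\<le>max L1 L2. \<Sum>m\<le>max M1 M2. \<Sum>\<xi>\<in>monomials z.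
         (f l m \<xi> + g l m \<xi>) * \<xi> ^ N * (of_real (ln (real N))) ^ l * (of_nat N) ^ m)) \<longlonglongrightarrow> 0"
      using tendsto_add[OF 1(2)[of "max L1 L2" "max M1 M2"] 2(2)[of "max L1 L2" "max M1 M2"]]
      by (simp add: ring_distribs sum.distrib algebra_simps)
  qed (use 1 2 in simp)
qed

lemma reg_const_cmult:
  assumes "reg_const z u c"
  shows "reg_const z (\<lambda>N. b * u N) (b * c)"
proof -
  obtain L1 M1 f where 1: "c = f 0 0 1"
    "\<And>L M. L \<ge> L1 \<Longrightarrow> M \<ge> M1 \<Longrightarrow> (\<lambda>N. u N - log_sum z L M f N) \<longlonglongrightarrow> 0"
    by (rule reg_const_pad[OF assms(1)]) blast
  show ?thesis
    unfolding reg_const_def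
  proof (rule exI[of _ L1], rule exI[of _ M1], rule exI[of _ "\<lambda>l m \<xi>. b * f l m \<xi>"], rule conjI)
    show "(\<lambda>N. b * u N - (\<Sum>l\<le>L1. \<Sum>m\<le>M1. \<Sum>\<xi>\<in>monomials z.
         (b * f l m \<xi>) * \<xi> ^ N * (of_real (ln (real N))) ^ l * (of_nat N) ^ m)) \<longlonglongrightarrow> 0"
      using tendsto_mult_right_zero[OF 1(2)[of L1 M1], of b]
      by (simp add: right_diff_distrib sum_distrib_left mult.assoc)
  qed (use 1 in simp)
qed

lemma reg_const_null: "u \<longlonglongrightarrow> 0 \<Longrightarrow> reg_const z u 0"
  unfolding reg_const_def by (intro exI[of _ 0] exI[of _ 0] exI[of _ "\<lambda>l m \<xi>. 0"]) simp

lemma reg_const_diff: "reg_const z u c \<Longrightarrow> reg_const z v d \<Longrightarrow> reg_const z (\<lambda>N. u N - v N) (c - d)"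
  using reg_const_add[of z u c "\<lambda>N. (-1) * v N" "(-1) * d"] reg_const_cmult[of z v d "-1"] by simp

lemma reg_const_sum:
  "(\<And>i. i \<in> I \<Longrightarrow> reg_const z (u i) (c i)) \<Longrightarrow> reg_const z (\<lambda>N. \<Sum>i\<in>I. u i N) (\<Sum>i\<in>I. c i)"
  by (induction I rule: infinite_finite_induct) (auto intro: reg_const_null reg_const_add)

lemma reg_const_cong:
  assumes "reg_const z u c" "\<forall>\<^sub>F N in sequentially. u N = v N"
  shows "reg_const z v c"
proof -
  have "(\<lambda>N. v N - u N) \<longlonglongrightarrow> 0"
    by (rule tendsto_eventually) (use assms(2) in \<open>auto elim: eventually_mono\<close>)
  from reg_const_add[OF assms(1) reg_const_null[OF this]] show ?thesis by simp
qed

text \<open>The argument is -ln N because each derivative of N^(-s) brings down that factor. No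
  positive power of N occurs, so the constant term is the value of P at 0, present only without
  oscillation.\<close>

lemma reg_const_log_poly:
  assumes "\<xi> \<in> monomials z" "finite (monomials z)"
  shows "reg_const z (\<lambda>N. \<xi> ^ N * poly P (- of_real (ln (real N)))) (if \<xi> = 1 then poly P 0 else 0)"
  unfolding reg_const_def
proof (rule exI[of _ "degree P"], rule exI[of _ 0],
    rule exI[of _ "\<lambda>l m \<xi>'. if \<xi>' = \<xi> then coeff P l * (-1) ^ l else 0"], rule conjI)
  have "\<xi> ^ N * poly P (- of_real (ln (real N))) - (\<Sum>l\<le>degree P. \<Sum>m\<le>0. \<Sum>\<xi>'\<in>monomials z.
         (if \<xi>' = \<xi> then coeff P l * (-1) ^ l else 0) * \<xi>' ^ N * (of_real (ln (real N))) ^ l * (of_nat N) ^ m) = 0" for N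
  proof -
    have "(\<Sum>\<xi>'\<in>monomials z. (if \<xi>' = \<xi> then coeff P l * (-1) ^ l else 0) * \<xi>' ^ N * (of_real (ln (real N))) ^ l)
      = (\<Sum>\<xi>'\<in>monomials z. if \<xi>' = \<xi> then coeff P l * (-1) ^ l * \<xi> ^ N * (of_real (ln (real N))) ^ l else 0)" for l
      by (intro sum.cong) auto
    also have "\<dots> l = \<xi> ^ N * (coeff P l * (- of_real (ln (real N))) ^ l)" for l
      using assms by (simp add: sum.delta power_minus[of "of_real _"])
    finally show ?thesis by (simp add: poly_altdef sum_distrib_left)
  qed
  then show "(\<lambda>N. \<xi> ^ N * poly P (- of_real (ln (real N))) - (\<Sum>l\<le>degree P. \<Sum>m\<le>0. \<Sum>\<xi>'\<in>monomials z.
         (if \<xi>' = \<xi> then coeff P l * (-1) ^ l else 0) * \<xi>' ^ N * (of_real (ln (real N))) ^ l * (of_nat N) ^ m)) \<longlonglongrightarrow> 0"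
    by simp
qed (auto simp: poly_0_coeff_0)

text \<open>On each residue class modulo the common period the \<xi>^N are constant, so
  \<open>log_poly_independent\<close> shows that the \<open>f 0 0 \<xi> * \<xi> ^ b\<close> sum to 0
  for each b. Summing over b isolates \<xi> = 1.\<close>

lemma reg_const_zero_unique:
  assumes z: "\<forall>x\<in>set z. root_of_unity x" and r: "reg_const z (\<lambda>N. 0) c"
  shows "c = 0"
proof -
  obtain L M f where f: "c = f 0 0 1"
    "\<And>L' M'. L' \<ge> L \<Longrightarrow> M' \<ge> M \<Longrightarrow> (\<lambda>N. 0 - log_sum z L' M' f N) \<longlonglongrightarrow> 0"
    by (rule reg_const_pad[OF r]) blast
  obtain M0 where M0: "M0 > 0" "\<And>\<xi>. \<xi> \<in> monomials z \<Longrightarrow> \<xi> ^ M0 = 1"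
    using monomials_period[OF z] by blast
  have fin: "finite (monomials z)" by (rule finite_monomials[OF z])
  have zero: "(\<Sum>\<xi>\<in>monomials z. f 0 0 \<xi> * \<xi> ^ b) = 0" for b
  proof -
    \<comment> \<open>\<open>Suc n\<close> keeps \<open>x n\<close> positive also for b = 0, so that
      exp inverts ln.\<close>
    define x where "x n = M0 * Suc n + b" for n
    have xt: "filterlim x at_top sequentially"
      unfolding filterlim_at_top eventually_sequentially x_def using M0(1)
      by (metis le_add1 le_trans mult_le_mono1 mult_1 Suc_leI One_nat_def le_SucI)
    have y: "filterlim (\<lambda>n. ln (real (x n))) at_top sequentially"
      by (rule filterlim_compose[OF ln_at_top filterlim_compose[OF filterlim_real_sequentially xt]])
    have "x n > 0" for n using M0(1) by (simp add: x_def)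
    then have xpos: "real (x n) > 0" for n by simp
    have "(\<lambda>N. - (0 - log_sum z L M f N)) \<longlonglongrightarrow> 0"
      using tendsto_minus[OF f(2)[of L M]] by simp
    from filterlim_compose[OF this xt]
    have "(\<lambda>n. \<Sum>l\<le>L. \<Sum>m\<le>M. \<Sum>\<xi>\<in>monomials z.
              f l m \<xi> * \<xi> ^ x n * (of_real (ln (real (x n)))) ^ l * (of_nat (x n)) ^ m) \<longlonglongrightarrow> 0"
      by simp
    also have "(\<lambda>n. \<Sum>l\<le>L. \<Sum>m\<le>M. \<Sum>\<xi>\<in>monomials z.
              f l m \<xi> * \<xi> ^ x n * (of_real (ln (real (x n)))) ^ l * (of_nat (x n)) ^ m)
        = (\<lambda>n. \<Sum>l\<le>L. \<Sum>m\<le>M. (\<Sum>\<xi>\<in>monomials z. f l m \<xi> * \<xi> ^ b) *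
           of_real (ln (real (x n))) ^ l * of_real (exp (ln (real (x n)))) ^ m)"
    proof (intro ext sum.cong refl)
      fix n l m
      have "\<xi> ^ x n = \<xi> ^ b" if "\<xi> \<in> monomials z" for \<xi>
        using M0(2)[OF that] by (simp add: x_def power_add power_mult)
      then show "(\<Sum>\<xi>\<in>monomials z. f l m \<xi> * \<xi> ^ x n * (of_real (ln (real (x n)))) ^ l * (of_nat (x n)) ^ m)
        = (\<Sum>\<xi>\<in>monomials z. f l m \<xi> * \<xi> ^ b) *
           of_real (ln (real (x n))) ^ l * of_real (exp (ln (real (x n)))) ^ m"
        using xpos by (simp add: sum_distrib_right)
    qed
    finally show ?thesis
      by (rule log_poly_independent[OF y]) auto
  qed
  have geo: "(\<Sum>b<M0. \<xi> ^ b) = (if \<xi> = 1 then of_nat M0 else 0)" if "\<xi> \<in> monomials z" for \<xi>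
    using M0(2)[OF that] by (auto simp: geometric_sum)
  have "0 = (\<Sum>b<M0. \<Sum>\<xi>\<in>monomials z. f 0 0 \<xi> * \<xi> ^ b)" by (simp add: zero)
  also have "\<dots> = (\<Sum>\<xi>\<in>monomials z. f 0 0 \<xi> * (\<Sum>b<M0. \<xi> ^ b))"
    by (subst sum.swap) (simp add: sum_distrib_left)
  also have "\<dots> = (\<Sum>\<xi>\<in>monomials z. if \<xi> = 1 then f 0 0 1 * of_nat M0 else 0)"
    by (intro sum.cong) (auto simp: geo)
  also have "\<dots> = f 0 0 1 * of_nat M0" using fin one_monomial[of z] by (simp add: sum.delta)
  finally show ?thesis using M0(1) f(1) by simp
qed

lemma reg_const_unique:
  assumes "\<forall>x\<in>set z. root_of_unity x" "reg_const z u c" "reg_const z u d"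
  shows "c = d"
  using reg_const_zero_unique[OF assms(1), of "c - d"] reg_const_diff[OF assms(2,3)] by simp

lemma reg_val_eqI:
  assumes "\<forall>x\<in>set z. root_of_unity x" "reg_const z (reg_partial z a k) c"
  shows "reg_val z a k = c"
  unfolding reg_val_eq by (rule the_equality) (use assms reg_const_unique in blast)+

section \<open>Division of coefficient families by linear forms\<close>

definition dec_at :: "nat \<Rightarrow> nat list \<Rightarrow> nat list" where "dec_at p ks = ks[p := ks ! p - 1]"
definition inc_at :: "nat \<Rightarrow> nat list \<Rightarrow> nat list" where "inc_at p ks = ks[p := Suc (ks ! p)]"

lemma dec_at_inc_at: "p < length ks \<Longrightarrow> dec_at p (inc_at p ks) = ks"
  by (simp add: dec_at_def inc_at_def)

lemma inc_at_dec_at: "p < length ks \<Longrightarrow> ks ! p \<noteq> 0 \<Longrightarrow> inc_at p (dec_at p ks) = ks"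
  by (simp add: dec_at_def inc_at_def)

lemma length_inc_at_dec_at [simp]: "length (inc_at p ks) = length ks" "length (dec_at p ks) = length ks"
  by (simp_all add: inc_at_def dec_at_def)

lemma sum_list_inc_at: "p < length ks \<Longrightarrow> sum_list (inc_at p ks) = Suc (sum_list ks)"
  by (simp add: inc_at_def sum_list_update)

lemma sum_list_dec_at:
  assumes "p < length ks" "ks ! p \<noteq> 0" shows "Suc (sum_list (dec_at p ks)) = sum_list ks"
  using sum_list_inc_at[of p "dec_at p ks"] inc_at_dec_at[OF assms] assms by simp

lemma monomial_at_inc_at:
  assumes "p < length ks" "length ks = length a"
  shows "monomial_at a s (inc_at p ks) = (s ! p - a ! p) * monomial_at a s ks"
proof -
  have "monomial_at a s (inc_at p ks) = (s ! p - a ! p) ^ (inc_at p ks ! p) * (\<Prod>j\<in>{..<length ks} - {p}. (s ! j - a ! j) ^ (inc_at p ks ! j))"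
    unfolding monomial_at_def using assms by (subst prod.remove[of _ p]) auto
  also have "(\<Prod>j\<in>{..<length ks} - {p}. (s ! j - a ! j) ^ (inc_at p ks ! j)) = (\<Prod>j\<in>{..<length ks} - {p}. (s ! j - a ! j) ^ (ks ! j))"
    by (intro prod.cong) (auto simp: inc_at_def)
  also have "inc_at p ks ! p = Suc (ks ! p)" using assms by (simp add: inc_at_def)
  also have "(s ! p - a ! p) ^ Suc (ks ! p) * (\<Prod>j\<in>{..<length ks} - {p}. (s ! j - a ! j) ^ (ks ! j))
     = (s ! p - a ! p) * monomial_at a s ks"
    unfolding monomial_at_def using assms by (subst prod.remove[of "{..<length ks}" p]) (auto simp: mult_ac)
  finally show ?thesis .
qed

lemma monomial_at_dec_at:
  assumes "p < length ks" "length ks = length a" "0 < ks ! p"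
  shows "(s ! p - a ! p) * (b * monomial_at a s (dec_at p ks)) = b * monomial_at a s ks"
  using monomial_at_inc_at[of p "dec_at p ks" a s] inc_at_dec_at[of p ks] assms by simp

lemma inc_at_nth: "p < length ks \<Longrightarrow> inc_at p ks ! p = Suc (ks ! p)"
  by (simp add: inc_at_def)

lemma has_sum_finite_sum:
  fixes f :: "'i \<Rightarrow> 'a \<Rightarrow> 'b::topological_comm_monoid_add"
  shows "(\<And>i. i \<in> I \<Longrightarrow> (f i has_sum S i) A) \<Longrightarrow> ((\<lambda>x. \<Sum>i\<in>I. f i x) has_sum (\<Sum>i\<in>I. S i)) A"
  by (induction I rule: infinite_finite_induct) (auto intro: has_sum_0 has_sum_add)

text \<open>Multiplication by \<open>s ! p - a ! p\<close> raises the exponent at p, a reindexing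
  along \<open>inc_at\<close>. The case distinction is there because \<open>dec_at\<close>
  truncates: at an entry 0 it returns ks itself.\<close>

lemma has_sum_dec_at:
  assumes b: "((\<lambda>ks. b ks * monomial_at a s ks) has_sum S) (multi_idx d)" and p: "p < d" and a: "length a = d"
  shows "((\<lambda>ks. (if ks ! p = 0 then 0 else b (dec_at p ks)) * monomial_at a s ks) has_sum (s ! p - a ! p) * S) (multi_idx d)"
proof -
  have "((\<lambda>ks. b (dec_at p ks) * monomial_at a s ks) has_sum (s ! p - a ! p) * S) {ks \<in> multi_idx d. ks ! p \<noteq> 0}
     \<longleftrightarrow> ((\<lambda>ks. (s ! p - a ! p) * (b ks * monomial_at a s ks)) has_sum (s ! p - a ! p) * S) (multi_idx d)"
    by (rule has_sum_reindex_bij_witness[of _ "inc_at p" "dec_at p"])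
       (use p a in \<open>auto simp: multi_idx_def dec_at_inc_at inc_at_dec_at monomial_at_dec_at inc_at_nth\<close>)
  then have "((\<lambda>ks. b (dec_at p ks) * monomial_at a s ks) has_sum (s ! p - a ! p) * S) {ks \<in> multi_idx d. ks ! p \<noteq> 0}"
    using has_sum_cmult_right[OF b] by blast
  then show ?thesis
    by (rule has_sum_cong_neutral[THEN iffD1, rotated -1]) auto
qed

text \<open>Division of a power series by a linear form, on the level of coefficients. If the constant term c
  of the form is nonzero, one solves for the coefficient at ks. Otherwise one solves for it in the
  equation with index raised in a chosen variable \<open>p0\<close>; the other coefficients that occur have
  smaller degree in the variables of \<open>P - {p0}\<close>.\<close>

lemma reg_const_division_step:
  fixes V :: "nat list \<Rightarrow> nat \<Rightarrow> complex" and A :: "nat list \<Rightarrow> complex"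
  assumes z: "\<forall>x\<in>set z. root_of_unity x" and P: "P \<subseteq> {..<d}" "P \<noteq> {}" and C: "C \<ge> 0" and R: "R \<ge> 1"
    and A: "\<And>ks. ks \<in> multi_idx d \<Longrightarrow>
       reg_const z (\<lambda>N. c * V ks N + (\<Sum>p\<in>P. if ks ! p = 0 then 0 else V (dec_at p ks) N)) (A ks)"
    and Ab: "\<And>ks. ks \<in> multi_idx d \<Longrightarrow> cmod (A ks) \<le> C * R ^ sum_list ks"
  obtains b C' R' where "C' \<ge> 0" "R' \<ge> 1"
    "\<And>ks. ks \<in> multi_idx d \<Longrightarrow> reg_const z (V ks) (b ks)"
    "\<And>ks. ks \<in> multi_idx d \<Longrightarrow> cmod (b ks) \<le> C' * R' ^ sum_list ks"
    "\<And>ks. ks \<in> multi_idx d \<Longrightarrow> A ks = c * b ks + (\<Sum>p\<in>P. if ks ! p = 0 then 0 else b (dec_at p ks))"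
proof -
  have finP: "finite P" using P finite_subset by blast
  have cardP: "card P \<le> d" using card_mono[OF _ P(1)] by simp
  have "\<exists>C'\<ge>0. \<exists>R'\<ge>1. \<forall>ks\<in>multi_idx d. \<exists>b. reg_const z (V ks) b \<and> cmod b \<le> C' * R' ^ sum_list ks"
  proof (cases "c = 0")
    case False
    \<comment> \<open>With these constants the at most d lower coefficients use up one half of the
      bound for the coefficient at ks, and \<open>A ks\<close> uses up the other half.\<close>
    define C' where "C' = 2 * C / cmod c"
    define R' where "R' = max R (2 * real d / cmod c)"
    have C': "C' \<ge> 0" using C by (simp add: C'_def)
    have "2 * real d / cmod c \<le> R'" by (simp add: R'_def)
    then have "real d / cmod c \<le> R' / 2" by (simp add: field_simps)
    then have R': "R' \<ge> 1" "R' \<ge> R" "real d / cmod c \<le> R' / 2" using R by (simp_all add: R'_def)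
    have "\<exists>b. reg_const z (V ks) b \<and> cmod b \<le> C' * R' ^ sum_list ks" if "ks \<in> multi_idx d" for ks
      using that
    proof (induction "sum_list ks" arbitrary: ks rule: less_induct)
      case less
      have len: "length ks = d" using less.prems by (simp add: multi_idx_def)
      have "\<forall>p\<in>{p\<in>P. ks ! p \<noteq> 0}. \<exists>b. reg_const z (V (dec_at p ks)) b \<and> cmod b \<le> C' * R' ^ sum_list (dec_at p ks)"
      proof
        fix p assume p: "p \<in> {p\<in>P. ks ! p \<noteq> 0}"
        then have "p < length ks" using P len by auto
        then show "\<exists>b. reg_const z (V (dec_at p ks)) b \<and> cmod b \<le> C' * R' ^ sum_list (dec_at p ks)"
          using sum_list_dec_at[of p ks] p less.prems by (intro less.hyps) (auto simp: multi_idx_def)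
      qed
      from bchoice[OF this] obtain b where b: "\<And>p. p \<in> P \<Longrightarrow> ks ! p \<noteq> 0 \<Longrightarrow>
          reg_const z (V (dec_at p ks)) (b p) \<and> cmod (b p) \<le> C' * R' ^ sum_list (dec_at p ks)" by auto
      define B where "B = (\<Sum>p\<in>P. if ks ! p = 0 then 0 else b p)"
      have "reg_const z (\<lambda>N. \<Sum>p\<in>P. if ks ! p = 0 then 0 else V (dec_at p ks) N) B"
        unfolding B_def using b by (intro reg_const_sum) (auto intro: reg_const_null)
      from reg_const_cmult[OF reg_const_diff[OF A[OF less.prems] this], of "1 / c"]
      have r: "reg_const z (V ks) ((A ks - B) / c)" using False by simp
      have "cmod B \<le> (\<Sum>p\<in>P. C' * R' ^ sum_list ks / R')"
        unfolding B_def
      proof (rule sum_norm_le)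
        fix p assume p: "p \<in> P"
        show "cmod (if ks ! p = 0 then 0 else b p) \<le> C' * R' ^ sum_list ks / R'"
        proof (cases "ks ! p = 0")
          case False
          have "p < length ks" using P p len by auto
          from sum_list_dec_at[OF this False] have "R' ^ sum_list ks = R' * R' ^ sum_list (dec_at p ks)"
            by (metis power_Suc)
          then show ?thesis using b[OF p False] False R' by simp
        qed (use C' R' in auto)
      qed
      also have "\<dots> = real (card P) * (C' * R' ^ sum_list ks / R')" by simp
      also have "\<dots> \<le> real d * (C' * R' ^ sum_list ks / R')"
        using C' R' cardP by (intro mult_right_mono) auto
      finally have "cmod B \<le> real d * (C' * R' ^ sum_list ks / R')" .
      then have "cmod B / cmod c \<le> real d * (C' * R' ^ sum_list ks / R') / cmod c"
        by (intro divide_right_mono) auto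
      also have "\<dots> = real d / cmod c * (C' * R' ^ sum_list ks / R')" by simp
      also have "\<dots> \<le> R' / 2 * (C' * R' ^ sum_list ks / R')"
        using C' R' by (intro mult_right_mono) auto
      also have "\<dots> = C' / 2 * R' ^ sum_list ks" using R' by simp
      finally have 1: "cmod B / cmod c \<le> C' / 2 * R' ^ sum_list ks" .
      have "cmod (A ks) \<le> C * R' ^ sum_list ks"
        using Ab[OF less.prems] C R R' power_mono[of R R' "sum_list ks"]
        by (meson mult_left_mono order_trans zero_le_one)
      then have 2: "cmod (A ks) / cmod c \<le> C' / 2 * R' ^ sum_list ks"
        by (simp add: C'_def divide_right_mono)
      have "cmod ((A ks - B) / c) \<le> cmod (A ks) / cmod c + cmod B / cmod c"
        by (simp add: norm_divide divide_right_mono norm_triangle_ineq4 flip: add_divide_distrib)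
      also have "\<dots> \<le> C' / 2 * R' ^ sum_list ks + C' / 2 * R' ^ sum_list ks"
        using 1 2 by (rule add_mono[rotated])
      finally have "cmod ((A ks - B) / c) \<le> C' * R' ^ sum_list ks" by simp
      with r show ?case by blast
    qed
    with C' R' show ?thesis by blast
  next
    case True
    obtain p0 where p0: "p0 \<in> P" using P by blast
    define \<mu> where "\<mu> ks = (\<Sum>p\<in>P - {p0}. ks ! p)" for ks :: "nat list"
    \<comment> \<open>The equation is used at an index of degree one higher, hence
      \<open>Suc\<close>. Besides A at most d coefficients with smaller \<mu> enter, which costs a
      factor d + 1 for each unit of \<mu>.\<close>
    have "\<exists>b. reg_const z (V ks) b \<and> cmod b \<le> C * R ^ Suc (sum_list ks) * real (Suc d) ^ \<mu> ks"
      if "ks \<in> multi_idx d" for ks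
      using that
    proof (induction "\<mu> ks" arbitrary: ks rule: less_induct)
      case less
      have len: "length ks = d" using less.prems by (simp add: multi_idx_def)
      have p0d: "p0 < d" using p0 P by auto
      define ks1 where "ks1 = inc_at p0 ks"
      have ks1: "ks1 \<in> multi_idx d" "length ks1 = d" using len by (simp_all add: ks1_def multi_idx_def)
      have k1: "ks1 ! p = ks ! p" if "p \<noteq> p0" for p using that by (simp add: ks1_def inc_at_def)
      have \<mu>1: "Suc (\<mu> (dec_at p ks1)) = \<mu> ks" "sum_list (dec_at p ks1) = sum_list ks" if p: "p \<in> P - {p0}" "ks ! p \<noteq> 0" for p
      proof -
        have pd: "p < d" using p P by auto
        have "\<mu> ks = ks ! p + (\<Sum>q\<in>P - {p0} - {p}. ks ! q)"
          unfolding \<mu>_def using finP p by (subst sum.remove[of _ p]) auto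
        moreover have "\<mu> (dec_at p ks1) = dec_at p ks1 ! p + (\<Sum>q\<in>P - {p0} - {p}. dec_at p ks1 ! q)"
          unfolding \<mu>_def using finP p by (subst sum.remove[of _ p]) auto
        moreover have "(\<Sum>q\<in>P - {p0} - {p}. dec_at p ks1 ! q) = (\<Sum>q\<in>P - {p0} - {p}. ks ! q)"
          by (intro sum.cong) (auto simp: dec_at_def k1)
        moreover have "Suc (dec_at p ks1 ! p) = ks ! p" using p pd ks1 by (simp add: dec_at_def k1)
        ultimately show "Suc (\<mu> (dec_at p ks1)) = \<mu> ks" by simp
        have "Suc (sum_list (dec_at p ks1)) = sum_list ks1"
          using p pd ks1 k1[of p] by (intro sum_list_dec_at) auto
        then show "sum_list (dec_at p ks1) = sum_list ks"
          using sum_list_inc_at[of p0 ks] p0d len by (simp add: ks1_def)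
      qed
      have "\<forall>p\<in>{p\<in>P - {p0}. ks ! p \<noteq> 0}. \<exists>b. reg_const z (V (dec_at p ks1)) b \<and>
          cmod b \<le> C * R ^ Suc (sum_list (dec_at p ks1)) * real (Suc d) ^ \<mu> (dec_at p ks1)"
      proof
        fix p assume p: "p \<in> {p\<in>P - {p0}. ks ! p \<noteq> 0}"
        then show "\<exists>b. reg_const z (V (dec_at p ks1)) b \<and>
          cmod b \<le> C * R ^ Suc (sum_list (dec_at p ks1)) * real (Suc d) ^ \<mu> (dec_at p ks1)"
          using \<mu>1(1)[of p] ks1 by (intro less.hyps) (auto simp: multi_idx_def)
      qed
      from bchoice[OF this] obtain b where b: "\<And>p. p \<in> P - {p0} \<Longrightarrow> ks ! p \<noteq> 0 \<Longrightarrow>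
          reg_const z (V (dec_at p ks1)) (b p) \<and> cmod (b p) \<le> C * R ^ Suc (sum_list (dec_at p ks1)) * real (Suc d) ^ \<mu> (dec_at p ks1)"
        by auto
      define B where "B = (\<Sum>p\<in>P - {p0}. if ks ! p = 0 then 0 else b p)"
      have rB: "reg_const z (\<lambda>N. \<Sum>p\<in>P - {p0}. if ks ! p = 0 then 0 else V (dec_at p ks1) N) B"
        unfolding B_def using b by (intro reg_const_sum) (auto intro: reg_const_null)
      have "(\<Sum>p\<in>P. if ks1 ! p = 0 then 0 else V (dec_at p ks1) N)
          = V ks N + (\<Sum>p\<in>P - {p0}. if ks ! p = 0 then 0 else V (dec_at p ks1) N)" for N
      proof -
        have "(\<Sum>p\<in>P. if ks1 ! p = 0 then 0 else V (dec_at p ks1) N) =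
          (if ks1 ! p0 = 0 then 0 else V (dec_at p0 ks1) N) + (\<Sum>p\<in>P - {p0}. if ks1 ! p = 0 then 0 else V (dec_at p ks1) N)"
          by (rule sum.remove[OF finP p0])
        also have "(if ks1 ! p0 = 0 then 0 else V (dec_at p0 ks1) N) = V ks N"
          using p0d len by (simp add: ks1_def dec_at_inc_at) (simp add: inc_at_def)
        also have "(\<Sum>p\<in>P - {p0}. if ks1 ! p = 0 then 0 else V (dec_at p ks1) N)
           = (\<Sum>p\<in>P - {p0}. if ks ! p = 0 then 0 else V (dec_at p ks1) N)"
          by (intro sum.cong) (auto simp: k1)
        finally show ?thesis .
      qed
      with reg_const_diff[OF A[OF ks1(1)] rB] True have r: "reg_const z (V ks) (A ks1 - B)" by simp
      define D where "D = C * R ^ Suc (sum_list ks)"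
      have D: "D \<ge> 0" using C R by (simp add: D_def)
      have "cmod (A ks1) \<le> D"
        using Ab[OF ks1(1)] sum_list_inc_at[of p0 ks] p0d len by (simp add: D_def ks1_def)
      have "cmod (A ks1 - B) \<le> D * real (Suc d) ^ \<mu> ks"
      proof (cases "\<mu> ks")
        case 0
        then have "\<forall>p\<in>P - {p0}. ks ! p = 0" using finP by (simp add: \<mu>_def)
        then have "B = 0" unfolding B_def by (intro sum.neutral) auto
        then show ?thesis using \<open>cmod (A ks1) \<le> D\<close> 0 by simp
      next
        case (Suc m)
        have "cmod B \<le> (\<Sum>p\<in>P - {p0}. D * real (Suc d) ^ m)"
          unfolding B_def
        proof (rule sum_norm_le)
          fix p assume p: "p \<in> P - {p0}"
          show "cmod (if ks ! p = 0 then 0 else b p) \<le> D * real (Suc d) ^ m"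
            using b[OF p] \<mu>1[OF p] Suc D by (auto simp: D_def)
        qed
        also have "\<dots> \<le> real d * (D * real (Suc d) ^ m)"
        proof -
          have "card (P - {p0}) \<le> d" using cardP card_mono[OF finP, of "P - {p0}"] by auto
          then show ?thesis using D by (simp add: mult_right_mono)
        qed
        finally have "cmod B \<le> real d * (D * real (Suc d) ^ m)" .
        moreover have "D * 1 \<le> D * real (Suc d) ^ m"
          using D by (intro mult_left_mono one_le_power) auto
        ultimately have "cmod (A ks1) + cmod B \<le> real (Suc d) * (D * real (Suc d) ^ m)"
          using \<open>cmod (A ks1) \<le> D\<close> by (simp add: algebra_simps)
        then show ?thesis using norm_triangle_ineq4[of "A ks1" B] Suc by (simp add: mult_ac)
      qed
      with r show ?case unfolding D_def by blast
    qed
    \<comment> \<open>\<mu> is at most the total degree, so the extra factor becomes part of the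
      geometric rate.\<close>
    moreover have "C * R ^ Suc (sum_list ks) * real (Suc d) ^ \<mu> ks \<le> (C * R) * (R * real (Suc d)) ^ sum_list ks"
      if "ks \<in> multi_idx d" for ks
    proof -
      have "\<mu> ks \<le> (\<Sum>p<d. ks ! p)" unfolding \<mu>_def using P by (intro sum_mono2) auto
      also have "\<dots> = sum_list ks" using that by (simp add: multi_idx_def sum_list_sum_nth atLeast0LessThan)
      finally have "real (Suc d) ^ \<mu> ks \<le> real (Suc d) ^ sum_list ks" by (intro power_increasing) auto
      then have "(C * R * R ^ sum_list ks) * real (Suc d) ^ \<mu> ks \<le> (C * R * R ^ sum_list ks) * real (Suc d) ^ sum_list ks"
        using C R by (intro mult_left_mono) auto
      then show ?thesis by (simp add: power_mult_distrib mult_ac)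
    qed
    ultimately have "\<forall>ks\<in>multi_idx d. \<exists>b. reg_const z (V ks) b \<and> cmod b \<le> (C * R) * (R * real (Suc d)) ^ sum_list ks"
      by (meson order_trans)
    moreover have "R * real (Suc d) \<ge> 1 * 1" using R by (intro mult_mono) auto
    ultimately show ?thesis using C R by (intro exI[of _ "C * R"] exI[of _ "R * real (Suc d)"]) auto
  qed
  then obtain C' R' where CR: "C' \<ge> 0" "R' \<ge> 1" "\<forall>ks\<in>multi_idx d. \<exists>b. reg_const z (V ks) b \<and> cmod b \<le> C' * R' ^ sum_list ks"
    by blast
  from bchoice[OF CR(3)] obtain b where b: "\<And>ks. ks \<in> multi_idx d \<Longrightarrow> reg_const z (V ks) (b ks) \<and> cmod (b ks) \<le> C' * R' ^ sum_list ks"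
    by blast
  \<comment> \<open>Both sides are constant terms of the same sequence, so uniqueness transfers the
    recursion from V to its constant terms.\<close>
  have "A ks = c * b ks + (\<Sum>p\<in>P. if ks ! p = 0 then 0 else b (dec_at p ks))" if ks: "ks \<in> multi_idx d" for ks
  proof (rule reg_const_unique[OF z A[OF ks]])
    have dk: "dec_at p ks \<in> multi_idx d" for p using ks by (simp add: multi_idx_def)
    show "reg_const z (\<lambda>N. c * V ks N + (\<Sum>p\<in>P. if ks ! p = 0 then 0 else V (dec_at p ks) N))
       (c * b ks + (\<Sum>p\<in>P. if ks ! p = 0 then 0 else b (dec_at p ks)))"
      using b[OF ks] b[OF dk] by (intro reg_const_add reg_const_cmult reg_const_sum) (auto intro: reg_const_null)
  qed
  with b CR that show ?thesis by blast
qed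

text \<open>The form is expanded at a, as its value there plus the sum of the
  \<open>s ! p - a ! p\<close>, and each of these factors lowers one exponent.\<close>

lemma taylor_coeff_form_mult:
  assumes "e > 0" "holo_on (polydisc a e) f" "length ks = length a" "P \<subseteq> {..<length a}"
  shows "taylor_coeff a ks (\<lambda>s. (c + (\<Sum>p\<in>P. s ! p)) * f s) =
    (c + (\<Sum>p\<in>P. a ! p)) * taylor_coeff a ks f + (\<Sum>p\<in>P. if ks ! p = 0 then 0 else taylor_coeff a (dec_at p ks) f)"
proof -
  have co: "holo_on (polydisc a e) (\<lambda>s. s ! p - a ! p)" if "p \<in> P" for p
    by (intro holo_on_diff holo_on_const holo_on_coord) (use that assms(4) polydisc_length in fastforce)
  have "taylor_coeff a ks (\<lambda>s. (c + (\<Sum>p\<in>P. s ! p)) * f s)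
     = taylor_coeff a ks (\<lambda>s. (c + (\<Sum>p\<in>P. a ! p)) * f s + (\<Sum>p\<in>P. (s ! p - a ! p) * f s))"
    by (simp add: sum_distrib_right[symmetric] sum_subtractf) (simp add: algebra_simps)
  also have "\<dots> = taylor_coeff a ks (\<lambda>s. (c + (\<Sum>p\<in>P. a ! p)) * f s) + taylor_coeff a ks (\<lambda>s. \<Sum>p\<in>P. (s ! p - a ! p) * f s)"
    by (intro taylor_coeff_add[OF assms(1)] holo_on_mult holo_on_const holo_on_sum co assms)
  also have "taylor_coeff a ks (\<lambda>s. \<Sum>p\<in>P. (s ! p - a ! p) * f s) = (\<Sum>p\<in>P. taylor_coeff a ks (\<lambda>s. (s ! p - a ! p) * f s))"
    by (intro taylor_coeff_sum[OF assms(1)] holo_on_mult co assms)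
  also have "\<dots> = (\<Sum>p\<in>P. if ks ! p = 0 then 0 else taylor_coeff a (dec_at p ks) f)"
    using assms(4) unfolding dec_at_def by (intro sum.cong taylor_coeff_coord_mult[OF assms(1-3)]) auto
  finally show ?thesis by (simp add: taylor_coeff_cmult[OF assms(1-3)])
qed

text \<open>The last clause multiplies the quotient series by Q instead of dividing by Q, so it also
  covers points where Q vanishes.\<close>

lemma reg_const_division:
  assumes z: "\<forall>x\<in>set z. root_of_unity x" and e: "e > 0" and a: "length a = d"
    and u: "\<And>N. holo_on (polydisc a e) (u N)" and Q: "form_product d Q"
  shows "C \<ge> 0 \<Longrightarrow> R \<ge> 1 \<Longrightarrow> (\<And>ks. ks \<in> multi_idx d \<Longrightarrow> reg_const z (\<lambda>N. taylor_coeff a ks (\<lambda>s. Q s * u N s)) (A ks)) \<Longrightarrow>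
    (\<And>ks. ks \<in> multi_idx d \<Longrightarrow> cmod (A ks) \<le> C * R ^ sum_list ks) \<Longrightarrow>
    \<exists>b C' R'. C' \<ge> 0 \<and> R' \<ge> 1 \<and> (\<forall>ks\<in>multi_idx d. reg_const z (\<lambda>N. taylor_coeff a ks (u N)) (b ks) \<and>
        cmod (b ks) \<le> C' * R' ^ sum_list ks) \<and>
      (\<forall>s S. ((\<lambda>ks. b ks * monomial_at a s ks) has_sum S) (multi_idx d) \<longrightarrow>
         ((\<lambda>ks. A ks * monomial_at a s ks) has_sum Q s * S) (multi_idx d))"
  using Q
proof (induction arbitrary: A C R rule: form_product.induct)
  case one
  then show ?case by (intro exI[of _ A] exI[of _ C] exI[of _ R]) auto
next
  case (step Q P c)
  have Qh: "holo_on (polydisc a e) Q"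
    using step.hyps(1) a by (intro form_product_holo) (auto dest: polydisc_length)
  define c' where "c' = c + (\<Sum>p\<in>P. a ! p)"
  have A': "reg_const z (\<lambda>N. c' * taylor_coeff a ks (\<lambda>s. Q s * u N s) +
      (\<Sum>p\<in>P. if ks ! p = 0 then 0 else taylor_coeff a (dec_at p ks) (\<lambda>s. Q s * u N s))) (A ks)"
    if ks: "ks \<in> multi_idx d" for ks
  proof -
    have "taylor_coeff a ks (\<lambda>s. (c + (\<Sum>p\<in>P. s ! p)) * Q s * u N s) = c' * taylor_coeff a ks (\<lambda>s. Q s * u N s) +
      (\<Sum>p\<in>P. if ks ! p = 0 then 0 else taylor_coeff a (dec_at p ks) (\<lambda>s. Q s * u N s))" for N
      unfolding c'_def mult.assoc
      by (rule taylor_coeff_form_mult[OF e holo_on_mult[OF Qh u]]) (use ks a step.hyps in \<open>auto simp: multi_idx_def\<close>)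
    then show ?thesis using step.prems(3)[OF ks] by simp
  qed
  obtain b1 C1 R1 where b1: "C1 \<ge> 0" "R1 \<ge> 1"
    "\<And>ks. ks \<in> multi_idx d \<Longrightarrow> reg_const z (\<lambda>N. taylor_coeff a ks (\<lambda>s. Q s * u N s)) (b1 ks)"
    "\<And>ks. ks \<in> multi_idx d \<Longrightarrow> cmod (b1 ks) \<le> C1 * R1 ^ sum_list ks"
    "\<And>ks. ks \<in> multi_idx d \<Longrightarrow> A ks = c' * b1 ks + (\<Sum>p\<in>P. if ks ! p = 0 then 0 else b1 (dec_at p ks))"
    by (rule reg_const_division_step[OF z step.hyps(2,3) step.prems(1,2) A' step.prems(4)]) blast+
  obtain b C' R' where b: "C' \<ge> 0" "R' \<ge> 1" "\<forall>ks\<in>multi_idx d. reg_const z (\<lambda>N. taylor_coeff a ks (u N)) (b ks) \<and>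
        cmod (b ks) \<le> C' * R' ^ sum_list ks"
      "\<forall>s S. ((\<lambda>ks. b ks * monomial_at a s ks) has_sum S) (multi_idx d) \<longrightarrow>
         ((\<lambda>ks. b1 ks * monomial_at a s ks) has_sum Q s * S) (multi_idx d)"
    using step.IH[OF b1(1-4)] by blast
  have "((\<lambda>ks. A ks * monomial_at a s ks) has_sum (c + (\<Sum>p\<in>P. s ! p)) * Q s * S) (multi_idx d)"
    if S: "((\<lambda>ks. b ks * monomial_at a s ks) has_sum S) (multi_idx d)" for s S
  proof -
    have h: "((\<lambda>ks. b1 ks * monomial_at a s ks) has_sum Q s * S) (multi_idx d)" using b(4) S by blast
    have "((\<lambda>ks. c' * (b1 ks * monomial_at a s ks) + (\<Sum>p\<in>P. (if ks ! p = 0 then 0 else b1 (dec_at p ks)) * monomial_at a s ks))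
        has_sum c' * (Q s * S) + (\<Sum>p\<in>P. (s ! p - a ! p) * (Q s * S))) (multi_idx d)"
      using step.hyps(2) by (intro has_sum_add has_sum_cmult_right has_sum_finite_sum has_sum_dec_at h a) auto
    moreover have "c' * (Q s * S) + (\<Sum>p\<in>P. (s ! p - a ! p) * (Q s * S)) = (c + (\<Sum>p\<in>P. s ! p)) * Q s * S"
      unfolding c'_def sum_distrib_right[symmetric] sum_subtractf by (simp add: algebra_simps)
    ultimately show ?thesis
      by (subst has_sum_cong[where g = "\<lambda>ks. c' * (b1 ks * monomial_at a s ks) +
            (\<Sum>p\<in>P. (if ks ! p = 0 then 0 else b1 (dec_at p ks)) * monomial_at a s ks)"])
         (auto simp: b1(5) ring_distribs sum_distrib_right mult.assoc)
  qed
  with b show ?case by blast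
qed

section \<open>Meromorphic continuation and the index set\<close>

text \<open>P constrains only the last d coordinates: the smaller polydisc is found for these, and
  the first i coordinates stay centred at those of p.\<close>

lemma generically_drop:
  assumes "generically (disc0 d K) P"
  shows "generically (disc0 (i + d) K) (\<lambda>s. P (drop i s))"
  unfolding generically_def
proof (intro allI impI)
  fix p and e :: real assume e: "e > 0" and sub: "polydisc p e \<subseteq> disc0 (i + d) K"
  have lp: "length p = i + d" using sub e polydisc_center[OF e, of p] polydisc_length by fastforce
  have sub': "polydisc (drop i p) e \<subseteq> disc0 d K"
  proof
    fix x assume x: "x \<in> polydisc (drop i p) e"
    then have "take i p @ x \<in> polydisc p e"
      using lp e by (auto simp: polydisc_def nth_append)
        (metis add_diff_cancel_left' add_diff_inverse_nat less_diff_conv2 linorder_not_less nth_drop add.commute le_add1)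
    then have "take i p @ x \<in> disc0 (i + d) K" using sub by blast
    from polydisc_drop[OF this, of i] show "x \<in> disc0 d K" using lp by simp
  qed
  then obtain q e' where q: "e' > 0" "polydisc q e' \<subseteq> polydisc (drop i p) e" "\<forall>s\<in>polydisc q e'. P s"
    using assms e unfolding generically_def by meson
  have lq: "length q = d" using q polydisc_center[OF q(1), of q] polydisc_length lp by fastforce
  define q' where "q' = take i p @ q"
  have 1: "drop i s \<in> polydisc q e'" if "s \<in> polydisc q' (min e e')" for s
    using polydisc_drop[OF that, of i] polydisc_mono[of "min e e'" e' q] lp by (auto simp: q'_def)
  have "polydisc q' (min e e') \<subseteq> polydisc p e"
  proof
    fix s assume s: "s \<in> polydisc q' (min e e')"
    then have ls: "length s = i + d" using lp lq by (auto simp: polydisc_def q'_def)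
    have "cmod (s ! j - p ! j) < e" if j: "j < i + d" for j
    proof (cases "j < i")
      case True
      then show ?thesis using polydisc_nth[OF s, of j] lp lq by (simp add: q'_def nth_append)
    next
      case False
      have "drop i s \<in> polydisc (drop i p) e" using 1[OF s] q by blast
      from polydisc_nth[OF this, of "j - i"] show ?thesis using False j lp ls by simp
    qed
    then show "s \<in> polydisc p e" using ls lp by (simp add: polydisc_def)
  qed
  then show "\<exists>q e'. 0 < e' \<and> polydisc q e' \<subseteq> polydisc p e \<and> (\<forall>s\<in>polydisc q e'. P (drop i s))"
    using 1 q e by (intro exI[of _ q'] exI[of _ "min e e'"]) auto
qed

text \<open>The series is dominated by the product over j of the convergent series of n^(-Re (s !
  j)). Absolute convergence permits any exhaustion of the index set by finite sets, in particular
  the one by \<open>dec_tuples d N\<close>.\<close>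

lemma Li_partial_tendsto_Li_series:
  assumes w: "\<And>x. x \<in> set w \<Longrightarrow> cmod x = 1" and s: "length s = length w" "\<And>j. j < length w \<Longrightarrow> Re (s ! j) > 1"
  shows "(\<lambda>N. Li_partial w s N) \<longlonglongrightarrow> Li_series w s"
proof -
  define d where "d = length w"
  define T where "T = {ns. length ns = length w \<and> sorted_wrt (\<lambda>x y. x > y) ns \<and> (\<forall>n\<in>set ns. 0 < (n::nat))}"
  define t where "t ns = (\<Prod>j<length w. w ! j ^ (ns ! j) / of_nat (ns ! j) powr (s ! j))" for ns :: "nat list"
  define f where "f j n = (if n = 0 then 0 else 1 / real n powr Re (s ! j))" for j and n :: nat
  have fs: "f j summable_on UNIV" if "j < d" for j
  proof (rule norm_summable_imp_summable_on)
    have "summable (\<lambda>n. 1 / real n powr Re (s ! j))"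
      using summable_real_powr_iff[of "- Re (s ! j)"] s(2) that by (simp add: powr_minus_divide d_def)
    then show "summable (\<lambda>n. norm (f j n))"
      by (rule summable_comparison_test'[of _ 0]) (auto simp: f_def)
  qed
  have "(\<lambda>ns. \<Prod>j<d. f j (ns ! j)) summable_on multi_idx d"
    by (rule summable_on_multi_idx_prod) (simp add: f_def, use fs in blast)
  then have "(\<lambda>ns. \<Prod>j<d. f j (ns ! j)) summable_on T"
    by (rule summable_on_subset_banach) (auto simp: T_def multi_idx_def d_def)
  then have "(\<lambda>ns. norm (t ns)) summable_on T"
  proof (rule Infinite_Sum.abs_summable_on_comparison_test')
    fix ns assume ns: "ns \<in> T"
    have "cmod (t ns) = (\<Prod>j<d. cmod (w ! j ^ (ns ! j) / of_nat (ns ! j) powr (s ! j)))"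
      by (simp add: t_def d_def prod_norm)
    also have "\<dots> = (\<Prod>j<d. f j (ns ! j))"
    proof (intro prod.cong refl)
      fix j assume j: "j \<in> {..<d}"
      then have "ns ! j > 0" using ns by (auto simp: T_def d_def)
      then show "cmod (w ! j ^ (ns ! j) / of_nat (ns ! j) powr (s ! j)) = f j (ns ! j)"
        using w[of "w ! j"] j by (simp add: f_def norm_divide norm_power norm_of_nat_powr d_def)
    qed
    finally show "cmod (t ns) \<le> (\<Prod>j<d. f j (ns ! j))" by simp
  qed
  then have "t summable_on T" by (rule abs_summable_summable)
  then have hs: "(t has_sum Li_series w s) T"
    unfolding Li_series_def t_def[abs_def] T_def by (rule has_sum_infsum)
  have sub: "dec_tuples d N \<subseteq> T" for N by (auto simp: dec_tuples_def T_def d_def)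
  have "filterlim (\<lambda>N. dec_tuples d N) (finite_subsets_at_top T) sequentially"
    unfolding filterlim_finite_subsets_at_top
  proof (intro allI impI)
    fix X assume X: "finite X \<and> X \<subseteq> T"
    define N0 where "N0 = Suc (Max (insert 0 (\<Union>ns\<in>X. set ns)))"
    have bd: "n < N0" if "ns \<in> X" "n \<in> set ns" for n ns
      unfolding N0_def less_Suc_eq_le by (rule Max_ge) (use X that in auto)
    have "X \<subseteq> dec_tuples d N" if "N \<ge> N0" for N
    proof
      fix ns assume ns: "ns \<in> X"
      then have "ns \<in> T" using X by blast
      moreover have "\<forall>n\<in>set ns. n < N" using bd[OF ns] that less_le_trans by blast
      ultimately show "ns \<in> dec_tuples d N" by (simp add: dec_tuples_def T_def d_def)
    qed
    then show "\<forall>\<^sub>F N in sequentially. finite (dec_tuples d N) \<and> X \<subseteq> dec_tuples d N \<and> dec_tuples d N \<subseteq> T"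
      using sub finite_dec_tuples unfolding eventually_sequentially by blast
  qed
  from filterlim_compose[OF hs[unfolded has_sum_def] this]
  have "(\<lambda>N. \<Sum>ns\<in>dec_tuples d N. t ns) \<longlonglongrightarrow> Li_series w s" .
  moreover have "(\<Sum>ns\<in>dec_tuples d N. t ns) = Li_partial w s N" for N
    unfolding Li_partial_eq_sum[OF s(1)] t_def d_def by (intro sum.cong prod.cong refl) (simp add: powr_minus_divide)
  ultimately show ?thesis by simp
qed

lemma Li_conv_domI:
  assumes "length s = length w" "\<And>j. j < length w \<Longrightarrow> Re (s ! j) > 1"
  shows "s \<in> Li_conv_dom w"
  unfolding Li_conv_dom_def
proof (intro CollectI conjI ballI)
  fix i assume i: "i \<in> {1..length w}"
  have "real i = (\<Sum>j=1..i. 1)" by simp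
  also have "\<dots> < (\<Sum>j=1..i. Re (s ! (j - 1)))"
    by (rule sum_strict_mono) (use i assms in auto)
  finally show "real i < Re (\<Sum>j=1..i. s ! (j - 1))" by simp
qed (use assms in auto)

text \<open>A meromorphic f is a quotient G / H only locally. On such a polydisc, f Q = g near one
  point makes G Q - g H vanish identically, so the identity spreads over that polydisc.
  Connectedness of the segment from c0 to p carries it to every p in the disc.\<close>

lemma mero_continuation:
  assumes f: "meromorphic d f" and Q: "holo_on (disc0 d K) Q" and g: "holo_on (disc0 d K) g"
    and c0: "c0 \<in> disc0 d K" "e0 > 0" and gen0: "generically (polydisc c0 e0) (\<lambda>s. f s * Q s = g s)"
  shows "generically (disc0 d K) (\<lambda>s. f s * Q s = g s)"
proof -
  define P where "P s \<longleftrightarrow> f s * Q s = g s" for s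
  define A where "A = {p. \<exists>e>0. generically (polydisc p e) P}"
  have loc: "\<exists>e>0. \<forall>p'\<in>polydisc p e. p' \<in> A \<longrightarrow> generically (polydisc p e) P" if p: "p \<in> disc0 d K" for p
  proof -
    obtain e1 where e1: "e1 > 0" "polydisc p e1 \<subseteq> disc0 d K"
      using polydisc_open_polydisc p unfolding polydisc_open_def by blast
    have lp: "length p = d" using polydisc_length[OF p] by simp
    obtain e2 G H where e2: "e2 > 0" "holo_on (polydisc p e2) G" "holo_on (polydisc p e2) H"
      "\<exists>q\<in>polydisc p e2. H q \<noteq> 0" "\<forall>q\<in>polydisc p e2. H q \<noteq> 0 \<longrightarrow> f q = G q / H q"
      using f lp unfolding meromorphic_def by blast
    define e where "e = min e1 e2"
    have e: "e > 0" "polydisc p e \<subseteq> polydisc p e1" "polydisc p e \<subseteq> polydisc p e2"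
      using e1 e2 polydisc_mono[of e e1 p] polydisc_mono[of e e2 p] by (auto simp: e_def)
    have gH: "generically (polydisc p e) (\<lambda>s. H s \<noteq> 0)"
      by (rule generically_subset[OF generically_holo_nonzero[OF e2(3,4)] e(3)])
    have "generically (polydisc p e) P" if p': "p' \<in> polydisc p e" "p' \<in> A" for p'
    proof -
      obtain e3 where e3: "e3 > 0" "generically (polydisc p' e3) P" using p' unfolding A_def by blast
      obtain e4 where e4: "e4 > 0" "polydisc p' e4 \<subseteq> polydisc p e"
        using polydisc_open_polydisc p' unfolding polydisc_open_def by blast
      define \<delta> where "\<delta> = min e3 e4"
      have \<delta>: "\<delta> > 0" "polydisc p' \<delta> \<subseteq> polydisc p' e3" "polydisc p' \<delta> \<subseteq> polydisc p e"
        using e3 e4 polydisc_mono[of \<delta> e3 p'] polydisc_mono[of \<delta> e4 p'] by (auto simp: \<delta>_def)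
      have "generically (polydisc p' \<delta>) (\<lambda>s. P s \<and> H s \<noteq> 0)"
        by (intro generically_conj generically_subset[OF e3(2) \<delta>(2)] generically_subset[OF gH \<delta>(3)])
      then obtain q r where q: "r > 0" "polydisc q r \<subseteq> polydisc p' \<delta>" "\<forall>s\<in>polydisc q r. P s \<and> H s \<noteq> 0"
        unfolding generically_def using \<delta>(1) by blast
      have hol: "holo_on (polydisc p e) (\<lambda>s. G s * Q s - g s * H s)"
        using e e1 e2 Q g by (intro holo_on_diff holo_on_mult) (auto intro: holo_on_subset)
      have z: "G s * Q s - g s * H s = 0" if "s \<in> polydisc p e" for s
      proof (rule holo_on_identity[OF hol _ q(1) _ that])
        show "polydisc q r \<subseteq> polydisc p e" using q \<delta> by blast
        fix s assume s: "s \<in> polydisc q r"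
        then have "f s * Q s = g s" "H s \<noteq> 0" "f s = G s / H s"
          using q \<delta> e e2 unfolding P_def by blast+
        then show "G s * Q s - g s * H s = 0" by (auto simp: field_simps)
      qed
      show ?thesis
      proof (rule generically_mono[OF gH])
        fix s assume s: "s \<in> polydisc p e" "H s \<noteq> 0"
        then have "f s = G s / H s" using e e2 by blast
        then show "P s" using z[OF s(1)] s(2) by (simp add: P_def divide_eq_eq)
      qed
    qed
    with e show ?thesis by blast
  qed
  have "p \<in> A" if p: "p \<in> disc0 d K" for p
  proof -
    define \<gamma> where "\<gamma> u = map (\<lambda>j. of_real (1 - u) * c0 ! j + of_real u * p ! j) [0..<d]" for u
    have \<gamma>D: "\<gamma> u \<in> disc0 d K" if "u \<in> {0..1}" for u
      unfolding disc0_iff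
    proof (intro conjI allI impI)
      fix j assume j: "j < d"
      have "cmod (\<gamma> u ! j) \<le> (1 - u) * cmod (c0 ! j) + u * cmod (p ! j)"
        using that j norm_triangle_ineq[of "of_real (1 - u) * c0 ! j" "of_real u * p ! j"]
        unfolding \<gamma>_def norm_mult norm_of_real by simp
      also have "\<dots> < K"
        using c0 p j that unfolding disc0_iff by (intro convex_bound_lt) auto
      finally show "cmod (\<gamma> u ! j) < K" .
    qed (simp add: \<gamma>_def)
    have ends: "\<gamma> 0 = c0" "\<gamma> 1 = p"
      using c0 p by (auto simp: \<gamma>_def disc0_iff intro!: nth_equalityI)
    have "\<gamma> 1 \<in> A"
    proof (rule connected_induction_simple[where P = "\<lambda>u. \<gamma> u \<in> A" and S = "{0..1::real}" and a = 0])
      show "\<gamma> 0 \<in> A" unfolding A_def ends P_def using c0(2) gen0 by blast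
      fix u :: real assume u: "u \<in> {0..1}"
      obtain e where e: "e > 0" "\<forall>p'\<in>polydisc (\<gamma> u) e. p' \<in> A \<longrightarrow> generically (polydisc (\<gamma> u) e) P"
        using loc[OF \<gamma>D[OF u]] by blast
      \<comment> \<open>Coordinates of points of the disc differ by at most twice the modulus of K,
        so changing the parameter by less than \<delta> moves each coordinate by less than e; the
        summand 1 keeps the denominator positive.\<close>
      define \<delta> where "\<delta> = e / (2 * \<bar>K\<bar> + 1)"
      have \<delta>: "\<delta> > 0" using e by (simp add: \<delta>_def add_nonneg_pos)
      have in_p: "\<gamma> v \<in> polydisc (\<gamma> u) e" if "v \<in> {0..1}" "dist u v < \<delta>" for v
      proof -
        have "cmod (\<gamma> v ! j - \<gamma> u ! j) < e" if j: "j < d" for j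
        proof -
          have "\<gamma> v ! j - \<gamma> u ! j = of_real (v - u) * (p ! j - c0 ! j)"
            using j by (simp add: \<gamma>_def algebra_simps)
          then have "cmod (\<gamma> v ! j - \<gamma> u ! j) = \<bar>v - u\<bar> * cmod (p ! j - c0 ! j)"
            by (simp only: norm_mult norm_of_real)
          also have "\<dots> \<le> \<bar>v - u\<bar> * (2 * \<bar>K\<bar> + 1)"
          proof (rule mult_left_mono)
            have "cmod (p ! j - c0 ! j) \<le> cmod (p ! j) + cmod (c0 ! j)" by (rule norm_triangle_ineq4)
            then show "cmod (p ! j - c0 ! j) \<le> 2 * \<bar>K\<bar> + 1" using p c0 j by (fastforce simp: disc0_iff)
          qed auto
          also have "\<dots> < \<delta> * (2 * \<bar>K\<bar> + 1)"
            using \<open>dist u v < \<delta>\<close> by (intro mult_strict_right_mono) (auto simp: dist_real_def)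
          also have "\<dots> = e" by (simp add: \<delta>_def)
          finally show ?thesis .
        qed
        then show ?thesis by (simp add: polydisc_def \<gamma>_def)
      qed
      show "\<exists>T. openin (top_of_set {0..1}) T \<and> u \<in> T \<and> (\<forall>x\<in>T. \<forall>y\<in>T. \<gamma> x \<in> A \<longrightarrow> \<gamma> y \<in> A)"
      proof (intro exI[of _ "{0..1} \<inter> ball u \<delta>"] conjI ballI impI)
        show "openin (top_of_set {0..1}) ({0..1} \<inter> ball u \<delta>)" by (simp add: openin_open_Int)
        fix x y assume x: "x \<in> {0..1} \<inter> ball u \<delta>" and y: "y \<in> {0..1} \<inter> ball u \<delta>" and "\<gamma> x \<in> A"
        then have G: "generically (polydisc (\<gamma> u) e) P" using e in_p[of x] by auto
        have "\<gamma> y \<in> polydisc (\<gamma> u) e" using in_p[of y] y by auto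
        then obtain e' where "e' > 0" "polydisc (\<gamma> y) e' \<subseteq> polydisc (\<gamma> u) e"
          using polydisc_open_polydisc unfolding polydisc_open_def by blast
        then show "\<gamma> y \<in> A" unfolding A_def using generically_subset[OF G] by blast
      qed (use u \<delta> in auto)
    qed auto
    then show ?thesis by (simp add: ends)
  qed
  then have all: "\<exists>e>0. generically (polydisc p e) P" if "p \<in> disc0 d K" for p
    using that unfolding A_def by blast
  show ?thesis
    unfolding generically_def
  proof (intro allI impI)
    fix p and e :: real assume e: "e > 0" "polydisc p e \<subseteq> disc0 d K"
    then have "p \<in> disc0 d K" by (meson polydisc_center subsetD)
    then obtain e' where e': "e' > 0" "generically (polydisc p e') P" using all by blast
    have "polydisc p (min e e') \<subseteq> polydisc p e'" by (rule polydisc_mono) simp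
    then obtain q r where "r > 0" "polydisc q r \<subseteq> polydisc p (min e e')" "\<forall>s\<in>polydisc q r. P s"
      using e'(2) e(1) e'(1) unfolding generically_def by (metis min_less_iff_conj)
    moreover have "polydisc p (min e e') \<subseteq> polydisc p e" by (rule polydisc_mono) simp
    ultimately show "\<exists>q e'. 0 < e' \<and> polydisc q e' \<subseteq> polydisc p e \<and> (\<forall>s\<in>polydisc q e'. f s * Q s = g s)"
      unfolding P_def by blast
  qed
qed

lemma Li_cont_generically:
  assumes c: "Li_cont K w \<Lambda>" and w: "\<And>x. x \<in> set w \<Longrightarrow> cmod x = 1" and K: "K \<ge> 2"
    and f: "meromorphic (length w) f" "\<And>s. s \<in> Li_conv_dom w \<Longrightarrow> f s = Li_series w s"
  shows "generically (disc0 (length w) K) (\<lambda>s. f s = \<Lambda> s)"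
proof -
  define d where "d = length w"
  have q: "mero_bigo d K 0 (\<lambda>n. \<Lambda>)"
    and lim: "off_form_zeros d K (\<lambda>s. (\<forall>j<d. Re (s ! j) > 1) \<longrightarrow> (\<lambda>N. Li_partial w s N) \<longlonglongrightarrow> \<Lambda> s)"
    using c unfolding Li_cont_def d_def by auto
  obtain Q g C where "mero_bigo_rep d K 0 (\<lambda>n. \<Lambda>) Q g C"
    by (rule mero_bigoE[OF q])
  note Q' = mero_bigo_repD[OF this]
  note Q = Q'(1,3,5)
  define g1 where "g1 = g 1"
  have len: "length s = d" if "s \<in> disc0 d K" for s using that by (simp add: disc0_iff)
  have g1: "holo_on (disc0 d K) g1" "\<And>s. s \<in> disc0 d K \<Longrightarrow> Q s \<noteq> 0 \<Longrightarrow> \<Lambda> s = g1 s / Q s"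
    unfolding g1_def using Q by auto
  \<comment> \<open>Around 3/2 a disc of radius 1/4 has real parts above 1 and moduli below 2 \<le>
    K, so the polydisc lies both in the domain of convergence and in
    \<open>disc0 d K\<close>.\<close>
  define c0 :: "complex list" where "c0 = replicate d (3 / 2)"
  have sub: "polydisc c0 (1/4) \<subseteq> disc0 d K" and re: "\<And>s j. s \<in> polydisc c0 (1/4) \<Longrightarrow> j < d \<Longrightarrow> Re (s ! j) > 1"
  proof -
    show "polydisc c0 (1/4) \<subseteq> disc0 d K"
    proof
      fix s assume s: "s \<in> polydisc c0 (1/4)"
      have "cmod (s ! j) < K" if "j < d" for j
        using polydisc_nth[OF s, of j] that K norm_triangle_ineq2[of "s ! j" "3 / 2"]
        by (simp add: c0_def)
      then show "s \<in> disc0 d K" using polydisc_length[OF s] by (simp add: disc0_iff c0_def)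
    qed
    fix s j assume s: "s \<in> polydisc c0 (1/4)" "j < d"
    show "Re (s ! j) > 1"
      using polydisc_nth[OF s(1), of j] s(2) abs_Re_le_cmod[of "s ! j - 3 / 2"] by (simp add: c0_def)
  qed
  have gQ: "generically (disc0 d K) (\<lambda>s. Q s \<noteq> 0)" by (rule form_product_generically[OF Q(1) len])
  have "generically (polydisc c0 (1/4)) (\<lambda>s. f s * Q s = g1 s)"
  proof (rule generically_mono)
    show "generically (polydisc c0 (1/4)) (\<lambda>s. ((\<forall>j<d. Re (s ! j) > 1) \<longrightarrow> (\<lambda>N. Li_partial w s N) \<longlonglongrightarrow> \<Lambda> s) \<and> Q s \<noteq> 0)"
      by (intro generically_conj generically_subset[OF off_form_zeros_generically[OF lim] sub] generically_subset[OF gQ sub])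
    fix s assume s: "s \<in> polydisc c0 (1/4)"
      and *: "((\<forall>j<d. Re (s ! j) > 1) \<longrightarrow> (\<lambda>N. Li_partial w s N) \<longlonglongrightarrow> \<Lambda> s) \<and> Q s \<noteq> 0"
    have sD: "s \<in> disc0 d K" using s sub by blast
    have 1: "(\<lambda>N. Li_partial w s N) \<longlonglongrightarrow> \<Lambda> s" using * re[OF s] by blast
    have 2: "(\<lambda>N. Li_partial w s N) \<longlonglongrightarrow> Li_series w s"
      by (rule Li_partial_tendsto_Li_series[OF w]) (use len[OF sD] re[OF s] in \<open>auto simp: d_def\<close>)
    have "f s = Li_series w s"
      by (rule f(2), rule Li_conv_domI) (use len[OF sD] re[OF s] in \<open>auto simp: d_def\<close>)
    then have "f s = \<Lambda> s" using LIMSEQ_unique[OF 1 2] by simp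
    then show "f s * Q s = g1 s" using g1(2)[OF sD] * by simp
  qed
  then have "generically (disc0 d K) (\<lambda>s. f s * Q s = g1 s)"
    using sub by (intro mero_continuation[OF f(1)[folded d_def] form_product_holo[OF Q(1) len] g1(1), of c0 "1/4"]) auto
  from generically_conj[OF this gQ] show ?thesis
    unfolding d_def[symmetric]
  proof (rule generically_mono)
    fix s assume s: "s \<in> disc0 d K" and *: "f s * Q s = g1 s \<and> Q s \<noteq> 0"
    then have "f s = g1 s / Q s" by (simp add: eq_divide_eq)
    then show "f s = \<Lambda> s" using g1(2)[OF s] * by simp
  qed
qed

section \<open>Closure properties of meromorphic functions\<close>

lemma meromorphic_drop:
  assumes "meromorphic d f"
  shows "meromorphic (i + d) (\<lambda>s. f (drop i s))"
  unfolding meromorphic_def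
proof (intro allI impI)
  fix p :: "complex list" assume p: "length p = i + d"
  then have "length (drop i p) = d" by simp
  then obtain e g h where e: "e > 0" "holo_on (polydisc (drop i p) e) g" "holo_on (polydisc (drop i p) e) h"
    "\<exists>q\<in>polydisc (drop i p) e. h q \<noteq> 0" "\<forall>q\<in>polydisc (drop i p) e. h q \<noteq> 0 \<longrightarrow> f q = g q / h q"
    using assms unfolding meromorphic_def by blast
  obtain q where q: "q \<in> polydisc (drop i p) e" "h q \<noteq> 0" using e by blast
  have "take i p @ q \<in> polydisc p e"
    unfolding polydisc_def
  proof (intro CollectI conjI allI impI)
    show "length (take i p @ q) = length p" using polydisc_length[OF q(1)] p by simp
    fix j assume j: "j < length p"
    show "cmod ((take i p @ q) ! j - p ! j) < e"
      using polydisc_nth[OF q(1), of "j - i"] p j e(1) by (cases "j < i") (auto simp: nth_append)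
  qed
  moreover have "h (drop i (take i p @ q)) \<noteq> 0" using q p by simp
  ultimately have nz: "\<exists>q\<in>polydisc p e. h (drop i q) \<noteq> 0" by blast
  show "\<exists>e>0. \<exists>g h. holo_on (polydisc p e) g \<and> holo_on (polydisc p e) h \<and>
      (\<exists>q\<in>polydisc p e. h q \<noteq> 0) \<and> (\<forall>q\<in>polydisc p e. h q \<noteq> 0 \<longrightarrow> f (drop i q) = g q / h q)"
  proof (rule exI[of _ e], rule conjI[OF e(1)], rule exI[of _ "\<lambda>s. g (drop i s)"],
      rule exI[of _ "\<lambda>s. h (drop i s)"], intro conjI nz)
  qed (use e in \<open>auto intro: polydisc_drop holo_on_drop\<close>)
qed

text \<open>The product of the two local denominators is not identically 0 because each of them is
  generically nonzero.\<close>

lemma meromorphic_add: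
  assumes "meromorphic d f1" "meromorphic d f2"
  shows "meromorphic d (\<lambda>s. f1 s + f2 s)"
  unfolding meromorphic_def
proof (intro allI impI)
  fix p :: "complex list" assume p: "length p = d"
  obtain e1 g1 h1 where 1: "e1 > 0" "holo_on (polydisc p e1) g1" "holo_on (polydisc p e1) h1"
    "\<exists>q\<in>polydisc p e1. h1 q \<noteq> 0" "\<forall>q\<in>polydisc p e1. h1 q \<noteq> 0 \<longrightarrow> f1 q = g1 q / h1 q"
    using assms(1) p unfolding meromorphic_def by blast
  obtain e2 g2 h2 where 2: "e2 > 0" "holo_on (polydisc p e2) g2" "holo_on (polydisc p e2) h2"
    "\<exists>q\<in>polydisc p e2. h2 q \<noteq> 0" "\<forall>q\<in>polydisc p e2. h2 q \<noteq> 0 \<longrightarrow> f2 q = g2 q / h2 q"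
    using assms(2) p unfolding meromorphic_def by blast
  define e where "e = min e1 e2"
  have e: "e > 0" "polydisc p e \<subseteq> polydisc p e1" "polydisc p e \<subseteq> polydisc p e2"
    using 1(1) 2(1) polydisc_mono[of e e1 p] polydisc_mono[of e e2 p] by (auto simp: e_def)
  have "generically (polydisc p e) (\<lambda>s. h1 s \<noteq> 0 \<and> h2 s \<noteq> 0)"
    by (intro generically_conj generically_subset[OF generically_holo_nonzero[OF 1(3,4)] e(2)] generically_subset[OF generically_holo_nonzero[OF 2(3,4)] e(3)])
  then obtain q r where "r > 0" "polydisc q r \<subseteq> polydisc p e" "\<forall>s\<in>polydisc q r. h1 s \<noteq> 0 \<and> h2 s \<noteq> 0"
    unfolding generically_def using e(1) by blast
  then have nz: "\<exists>q\<in>polydisc p e. h1 q * h2 q \<noteq> 0" using polydisc_center by (meson mult_eq_0_iff subsetD)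
  show "\<exists>e>0. \<exists>g h. holo_on (polydisc p e) g \<and> holo_on (polydisc p e) h \<and>
      (\<exists>q\<in>polydisc p e. h q \<noteq> 0) \<and> (\<forall>q\<in>polydisc p e. h q \<noteq> 0 \<longrightarrow> f1 q + f2 q = g q / h q)"
  proof (rule exI[of _ e], rule conjI[OF e(1)], rule exI[of _ "\<lambda>s. g1 s * h2 s + g2 s * h1 s"],
      rule exI[of _ "\<lambda>s. h1 s * h2 s"], intro conjI nz ballI impI)
    fix q assume q: "q \<in> polydisc p e" "h1 q * h2 q \<noteq> 0"
    then have "f1 q = g1 q / h1 q" "f2 q = g2 q / h2 q" using e 1(5) 2(5) by auto
    then show "f1 q + f2 q = (g1 q * h2 q + g2 q * h1 q) / (h1 q * h2 q)" using q by (simp add: field_simps)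
  qed (use 1 2 e in \<open>auto intro!: holo_on_add holo_on_mult intro: holo_on_subset\<close>)
qed

lemma meromorphic_zero: "meromorphic d (\<lambda>s. 0)"
  unfolding meromorphic_def
proof (intro allI impI)
  fix p :: "complex list"
  show "\<exists>e>0. \<exists>g h. holo_on (polydisc p e) g \<and> holo_on (polydisc p e) h \<and>
      (\<exists>q\<in>polydisc p e. h q \<noteq> 0) \<and> (\<forall>q\<in>polydisc p e. h q \<noteq> 0 \<longrightarrow> 0 = g q / h q)"
    by (rule exI[of _ 1], rule conjI, simp, rule exI[of _ "\<lambda>s. 0"], rule exI[of _ "\<lambda>s. 1"])
       (auto intro: holo_on_const, metis polydisc_center zero_less_one)
qed

lemma meromorphic_sum: "(\<And>i. i \<in> I \<Longrightarrow> meromorphic d (f i)) \<Longrightarrow> meromorphic d (\<lambda>s. \<Sum>i\<in>I. f i s)"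
  by (induction I rule: infinite_finite_induct) (auto intro: meromorphic_zero meromorphic_add)

lemma meromorphic_divide_form_product:
  assumes "meromorphic d f" "form_product d Q"
  shows "meromorphic d (\<lambda>s. f s * (c / Q s))"
  unfolding meromorphic_def
proof (intro allI impI)
  fix p :: "complex list" assume p: "length p = d"
  obtain e g h where 1: "e > 0" "holo_on (polydisc p e) g" "holo_on (polydisc p e) h"
    "\<exists>q\<in>polydisc p e. h q \<noteq> 0" "\<forall>q\<in>polydisc p e. h q \<noteq> 0 \<longrightarrow> f q = g q / h q"
    using assms(1) p unfolding meromorphic_def by blast
  have len: "length s = d" if "s \<in> polydisc p e" for s using polydisc_length[OF that] p by simp
  have Qh: "holo_on (polydisc p e) Q" by (rule form_product_holo[OF assms(2) len])
  have "generically (polydisc p e) (\<lambda>s. h s \<noteq> 0 \<and> Q s \<noteq> 0)"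
    by (intro generically_conj generically_holo_nonzero[OF 1(3,4)] form_product_generically[OF assms(2) len])
  then obtain q r where "r > 0" "polydisc q r \<subseteq> polydisc p e" "\<forall>s\<in>polydisc q r. h s \<noteq> 0 \<and> Q s \<noteq> 0"
    unfolding generically_def using 1(1) by blast
  then have nz: "\<exists>q\<in>polydisc p e. h q * Q q \<noteq> 0" using polydisc_center by (meson mult_eq_0_iff subsetD)
  show "\<exists>e>0. \<exists>g h. holo_on (polydisc p e) g \<and> holo_on (polydisc p e) h \<and>
      (\<exists>q\<in>polydisc p e. h q \<noteq> 0) \<and> (\<forall>q\<in>polydisc p e. h q \<noteq> 0 \<longrightarrow> f q * (c / Q q) = g q / h q)"
  proof (rule exI[of _ e], rule conjI[OF 1(1)], rule exI[of _ "\<lambda>s. g s * c"],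
      rule exI[of _ "\<lambda>s. h s * Q s"], intro conjI nz)
  qed (use 1 Qh in \<open>auto intro!: holo_on_mult holo_on_const\<close>)
qed

lemma meromorphic_cong:
  assumes "meromorphic d f" "\<And>s. length s = d \<Longrightarrow> f s = f' s"
  shows "meromorphic d f'"
  unfolding meromorphic_def
proof (intro allI impI)
  fix p :: "complex list" assume p: "length p = d"
  then obtain e g h where 1: "e > 0" "holo_on (polydisc p e) g" "holo_on (polydisc p e) h"
    "\<exists>q\<in>polydisc p e. h q \<noteq> 0" "\<forall>q\<in>polydisc p e. h q \<noteq> 0 \<longrightarrow> f q = g q / h q"
    using assms(1) unfolding meromorphic_def by blast
  show "\<exists>e>0. \<exists>g h. holo_on (polydisc p e) g \<and> holo_on (polydisc p e) h \<and>
      (\<exists>q\<in>polydisc p e. h q \<noteq> 0) \<and> (\<forall>q\<in>polydisc p e. h q \<noteq> 0 \<longrightarrow> f' q = g q / h q)"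
  proof (rule exI[of _ e], rule conjI[OF 1(1)], rule exI[of _ g], rule exI[of _ h], intro conjI 1(2-4) ballI impI)
    fix q assume "q \<in> polydisc p e" "h q \<noteq> 0"
    then show "f' q = g q / h q" using 1(5) assms(2)[of q] p polydisc_length[of q p e] by simp
  qed
qed

section \<open>Leading factors, the factors H and the index set\<close>

lemma one_divide_diff: "1 / (x - y) = (- 1) / (y - (x::complex))"
proof -
  have "y - x = - (x - y)" by simp
  then show ?thesis by (simp only: minus_divide_divide)
qed

lemma sum_factor_form:
  assumes "1 \<le> i" "i \<le> d"
  shows "\<exists>Q c. form_product d Q \<and> (\<forall>s. sum_factor \<xi> i k s = c / Q s)"
proof (cases "\<xi> = 1")
  case True
  have "form_product d (\<lambda>s. - of_int (k + 1) + (\<Sum>p\<in>{..<i}. s ! p))"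
    by (rule form_product_form) (use assms in \<open>auto simp: lessThan_empty_iff\<close>)
  moreover have "sum_factor \<xi> i k s = (- 1) / (- of_int (k + 1) + (\<Sum>p\<in>{..<i}. s ! p))" for s
    using True one_divide_diff[of "of_int (k + 1)" "prefix_sum i s"] by (simp add: sum_factor_def prefix_sum_def)
  ultimately show ?thesis by blast
next
  case False
  then show ?thesis
    by (intro exI[of _ "\<lambda>s. 1"] exI[of _ "1 / (\<xi> - 1)"]) (auto simp: sum_factor_def intro: form_product.one)
qed

text \<open>Puts the factors of the right-hand side into a shape from which its meromorphy can be
  read off.\<close>

lemma lead_factor_form:
  "i \<le> d \<Longrightarrow> \<exists>Q c. form_product d Q \<and> (\<forall>s. length s = d \<longrightarrow> lead_factor z i s = c / Q s)"
proof (induction i arbitrary: z d)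
  case 0
  show ?case by (intro exI[of _ "\<lambda>s. 1"] exI[of _ 1]) (auto intro: form_product.one)
next
  case (Suc i)
  then obtain d' where d: "d = Suc d'" "i \<le> d'" by (cases d) auto
  obtain Q c where Q: "form_product d' Q" "\<forall>s. length s = d' \<longrightarrow> lead_factor (drop 1 z) i s = c / Q s"
    using Suc.IH[OF d(2)] by blast
  obtain Q' where Q': "form_product d Q'" "\<forall>s. length s = d \<longrightarrow> Q' s = Q (drop 1 s)"
    using form_product_drop[OF Q(1), of 1] d by auto
  obtain Q2 c2 where Q2: "form_product d Q2" "\<forall>s. sum_factor (prefix_prod z (Suc i)) (Suc i) (exp_shift (drop 1 z) i) s = c2 / Q2 s"
    using sum_factor_form[of "Suc i" d "prefix_prod z (Suc i)" "exp_shift (drop 1 z) i"] Suc.prems by auto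
  show ?case
    by (intro exI[of _ "\<lambda>s. Q' s * Q2 s"] exI[of _ "c * c2"] conjI form_product_mult Q' Q2)
       (use Q Q' Q2 d in auto)
qed

lemma zprod_prefix_prod: "1 \<le> j \<Longrightarrow> j \<le> i \<Longrightarrow> i \<le> length z \<Longrightarrow> prefix_prod (drop (j - 1) z) (Suc (i - j)) = zprod z j i"
  unfolding prefix_prod_def zprod_def
  by (rule prod.reindex_bij_witness[of _ "\<lambda>k. k - j" "\<lambda>p. p + j"]) (auto simp: add.commute)

lemma zprod_drop: "zprod (drop (Suc 0) z) j i = zprod z (Suc j) (Suc i)" if "1 \<le> j" "Suc i \<le> length z"
  unfolding zprod_def
  by (rule prod.reindex_bij_witness[of _ "\<lambda>k. k - 1" "\<lambda>k. Suc k"]) (use that in auto)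

lemma exp_shift_unroll: "i \<le> length z \<Longrightarrow> exp_shift z i = (\<Sum>k=1..i. one_ind (zprod z k i))"
proof (induction i arbitrary: z)
  case (Suc i)
  have "exp_shift z (Suc i) = (\<Sum>k=1..i. one_ind (zprod (drop 1 z) k i)) + one_ind (prefix_prod z (Suc i))"
    using Suc by simp
  also have "(\<Sum>k=1..i. one_ind (zprod (drop 1 z) k i)) = (\<Sum>k=1..i. one_ind (zprod z (Suc k) (Suc i)))"
    using Suc.prems by (intro sum.cong) (auto simp: zprod_drop)
  also have "\<dots> = (\<Sum>k=2..Suc i. one_ind (zprod z k (Suc i)))"
    by (rule sum.reindex_bij_witness[of _ "\<lambda>k. k - 1" "\<lambda>k. Suc k"]) auto
  also have "prefix_prod z (Suc i) = zprod z 1 (Suc i)" using zprod_prefix_prod[of 1 "Suc i" z] Suc.prems by simp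
  finally show ?case by (simp add: sum.atLeast_Suc_atMost numeral_2_eq_2)
qed simp

lemma lead_factor_unroll:
  "i \<le> length z \<Longrightarrow> i \<le> length s \<Longrightarrow> lead_factor z i s =
    (\<Prod>j=1..i. sum_factor (zprod z j i) (Suc (i - j)) (exp_shift (drop j z) (i - j)) (drop (j - 1) s))"
proof (induction i arbitrary: z s)
  case (Suc i)
  have "lead_factor (drop 1 z) i (drop 1 s) = (\<Prod>j=1..i. sum_factor (zprod (drop 1 z) j i) (Suc (i - j))
      (exp_shift (drop j (drop 1 z)) (i - j)) (drop (j - 1) (drop 1 s)))"
    using Suc.prems by (intro Suc.IH) auto
  also have "\<dots> = (\<Prod>j=1..i. sum_factor (zprod z (Suc j) (Suc i)) (Suc (Suc i - Suc j))
      (exp_shift (drop (Suc j) z) (Suc i - Suc j)) (drop (Suc j - 1) s))"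
    using Suc.prems by (intro prod.cong) (auto simp: zprod_drop)
  also have "\<dots> = (\<Prod>j=2..Suc i. sum_factor (zprod z j (Suc i)) (Suc (Suc i - j))
      (exp_shift (drop j z) (Suc i - j)) (drop (j - 1) s))"
    by (rule prod.reindex_bij_witness[of _ "\<lambda>k. k - 1" "\<lambda>k. Suc k"]) auto
  finally have "lead_factor z (Suc i) s = sum_factor (zprod z 1 (Suc i)) (Suc i) (exp_shift (drop 1 z) i) s *
     (\<Prod>j=2..Suc i. sum_factor (zprod z j (Suc i)) (Suc (Suc i - j)) (exp_shift (drop j z) (Suc i - j)) (drop (j - 1) s))"
    using zprod_prefix_prod[of 1 "Suc i" z] Suc.prems by (simp add: mult.commute)
  then show ?case by (simp add: prod.atLeast_Suc_atMost numeral_2_eq_2 del: prod.cl_ivl_Suc)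
qed simp

lemma exp_shift_drop:
  assumes "1 \<le> j" "j \<le> i" "i \<le> length z"
  shows "exp_shift (drop j z) (i - j) = (\<Sum>k=Suc j..i. one_ind (zprod z k i))"
proof -
  have "exp_shift (drop j z) (i - j) = (\<Sum>k=1..i-j. one_ind (zprod (drop j z) k (i - j)))"
    by (rule exp_shift_unroll) (use assms in auto)
  also have "\<dots> = (\<Sum>k=Suc j..i. one_ind (zprod z k i))"
  proof (rule sum.reindex_bij_witness[of _ "\<lambda>k. k - j" "\<lambda>k. k + j"])
    fix k assume k: "k \<in> {1..i - j}"
    have "zprod (drop j z) k (i - j) = zprod z (k + j) i"
      unfolding zprod_def
      by (rule prod.reindex_bij_witness[of _ "\<lambda>k. k - j" "\<lambda>k. k + j"])
         (use k assms in \<open>auto simp: add.commute\<close>)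
    then show "one_ind (zprod z (k + j) i) = one_ind (zprod (drop j z) k (i - j))" by simp
  qed auto
  finally show ?thesis .
qed

lemma sum_one_ind: "(\<Sum>k\<in>A. one_ind (f k)) = int (card A) - int (card {k\<in>A. f k \<noteq> 1})" if "finite A" for A :: "nat set"
proof -
  have "(\<Sum>k\<in>A. one_ind (f k)) = (\<Sum>k\<in>A. 1 - (if f k \<noteq> 1 then 1 else 0))"
    by (intro sum.cong) (auto simp: one_ind_def)
  also have "\<dots> = int (card A) - (\<Sum>k\<in>A. if f k \<noteq> 1 then 1 else 0)" by (simp add: sum_subtractf)
  also have "(\<Sum>k\<in>A. if f k \<noteq> 1 then 1 else 0) = int (card {k\<in>A. f k \<noteq> 1})"
    using that by (simp add: sum.If_cases Int_def)
  finally show ?thesis .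
qed

text \<open>In the j-th factor, if \<open>zprod z j i\<close> is 1, the number subtracted from the
  partial sum of s counts the k in {j..i} with trivial \<open>zprod z k i\<close>. At most one k is
  missing, namely t, which accounts for i - j + 1 when j > t and i - j when j < t; j = t gives the
  constant 1 / (\<open>zprod z t i\<close> - 1). Each factor is -1 over the corresponding
  \<open>Hfun\<close>.\<close>

lemma lead_factor_eq_Hfun:
  assumes i: "i \<le> length z" "length s = length z" and c: "card {t\<in>{1..i}. zprod z t i \<noteq> 1} \<le> 1"
  shows "lead_factor z i s = (- 1) ^ i / (\<Prod>j=1..i. Hfun z i j s)"
proof -
  define T where "T = {t\<in>{1..i}. zprod z t i \<noteq> 1}"
  have Tf: "finite T" by (simp add: T_def)
  \<comment> \<open>If all products are trivial, \<open>tidx\<close> is 0, below every j \<ge> 1,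
    and only the last case of \<open>Hfun\<close> arises.\<close>
  have tidx: "T = {tidx z i} \<or> (T = {} \<and> tidx z i = 0)"
  proof (cases "T = {}")
    case True
    then show ?thesis by (auto simp: T_def tidx_def)
  next
    case False
    then have "card T = 1" using c Tf by (fold T_def) (metis card_0_eq le_antisym less_one not_le)
    then obtain t where t: "T = {t}" by (auto simp: card_1_singleton_iff)
    have "(THE t. t \<in> {1..i} \<and> zprod z t i \<noteq> 1) = t"
      by (rule the_equality) (use t in \<open>auto simp: T_def\<close>)
    moreover have "\<exists>t\<in>{1..i}. zprod z t i \<noteq> 1" using t unfolding T_def by blast
    ultimately show ?thesis using t by (simp add: tidx_def)
  qed
  have "sum_factor (zprod z j i) (Suc (i - j)) (exp_shift (drop j z) (i - j)) (drop (j - 1) s) = (- 1) / Hfun z i j s"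
    if j: "j \<in> {1..i}" for j
  proof -
    have prefix_sum: "prefix_sum (Suc (i - j)) (drop (j - 1) s) = (\<Sum>k=j..i. s ! (k - 1))"
      unfolding prefix_sum_def
      by (rule sum.reindex_bij_witness[of _ "\<lambda>k. k - j" "\<lambda>p. p + j"]) (use j i in \<open>auto simp: add.commute\<close>)
    show ?thesis
    proof (cases "zprod z j i = 1")
      case False
      then have "j \<in> T" using j by (simp add: T_def)
      then have "j = tidx z i" using tidx by auto
      then show ?thesis
        using False one_divide_diff[of "zprod z j i" 1] by (simp add: sum_factor_def Hfun_def)
    next
      case True
      have k: "exp_shift (drop j z) (i - j) + 1 = int (Suc (i - j)) - int (card (T \<inter> {j..i}))"
      proof -
        have "exp_shift (drop j z) (i - j) + 1 = (\<Sum>k=j..i. one_ind (zprod z k i))"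
          using j i True by (subst exp_shift_drop) (auto simp: sum.atLeast_Suc_atMost one_ind_def)
        also have "\<dots> = int (card {j..i}) - int (card {k\<in>{j..i}. zprod z k i \<noteq> 1})"
          by (rule sum_one_ind) simp
        also have "{k\<in>{j..i}. zprod z k i \<noteq> 1} = T \<inter> {j..i}" using j by (auto simp: T_def)
        also have "card {j..i} = Suc (i - j)" using j by auto
        finally show ?thesis .
      qed
      have sf: "sum_factor (zprod z j i) (Suc (i - j)) (exp_shift (drop j z) (i - j)) (drop (j - 1) s)
          = (- 1) / ((\<Sum>k=j..i. s ! (k - 1)) - of_int (exp_shift (drop j z) (i - j) + 1))"
        unfolding sum_factor_def prefix_sum using True
          one_divide_diff[of "of_int (exp_shift (drop j z) (i - j) + 1)" "\<Sum>k=j..i. s ! (k - 1)"] by simp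
      have jT: "j \<notin> T" using True by (simp add: T_def)
      consider "j < tidx z i" "T = {tidx z i}" | "\<not> j < tidx z i" "j \<noteq> tidx z i" "T \<inter> {j..i} = {}"
        using tidx jT j by fastforce
      then show ?thesis
      proof cases
        case 1
        then have "tidx z i \<le> i" by (auto simp: T_def)
        then have "T \<inter> {j..i} = {tidx z i}" using 1 by auto
        then have "exp_shift (drop j z) (i - j) + 1 = int (i - j)" using k by simp
        then show ?thesis unfolding sf using 1 by (simp add: Hfun_def)
      next
        case 2
        then have "exp_shift (drop j z) (i - j) + 1 = int (i - j + 1)" using k by simp
        then show ?thesis unfolding sf using 2 by (simp add: Hfun_def)
      qed
    qed
  qed
  then have "lead_factor z i s = (\<Prod>j=1..i. (- 1) / Hfun z i j s)"
    using i by (subst lead_factor_unroll) (auto intro: prod.cong)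
  also have "\<dots> = (- 1) ^ i / (\<Prod>j=1..i. Hfun z i j s)"
    unfolding prod_dividef by simp
  finally show ?thesis .
qed

text \<open>If all \<open>zprod z t i\<close> are 1, comparing consecutive ones gives
  \<open>z ! (j - 1) = 1\<close> for each j \<le> i, and the flag is 0.\<close>

lemma aflag_le_card:
  assumes "i \<le> length z"
  shows "aflag z i \<le> int (card {t\<in>{1..i}. zprod z t i \<noteq> 1})"
proof (cases "{t\<in>{1..i}. zprod z t i \<noteq> 1} = {}")
  case True
  then have all: "zprod z t i = 1" if "t \<in> {1..i}" for t using that by auto
  have "z ! (j - 1) = 1" if j: "j \<in> {1..i}" for j
  proof -
    have "zprod z j i = z ! (j - 1) * zprod z (Suc j) i"
      unfolding zprod_def using j by (subst prod.atLeast_Suc_atMost) auto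
    moreover have "zprod z (Suc j) i = 1"
      by (cases "j = i") (use all[of "Suc j"] j in \<open>auto simp: zprod_def[of _ "Suc i"]\<close>)
    ultimately show ?thesis using all[OF j] by simp
  qed
  then show ?thesis by (simp add: aflag_def)
next
  case False
  then have "card {t\<in>{1..i}. zprod z t i \<noteq> 1} \<ge> 1"
    by (simp add: card_gt_0_iff Suc_leI)
  then show ?thesis by (simp add: aflag_def)
qed

lemma qidx_aflag:
  assumes "i \<in> {1..length z}"
  shows "i < qidx z \<longleftrightarrow> aflag z i = 0"
proof (cases "\<exists>q\<in>{1..length z}. z ! (q - 1) \<noteq> 1")
  case True
  define P where "P q \<longleftrightarrow> 1 \<le> q \<and> q \<le> length z \<and> z ! (q - 1) \<noteq> 1" for q
  have q: "qidx z = (LEAST q. P q)" using True by (simp add: qidx_def P_def)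
  have Pq: "P (qidx z)" unfolding q by (rule LeastI_ex) (use True in \<open>auto simp: P_def\<close>)
  show ?thesis
  proof
    assume "i < qidx z"
    then have "\<not> P j" if "j \<in> {1..i}" for j using that not_less_Least[of j P] q by auto
    then show "aflag z i = 0" using assms by (auto simp: aflag_def P_def)
  next
    assume "aflag z i = 0"
    then have "\<forall>j\<in>{1..i}. z ! (j - 1) = 1" by (auto simp: aflag_def split: if_splits)
    then show "i < qidx z" using Pq by (auto simp: P_def not_le[symmetric])
  qed
next
  case False
  then show ?thesis using assms by (auto simp: qidx_def aflag_def)
qed

text \<open>A point of \<open>U_dom z\<close> within 1 / (length z + 1) of a gives the inequality up
  to an error below 1, and integrality of a removes that error.\<close>

lemma closure_bound:
  assumes "pd_closure (U_dom z) (map of_int a)" "length a = length z" "i \<in> {1..length z}"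
  shows "(\<Sum>j=1..i. a ! (j - 1)) \<ge> int i - aflag z i"
proof -
  define e where "e = 1 / (real (length z) + 1)"
  have e: "e > 0" by (simp add: e_def)
  obtain q where q: "q \<in> U_dom z" "q \<in> polydisc (map of_int a) e"
    using assms(1) e unfolding pd_closure_def by blast
  have 1: "Re (\<Sum>j=1..i. q ! (j - 1)) > real_of_int (int i - aflag z i)"
    using q(1) assms(3) qidx_aflag[OF assms(3)] unfolding U_dom_def
    by (cases "aflag z i = 0") (auto simp: aflag_def not_less split: if_splits)
  have "Re (\<Sum>j=1..i. q ! (j - 1)) \<le> (\<Sum>j=1..i. real_of_int (a ! (j - 1)) + e)"
    unfolding Re_sum
  proof (rule sum_mono)
    fix j assume j: "j \<in> {1..i}"
    then have "cmod (q ! (j - 1) - of_int (a ! (j - 1))) < e"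
      using polydisc_nth[OF q(2), of "j - 1"] assms by auto
    then show "Re (q ! (j - 1)) \<le> real_of_int (a ! (j - 1)) + e"
      using abs_Re_le_cmod[of "q ! (j - 1) - of_int (a ! (j - 1))"] by simp
  qed
  also have "\<dots> = real_of_int (\<Sum>j=1..i. a ! (j - 1)) + real i * e" by (simp add: sum.distrib)
  also have "real i * e < 1" using assms(3) by (simp add: e_def)
  finally have "real_of_int (int i - aflag z i) < real_of_int (\<Sum>j=1..i. a ! (j - 1)) + 1" using 1 by linarith
  then show ?thesis by linarith
qed

text \<open>Let n be the number of nontrivial \<open>zprod z t i\<close>. Then
  \<open>exp_shift z i\<close> = i - n \<le> i - \<open>aflag z i\<close>, which is at most the sum
  of the first i entries of a. Equality throughout forces n = \<open>aflag z i\<close> \<le> 1;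
  these are the cardinality and sum conditions of \<open>Iset\<close>.\<close>

lemma exp_shift_le_sum:
  assumes "pd_closure (U_dom z) (map of_int a)" "length a = length z" "i \<le> length z"
  shows "exp_shift z i \<le> (\<Sum>j=1..i. a ! (j - 1))"
    and "(exp_shift z i = (\<Sum>j=1..i. a ! (j - 1)) \<and> prefix_prod z i = 1) \<longleftrightarrow> i \<in> Iset z a"
proof -
  define n where "n = card {t\<in>{1..i}. zprod z t i \<noteq> 1}"
  have exp_shift: "exp_shift z i = int i - int n"
    unfolding exp_shift_unroll[OF assms(3)] n_def by (subst sum_one_ind) auto
  have 1: "aflag z i \<le> int n" unfolding n_def by (rule aflag_le_card[OF assms(3)])
  have 2: "(\<Sum>j=1..i. a ! (j - 1)) \<ge> int i - aflag z i"
    using closure_bound[OF assms(1,2), of i] assms(3) by (cases "i = 0") (auto simp: aflag_def)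
  show "exp_shift z i \<le> (\<Sum>j=1..i. a ! (j - 1))" using exp_shift 1 2 by linarith
  have prefix_prod: "prefix_prod z i = zprod z 1 i"
    using zprod_prefix_prod[of 1 i z] assms(3) by (cases i) (auto simp: prefix_prod_def zprod_def)
  have af: "aflag z i \<le> 1" by (simp add: aflag_def)
  have n0: "n \<ge> 1 \<Longrightarrow> aflag z i = 1"
  proof -
    assume "n \<ge> 1"
    then obtain t where t: "t \<in> {1..i}" "zprod z t i \<noteq> 1"
      unfolding n_def by (metis (mono_tags, lifting) Collect_empty_eq card.empty not_one_le_zero)
    have "zprod z t i = 1" if "\<forall>j\<in>{1..i}. z ! (j - 1) = 1"
      unfolding zprod_def by (rule prod.neutral) (use that t in auto)
    then have "\<not> (\<forall>j\<in>{1..i}. z ! (j - 1) = 1)" using t by blast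
    then show "aflag z i = 1" by (simp add: aflag_def)
  qed
  have "exp_shift z i = (\<Sum>j=1..i. a ! (j - 1)) \<longleftrightarrow> n \<le> 1 \<and> (\<Sum>j=1..i. a ! (j - 1)) = int i - aflag z i"
  proof
    assume "exp_shift z i = (\<Sum>j=1..i. a ! (j - 1))"
    then show "n \<le> 1 \<and> (\<Sum>j=1..i. a ! (j - 1)) = int i - aflag z i" using exp_shift 1 2 af by linarith
  next
    assume *: "n \<le> 1 \<and> (\<Sum>j=1..i. a ! (j - 1)) = int i - aflag z i"
    then have "int n = aflag z i" using n0 1 by (cases "n = 0") (auto simp: aflag_def split: if_splits)
    then show "exp_shift z i = (\<Sum>j=1..i. a ! (j - 1))" using exp_shift * by simp
  qed
  then show "(exp_shift z i = (\<Sum>j=1..i. a ! (j - 1)) \<and> prefix_prod z i = 1) \<longleftrightarrow> i \<in> Iset z a"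
    using assms(3) unfolding Iset_def prefix_prod n_def by auto
qed

section \<open>The regularised series\<close>

lemma mero_bigo_common_denominator:
  assumes "finite I" "\<And>i. i \<in> I \<Longrightarrow> mero_bigo d K 0 (\<lambda>n. c i)"
  obtains Q g where "form_product d Q" "\<And>i. i \<in> I \<Longrightarrow> holo_on (disc0 d K) (g i)"
    "\<And>i s. i \<in> I \<Longrightarrow> s \<in> disc0 d K \<Longrightarrow> Q s \<noteq> 0 \<Longrightarrow> c i s = g i s / Q s"
    "\<And>i. i \<in> I \<Longrightarrow> \<exists>B. \<forall>s\<in>disc0 d K. cmod (g i s) \<le> B"
proof -
  have "\<exists>Q g. form_product d Q \<and> (\<forall>i\<in>I. holo_on (disc0 d K) (g i) \<and>
      (\<forall>s\<in>disc0 d K. Q s \<noteq> 0 \<longrightarrow> c i s = g i s / Q s) \<and> (\<exists>B. \<forall>s\<in>disc0 d K. cmod (g i s) \<le> B))"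
    using assms
  proof (induction I rule: finite_induct)
    case empty
    then show ?case using form_product.one by blast
  next
    case (insert i I)
    then obtain Q g where Q: "form_product d Q" "\<forall>i\<in>I. holo_on (disc0 d K) (g i) \<and>
      (\<forall>s\<in>disc0 d K. Q s \<noteq> 0 \<longrightarrow> c i s = g i s / Q s) \<and> (\<exists>B. \<forall>s\<in>disc0 d K. cmod (g i s) \<le> B)"
      by auto
    have ci: "mero_bigo d K 0 (\<lambda>n. c i)" using insert.prems by simp
    obtain Q1 g1 C1 where "mero_bigo_rep d K 0 (\<lambda>n. c i) Q1 g1 C1"
      by (rule mero_bigoE[OF ci])
    note 1 = mero_bigo_repD[OF this]
    have len: "length s = d" if "s \<in> disc0 d K" for s using that by (simp add: disc0_iff)
    have Qh: "holo_on (disc0 d K) Q" "holo_on (disc0 d K) Q1"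
      using form_product_holo[OF Q(1) len] form_product_holo[OF 1(1) len] by blast+
    obtain B0 where B0: "B0 \<ge> 0" "\<forall>s\<in>disc0 d K. cmod (Q s) \<le> B0" using form_product_bounded[OF Q(1)] by blast
    obtain B1 where B1: "B1 \<ge> 0" "\<forall>s\<in>disc0 d K. cmod (Q1 s) \<le> B1" using form_product_bounded[OF 1(1)] by blast
    define h where "h j s = (if j = i then g1 1 s * Q s else g j s * Q1 s)" for j s
    have "holo_on (disc0 d K) (h j) \<and> (\<forall>s\<in>disc0 d K. Q s * Q1 s \<noteq> 0 \<longrightarrow> c j s = h j s / (Q s * Q1 s)) \<and>
       (\<exists>B. \<forall>s\<in>disc0 d K. cmod (h j s) \<le> B)" if j: "j \<in> insert i I" for j
    proof (cases "j = i")
      case True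
      have "cmod (g1 1 s * Q s) \<le> C1 * B0" if "s \<in> disc0 d K" for s
        unfolding norm_mult using 1(4)[of 1 s] 1(2) B0 that by (intro mult_mono) auto
      then show ?thesis
        unfolding h_def using True 1(3)[of 1] 1(5)[of 1] Qh by (auto intro!: holo_on_mult)
    next
      case False
      then have jI: "j \<in> I" using j by simp
      then obtain B where B: "\<forall>s\<in>disc0 d K. cmod (g j s) \<le> B" using Q(2) by blast
      have "cmod (g j s * Q1 s) \<le> \<bar>B\<bar> * B1" if "s \<in> disc0 d K" for s
        unfolding norm_mult using B B1 that by (intro mult_mono) (auto intro: order_trans[OF _ abs_ge_self])
      then show ?thesis
        unfolding h_def using False jI Q(2) Qh by (auto intro!: holo_on_mult)
    qed
    then show ?case using form_product_mult[OF Q(1) 1(1)]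
      by (intro exI[of _ "\<lambda>s. Q s * Q1 s"] exI[of _ h]) blast
  qed
  then show ?thesis using that by blast
qed

lemma higher_deriv_npowr:
  assumes "n \<ge> 1"
  shows "(deriv ^^ k) (\<lambda>w. c * of_nat n powr (- w)) = (\<lambda>w. c * (- of_real (ln (real n))) ^ k * of_nat n powr (- w :: complex))"
proof (induction k)
  case (Suc k)
  have "((\<lambda>w. c * (- of_real (ln (real n))) ^ k * of_nat n powr (- w)) has_field_derivative
      c * (- of_real (ln (real n))) ^ Suc k * of_nat n powr (- w)) (at w)" for w
  proof -
    have eq: "(of_nat n :: complex) powr (- v) = exp (- v * of_real (ln (real n)))" for v
      using assms by (simp add: powr_def)
    show ?thesis unfolding eq by (auto intro!: derivative_eq_intros simp: algebra_simps)
  qed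
  then have "deriv (\<lambda>w. c * (- of_real (ln (real n))) ^ k * of_nat n powr (- w)) =
      (\<lambda>w. c * (- of_real (ln (real n))) ^ Suc k * of_nat n powr (- w))"
    by (intro ext DERIV_imp_deriv)
  moreover have "(deriv ^^ Suc k) (\<lambda>w. c * of_nat n powr (- w)) = deriv (\<lambda>w. c * (- of_real (ln (real n))) ^ k * of_nat n powr (- w))"
    by (simp only: funpow.simps o_apply Suc)
  ultimately show ?case by simp
qed simp

lemma dec_tuples_nth: "ns \<in> dec_tuples r N \<Longrightarrow> j < r \<Longrightarrow> ns ! j \<ge> 1"
  by (auto simp: dec_tuples_def Suc_le_eq)

lemma holo_on_Li_partial:
  assumes "\<And>s. s \<in> U \<Longrightarrow> length s = length z" "polydisc_open U"
  shows "holo_on U (\<lambda>s. Li_partial z s N)"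
proof (rule holo_on_cong[OF _ assms(2)])
  show "holo_on U (\<lambda>s. \<Sum>ns\<in>dec_tuples (length z) N. \<Prod>j<length z. z ! j ^ (ns ! j) * of_nat (ns ! j) powr (- (s ! j)))"
    by (intro holo_on_sum holo_on_prod holo_on_mult holo_on_const holo_on_npowr holo_on_uminus holo_on_coord)
       (use assms in \<open>auto intro: dec_tuples_nth[simplified]\<close>)
qed (use Li_partial_eq_sum assms in auto)

text \<open>Each derivative of n^(-s) brings down a factor -ln n. So the weighted sums in
  \<open>reg_partial\<close> are Taylor coefficients of one function, with exactly the signs and
  factorials of \<open>reg_term\<close>.\<close>

lemma taylor_coeff_Li_partial:
  assumes a: "length a = length z" and ks: "length ks = length z"
  shows "taylor_coeff (map of_int a) ks (\<lambda>s. Li_partial z s N) =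
    (- 1) ^ sum_list ks / of_nat (\<Prod>j<length ks. fact (ks ! j)) * reg_partial z a ks N"
proof -
  define \<alpha> :: "complex list" where "\<alpha> = map of_int a"
  have l\<alpha>: "length \<alpha> = length z" using a by (simp add: \<alpha>_def)
  have len: "length s = length z" if "s \<in> polydisc \<alpha> 1" for s using polydisc_length[OF that] l\<alpha> by simp
  define F where "F ns s = (\<Prod>j<length \<alpha>. z ! j ^ (ns ! j) * of_nat (ns ! j) powr (- (s ! j)))" for ns :: "nat list" and s
  have "taylor_coeff \<alpha> ks (\<lambda>s. Li_partial z s N) = taylor_coeff \<alpha> ks (\<lambda>s. \<Sum>ns\<in>dec_tuples (length z) N. F ns s)"
    by (rule taylor_coeff_cong[of 1]) (use len Li_partial_eq_sum l\<alpha> in \<open>auto simp: F_def\<close>)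
  also have "\<dots> = (\<Sum>ns\<in>dec_tuples (length z) N. taylor_coeff \<alpha> ks (F ns))"
  proof (rule taylor_coeff_sum[of 1])
    fix ns assume "ns \<in> dec_tuples (length z) N"
    then show "holo_on (polydisc \<alpha> 1) (F ns)"
      unfolding F_def
      by (intro holo_on_prod holo_on_mult holo_on_const holo_on_npowr holo_on_uminus holo_on_coord)
         (use len l\<alpha> in \<open>auto intro: dec_tuples_nth[simplified]\<close>)
  qed (use ks l\<alpha> in auto)
  also have "\<dots> = (\<Sum>ns\<in>dec_tuples (length z) N. (- 1) ^ sum_list ks / of_nat (\<Prod>j<length ks. fact (ks ! j)) *
     (\<Prod>j<length z. z ! j ^ (ns ! j) * (of_real (ln (real (ns ! j)))) ^ (ks ! j) / (of_nat (ns ! j)) powi (a ! j)))"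
  proof (intro sum.cong refl)
    fix ns assume ns: "ns \<in> dec_tuples (length z) N"
    have n1: "ns ! j \<ge> 1" if "j < length z" for j using dec_tuples_nth[OF ns that] .
    \<comment> \<open>The default base 1 beyond the length makes every \<open>\<phi> j\<close>
      entire, as \<open>taylor_coeff_prod\<close> asks for all j.\<close>
    define \<phi> where "\<phi> j w = z ! j ^ (ns ! j) * of_nat (if j < length z then ns ! j else 1) powr (- w :: complex)" for j w
    have "F ns = (\<lambda>s. \<Prod>j<length \<alpha>. \<phi> j (s ! j))"
      by (intro ext) (simp add: F_def \<phi>_def l\<alpha>)
    moreover have "\<phi> j holomorphic_on UNIV" for j
      unfolding \<phi>_def using n1[of j] by (auto intro!: holomorphic_intros)
    ultimately have "taylor_coeff \<alpha> ks (F ns) = (\<Prod>j<length z. (deriv ^^ (ks ! j)) (\<phi> j) (\<alpha> ! j) / fact (ks ! j))"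
      using taylor_coeff_prod[of \<phi> ks \<alpha>] ks l\<alpha> by simp
    also have "\<dots> = (\<Prod>j<length z. ((- 1) ^ (ks ! j) / fact (ks ! j)) *
       (z ! j ^ (ns ! j) * (of_real (ln (real (ns ! j)))) ^ (ks ! j) / (of_nat (ns ! j)) powi (a ! j)))"
    proof (intro prod.cong refl)
      fix j assume j: "j \<in> {..<length z}"
      have "\<phi> j = (\<lambda>w. z ! j ^ (ns ! j) * of_nat (ns ! j) powr (- w))" using j by (simp add: \<phi>_def[abs_def])
      then have "(deriv ^^ (ks ! j)) (\<phi> j) (\<alpha> ! j) =
         z ! j ^ (ns ! j) * (- of_real (ln (real (ns ! j)))) ^ (ks ! j) * of_nat (ns ! j) powr (- (\<alpha> ! j))"
        using higher_deriv_npowr[OF n1[of j]] j by simp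
      also have "of_nat (ns ! j) powr (- (\<alpha> ! j)) = 1 / (of_nat (ns ! j)) powi (a ! j)"
        using n1[of j] j a by (simp add: \<alpha>_def powr_minus_divide complex_powr_of_int)
      finally show "(deriv ^^ (ks ! j)) (\<phi> j) (\<alpha> ! j) / fact (ks ! j) = ((- 1) ^ (ks ! j) / fact (ks ! j)) *
         (z ! j ^ (ns ! j) * (of_real (ln (real (ns ! j)))) ^ (ks ! j) / (of_nat (ns ! j)) powi (a ! j))"
        by (simp add: power_minus[of "of_real _"] mult_ac)
    qed
    also have "\<dots> = (\<Prod>j<length z. (- 1) ^ (ks ! j) / fact (ks ! j)) *
       (\<Prod>j<length z. z ! j ^ (ns ! j) * (of_real (ln (real (ns ! j)))) ^ (ks ! j) / (of_nat (ns ! j)) powi (a ! j))"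
      by (rule prod.distrib)
    also have "(\<Prod>j<length z. (- 1) ^ (ks ! j) / fact (ks ! j)) = ((- 1) ^ sum_list ks / of_nat (\<Prod>j<length ks. fact (ks ! j)) :: complex)"
      unfolding prod_dividef power_sum_list ks of_nat_prod of_nat_fact ..
    finally show "taylor_coeff \<alpha> ks (F ns) = (- 1) ^ sum_list ks / of_nat (\<Prod>j<length ks. fact (ks ! j)) *
     (\<Prod>j<length z. z ! j ^ (ns ! j) * (of_real (ln (real (ns ! j)))) ^ (ks ! j) / (of_nat (ns ! j)) powi (a ! j))" .
  qed
  also have "\<dots> = (- 1) ^ sum_list ks / of_nat (\<Prod>j<length ks. fact (ks ! j)) * reg_partial z a ks N"
    unfolding reg_partial_def dec_tuples_def sum_distrib_left ..
  finally show ?thesis by (simp add: \<alpha>_def)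
qed

lemma reg_const_decaying:
  assumes "cmod \<xi> = 1" "n0 < 0"
  shows "reg_const z (\<lambda>N. \<xi> ^ N * (of_nat N powr of_int n0 * poly P (- of_real (ln (real N))))) 0"
proof (rule reg_const_null)
  have lp: "(\<lambda>N. ln (real N) ^ l / real N) \<longlonglongrightarrow> 0" for l
  proof -
    have "((\<lambda>x. x ^ l / exp x) \<longlongrightarrow> 0) (at_top :: real filter)" by (rule tendsto_power_div_exp_0)
    from filterlim_compose[OF this filterlim_compose[OF ln_at_top filterlim_real_sequentially]]
    have "(\<lambda>N. ln (real N) ^ l / exp (ln (real N))) \<longlonglongrightarrow> 0" .
    moreover have "\<forall>\<^sub>F N in sequentially. ln (real N) ^ l / exp (ln (real N)) = ln (real N) ^ l / real N"
      using eventually_gt_at_top[of 0] by eventually_elim simp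
    ultimately show ?thesis by (rule Lim_transform_eventually)
  qed
  have "(\<lambda>N. \<Sum>l\<le>degree P. cmod (coeff P l) * \<bar>ln (real N) ^ l / real N\<bar>) \<longlonglongrightarrow> (\<Sum>l\<le>degree P. cmod (coeff P l) * 0)"
    by (intro tendsto_sum tendsto_mult_left tendsto_rabs_zero lp)
  then have "(\<lambda>N. \<Sum>l\<le>degree P. cmod (coeff P l) * \<bar>ln (real N) ^ l / real N\<bar>) \<longlonglongrightarrow> 0" by simp
  then show "(\<lambda>N. \<xi> ^ N * (of_nat N powr of_int n0 * poly P (- of_real (ln (real N))))) \<longlonglongrightarrow> 0"
  proof (rule Lim_null_comparison[rotated])
    show "\<forall>\<^sub>F N in sequentially. cmod (\<xi> ^ N * (of_nat N powr of_int n0 * poly P (- of_real (ln (real N)))))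
        \<le> (\<Sum>l\<le>degree P. cmod (coeff P l) * \<bar>ln (real N) ^ l / real N\<bar>)"
      using eventually_ge_at_top[of 1]
    proof eventually_elim
      case (elim N)
      have "real N powr of_int n0 \<le> real N powr (- 1)"
        using assms elim by (intro powr_mono) auto
      then have p: "cmod (of_nat N powr of_int n0) \<le> 1 / real N"
        using elim by (simp add: norm_of_nat_powr powr_minus_divide)
      have q: "cmod (poly P (- of_real (ln (real N)))) \<le> (\<Sum>l\<le>degree P. cmod (coeff P l) * \<bar>ln (real N) ^ l\<bar>)"
        unfolding poly_altdef
        by (rule order_trans[OF norm_sum]) (simp add: norm_mult norm_power power_abs)
      have "cmod (\<xi> ^ N * (of_nat N powr of_int n0 * poly P (- of_real (ln (real N)))))
          \<le> 1 / real N * (\<Sum>l\<le>degree P. cmod (coeff P l) * \<bar>ln (real N) ^ l\<bar>)"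
      proof -
        have "cmod (of_nat N powr of_int n0) * cmod (poly P (- of_real (ln (real N))))
            \<le> 1 / real N * (\<Sum>l\<le>degree P. cmod (coeff P l) * \<bar>ln (real N) ^ l\<bar>)"
          by (rule mult_mono[OF p q]) auto
        then show ?thesis by (simp only: norm_mult norm_power assms(1) power_one mult_1)
      qed
      also have "\<dots> = (\<Sum>l\<le>degree P. cmod (coeff P l) * \<bar>ln (real N) ^ l / real N\<bar>)"
        by (simp add: sum_distrib_left mult_ac)
      finally show ?case .
    qed
  qed
qed

lemma holo_on_if:
  "holo_on U f \<Longrightarrow> holo_on U g \<Longrightarrow> holo_on U (\<lambda>s. if P then f s else g s)"
  by (cases P) simp_all

lemma holo_prefix_sum_powr:
  assumes "N \<ge> 1" "i \<le> d" "\<And>s. s \<in> U \<Longrightarrow> length s = d"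
  shows "holo_on U (\<lambda>s. of_nat N powr (of_int k - prefix_sum i s))"
  by (intro holo_on_npowr[OF assms(1)] holo_on_diff holo_on_const prefix_sum_holo[OF assms(2,3)])

text \<open>Around \<alpha> the power of N is N^n0 times an exponential with c = -ln N, so the
  coefficient is N^n0 times a polynomial in ln N. For n0 < 0 it tends to 0; for n0 = 0 its constant
  part is the value of the polynomial at 0, which is discarded as oscillating unless \<xi> =
  1.\<close>

lemma reg_const_taylor_coeff_term:
  assumes e: "e > 0" and f: "holo_on (polydisc \<alpha> e) f" and ks: "length ks = length \<alpha>" and i: "i \<le> length \<alpha>"
    and \<xi>: "cmod \<xi> = 1" "\<xi> \<in> monomials z" "finite (monomials z)"
    and k: "of_int k - prefix_sum i \<alpha> = of_int n0" "n0 \<le> 0"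
  shows "reg_const z (\<lambda>N. taylor_coeff \<alpha> ks (\<lambda>s. f s * (osc \<xi> i k N s)))
     (if n0 = 0 \<and> \<xi> = 1 then taylor_coeff \<alpha> ks f else 0)"
proof -
  obtain P where P: "poly P 0 = taylor_coeff \<alpha> ks f"
    "\<And>c. taylor_coeff \<alpha> ks (\<lambda>s. exp (c * (prefix_sum i s - prefix_sum i \<alpha>)) * f s) = poly P c"
    using taylor_coeff_exp_prefix_sum[OF e f ks i] by blast
  have len: "length s = length \<alpha>" if "s \<in> polydisc \<alpha> e" for s using polydisc_length[OF that] .
  have ev: "\<forall>\<^sub>F N in sequentially. \<xi> ^ N * (of_nat N powr of_int n0 * poly P (- of_real (ln (real N))))
      = taylor_coeff \<alpha> ks (\<lambda>s. f s * (osc \<xi> i k N s))"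
    using eventually_ge_at_top[of 1]
  proof eventually_elim
    case (elim N)
    define c where "c = - complex_of_real (ln (real N))"
    have eq: "f s * (osc \<xi> i k N s) =
        (\<xi> ^ N * of_nat N powr of_int n0) * (exp (c * (prefix_sum i s - prefix_sum i \<alpha>)) * f s)" for s
    proof -
      have "of_nat N powr (of_int k - prefix_sum i s) = of_nat N powr (of_int n0 + (prefix_sum i \<alpha> - prefix_sum i s))"
        by (simp add: k(1)[symmetric])
      also have "\<dots> = of_nat N powr of_int n0 * of_nat N powr (prefix_sum i \<alpha> - prefix_sum i s)" by (rule powr_add)
      also have "of_nat N powr (prefix_sum i \<alpha> - prefix_sum i s) = exp (c * (prefix_sum i s - prefix_sum i \<alpha>))"
        using elim by (simp add: powr_def c_def algebra_simps)
      finally show ?thesis by (simp add: mult_ac)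
    qed
    have eh: "holo_on (polydisc \<alpha> e) (\<lambda>s. exp (c * (prefix_sum i s - prefix_sum i \<alpha>)) * f s)"
    proof (rule holo_on_mult[OF holo_on_compose[of _ "\<lambda>s. c * (prefix_sum i s - prefix_sum i \<alpha>)" exp] f])
      show "holo_on (polydisc \<alpha> e) (\<lambda>s. c * (prefix_sum i s - prefix_sum i \<alpha>))"
        by (intro holo_on_mult holo_on_diff holo_on_const prefix_sum_holo[OF i len])
    qed (auto intro!: holomorphic_on_imp_differentiable_at[of _ UNIV] holomorphic_intros)
    show ?case
      unfolding eq taylor_coeff_cmult[OF e eh ks] P(2) by (simp add: c_def mult_ac)
  qed
  have "reg_const z (\<lambda>N. \<xi> ^ N * (of_nat N powr of_int n0 * poly P (- of_real (ln (real N)))))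
     (if n0 = 0 \<and> \<xi> = 1 then taylor_coeff \<alpha> ks f else 0)"
  proof (cases "n0 = 0")
    case True
    have "\<forall>\<^sub>F N in sequentially. \<xi> ^ N * poly P (- of_real (ln (real N)))
       = \<xi> ^ N * (of_nat N powr of_int n0 * poly P (- of_real (ln (real N))))"
      using eventually_gt_at_top[of 0] by eventually_elim (use True in simp)
    from reg_const_cong[OF reg_const_log_poly[OF \<xi>(2,3)] this] show ?thesis
      by (simp only: True P(1) simp_thms)
  next
    case False
    then show ?thesis using reg_const_decaying[OF \<xi>(1), of n0 z P] k(2) by simp
  qed
  from reg_const_cong[OF this ev] show ?thesis .
qed

text \<open>The bounds are exported along with the identity: they give summability and continuity of
  the series, and continuity carries the identity beyond generic points.\<close>

lemma reg_series_eq_generic: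
  assumes za: "length a = length z" and z: "\<forall>x\<in>set z. root_of_unity x"
    and cl: "pd_closure (U_dom z) (map of_int a)"
    and L: "\<And>w. \<forall>x\<in>set w. root_of_unity x \<Longrightarrow>
           meromorphic (length w) (L w) \<and> (\<forall>s\<in>Li_conv_dom w. L w s = Li_series w s)"
  obtains C' R' where "C' \<ge> 0" "R' \<ge> 1"
    "\<And>ks. ks \<in> multi_idx (length z) \<Longrightarrow> cmod ((- 1) ^ sum_list ks / of_nat (\<Prod>j<length ks. fact (ks ! j)) * reg_val z a ks)
        \<le> C' * R' ^ sum_list ks"
    "generically (polydisc (map of_int a) (1 / (2 * R'))) (\<lambda>s. infsum (reg_term z a s) (multi_idx (length z)) = Li_reg_rhs L z a s)"
proof -
  define r where "r = length z"
  define \<alpha> :: "complex list" where "\<alpha> = map of_int a"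
  \<comment> \<open>Large enough for \<open>disc0 r K\<close> to contain the unit polydisc around a,
    and above the 2 that \<open>Li_cont_generically\<close> asks for.\<close>
  define K where "K = 3 + (\<Sum>j<r. \<bar>real_of_int (a ! j)\<bar>)"
  have K: "K \<ge> 3" by (simp add: K_def sum_nonneg)
  have l\<alpha>: "length \<alpha> = r" using za by (simp add: \<alpha>_def r_def)
  have zn: "cmod x = 1" if "x \<in> set z" for x using z that root_of_unity_norm by blast
  have fin: "finite (monomials z)" by (rule finite_monomials[OF z])
  have len: "length s = r" if "s \<in> disc0 r K" for s using that by (simp add: disc0_iff)
  have sub: "polydisc \<alpha> 1 \<subseteq> disc0 r K"
  proof
    fix s assume s: "s \<in> polydisc \<alpha> 1"
    have "cmod (s ! j) < K" if j: "j < r" for j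
    proof -
      have "cmod (s ! j - \<alpha> ! j) < 1" using polydisc_nth[OF s] j l\<alpha> by simp
      moreover have "cmod (\<alpha> ! j) \<le> (\<Sum>j<r. \<bar>real_of_int (a ! j)\<bar>)"
        using j l\<alpha> member_le_sum[of j "{..<r}" "\<lambda>j. \<bar>real_of_int (a ! j)\<bar>"] za by (simp add: \<alpha>_def r_def)
      ultimately show ?thesis using norm_triangle_ineq2[of "s ! j" "\<alpha> ! j"] by (simp add: K_def)
    qed
    then show "s \<in> disc0 r K" using polydisc_length[OF s] l\<alpha> by (simp add: disc0_iff)
  qed
  have pzn: "cmod (prefix_prod z i) = 1" if "i \<le> r" for i using cmod_prefix_prod[OF zn] that by (simp add: r_def)
  obtain Lm X where LX: "\<forall>i\<le>length z. Li_cont K (drop i z) (Lm i) \<and>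
      expansion (length z) K 1 (prefix_prod z i) i (exp_shift z i) (\<lambda>s. Lm i (drop i s) * lead_factor z i s) (X i)"
     "mero_bigo (length z) K 1 (\<lambda>N s. Li_partial z s N - (\<Sum>i\<le>length z. X i N s))"
    using Li_partial_expansion[of K z 1] zn K by auto
  have "\<forall>i\<in>{..r}. \<exists>J c. (\<forall>m. mero_bigo r K 0 (\<lambda>n. c m)) \<and> (\<forall>m>J. c m = (\<lambda>s. 0)) \<and> c 0 = (\<lambda>s. Lm i (drop i s) * lead_factor z i s) \<and>
     mero_bigo r K 1 (\<lambda>N s. X i N s - (\<Sum>m\<le>J. c m s * (osc (prefix_prod z i) i (exp_shift z i - int m) N s)))"
    using LX(1) unfolding r_def expansion_def by blast
  from bchoice[OF this] obtain J where "\<forall>i\<in>{..r}. \<exists>c. (\<forall>m. mero_bigo r K 0 (\<lambda>n. c m)) \<and> (\<forall>m>J i. c m = (\<lambda>s. 0)) \<and> c 0 = (\<lambda>s. Lm i (drop i s) * lead_factor z i s) \<and>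
     mero_bigo r K 1 (\<lambda>N s. X i N s - (\<Sum>m\<le>J i. c m s * (osc (prefix_prod z i) i (exp_shift z i - int m) N s)))"
    by blast
  from bchoice[OF this] obtain c where c: "\<And>i m. i \<le> r \<Longrightarrow> mero_bigo r K 0 (\<lambda>n. c i m)"
    "\<And>i. i \<le> r \<Longrightarrow> c i 0 = (\<lambda>s. Lm i (drop i s) * lead_factor z i s)"
    "\<And>i. i \<le> r \<Longrightarrow> mero_bigo r K 1 (\<lambda>N s. X i N s - (\<Sum>m\<le>J i. c i m s * (osc (prefix_prod z i) i (exp_shift z i - int m) N s)))"
    by blast
  define I where "I = (SIGMA i:{..r}. {..J i})"
  have finI: "finite I" by (simp add: I_def)
  have Ir: "fst x \<le> r" if "x \<in> I" for x using that by (auto simp: I_def)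
  define E where "E x N s = prefix_prod z (fst x) ^ N * of_nat N powr (of_int (exp_shift z (fst x) - int (snd x)) - prefix_sum (fst x) s)"
    for x :: "nat \<times> nat" and N s
  have err: "mero_bigo r K 1 (\<lambda>N s. Li_partial z s N - (\<Sum>x\<in>I. c (fst x) (snd x) s * E x N s))"
  proof (rule mero_bigo_cong)
    show "mero_bigo r K 1 (\<lambda>N s. (Li_partial z s N - (\<Sum>i\<le>r. X i N s)) + (\<Sum>i\<le>r. X i N s -
        (\<Sum>m\<le>J i. c i m s * (osc (prefix_prod z i) i (exp_shift z i - int m) N s))))"
      using LX(2) unfolding r_def[symmetric] by (intro mero_bigo_add mero_bigo_sum c(3)) auto
    fix N :: nat and s
    show "(Li_partial z s N - (\<Sum>i\<le>r. X i N s)) + (\<Sum>i\<le>r. X i N s -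
        (\<Sum>m\<le>J i. c i m s * (osc (prefix_prod z i) i (exp_shift z i - int m) N s)))
      = Li_partial z s N - (\<Sum>x\<in>I. c (fst x) (snd x) s * E x N s)"
      unfolding I_def E_def by (simp add: sum_subtractf sum.Sigma case_prod_unfold)
  qed
  obtain Q g where Q: "form_product r Q" "\<And>x. x \<in> I \<Longrightarrow> holo_on (disc0 r K) (g x)"
    "\<And>x s. x \<in> I \<Longrightarrow> s \<in> disc0 r K \<Longrightarrow> Q s \<noteq> 0 \<Longrightarrow> c (fst x) (snd x) s = g x s / Q s"
    "\<And>x. x \<in> I \<Longrightarrow> \<exists>B. \<forall>s\<in>disc0 r K. cmod (g x s) \<le> B"
    using mero_bigo_common_denominator[OF finI, of r K "\<lambda>x. c (fst x) (snd x)"] c(1) Ir by blast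
  obtain Q0 g0 C0 where "mero_bigo_rep r K 1 (\<lambda>n s. Li_partial z s n - (\<Sum>x\<in>I. c (fst x) (snd x) s * E x n s)) Q0 g0 C0"
    by (rule mero_bigoE[OF err])
  note Q0 = mero_bigo_repD[OF this]
  define Qf where "Qf s = Q s * Q0 s" for s
  have Qf: "form_product r Qf" unfolding Qf_def by (rule form_product_mult[OF Q(1) Q0(1)])
  have Qh: "holo_on (disc0 r K) Q" "holo_on (disc0 r K) Q0" "holo_on (disc0 r K) Qf"
    using form_product_holo[OF Q(1) len] form_product_holo[OF Q0(1) len] form_product_holo[OF Qf len] by blast+
  obtain BQ where BQ: "BQ \<ge> 0" "\<And>s. s \<in> disc0 r K \<Longrightarrow> cmod (Q s) \<le> BQ" using form_product_bounded[OF Q(1)] by metis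
  obtain BQ0 where BQ0: "BQ0 \<ge> 0" "\<And>s. s \<in> disc0 r K \<Longrightarrow> cmod (Q0 s) \<le> BQ0" using form_product_bounded[OF Q0(1)] by metis
  have genQ: "generically (disc0 r K) (\<lambda>s. Qf s \<noteq> 0)" by (rule form_product_generically[OF Qf len])
  have hE: "holo_on (disc0 r K) (\<lambda>s. E x N s)" if "N \<ge> 1" "x \<in> I" for x N
    unfolding E_def by (intro holo_on_mult holo_on_const holo_prefix_sum_powr[OF that(1) Ir[OF that(2)] len])
  have hp: "holo_on (disc0 r K) (\<lambda>s. Li_partial z s N)" for N
    by (rule holo_on_Li_partial[OF _ polydisc_open_polydisc]) (use len in \<open>auto simp: r_def\<close>)
  \<comment> \<open>The identity is clear where \<open>Qf\<close> is nonzero. Both sides are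
    holomorphic, so it extends to the zeros of \<open>Qf\<close>, and \<alpha> may be one of
    them.\<close>
  have expansion: "Qf s * Li_partial z s N = (\<Sum>x\<in>I. (Q0 s * g x s) * E x N s) + Q s * g0 N s"
    if N: "N \<ge> 1" and s: "s \<in> disc0 r K" for N s
  proof -
    have "holo_on (disc0 r K) (\<lambda>s. Qf s * Li_partial z s N - ((\<Sum>x\<in>I. (Q0 s * g x s) * E x N s) + Q s * g0 N s))"
      by (intro holo_on_diff holo_on_mult holo_on_add holo_on_sum Qh hp Q(2) Q0(3) hE N)
    then have "Qf s * Li_partial z s N - ((\<Sum>x\<in>I. (Q0 s * g x s) * E x N s) + Q s * g0 N s) = 0"
    proof (rule holo_on_generically_zero[OF _ generically_mono[OF genQ] s])
      fix s assume s: "s \<in> disc0 r K" and nz: "Qf s \<noteq> 0"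
      then have nz': "Q s \<noteq> 0" "Q0 s \<noteq> 0" by (auto simp: Qf_def)
      have "Li_partial z s N = (\<Sum>x\<in>I. c (fst x) (snd x) s * E x N s) + g0 N s / Q0 s"
        using Q0(5)[OF N s nz'(2)] by (simp add: algebra_simps)
      also have "(\<Sum>x\<in>I. c (fst x) (snd x) s * E x N s) = (\<Sum>x\<in>I. g x s * E x N s) / Q s"
        unfolding sum_divide_distrib by (intro sum.cong) (use Q(3)[OF _ s nz'(1)] in auto)
      finally show "Qf s * Li_partial z s N - ((\<Sum>x\<in>I. (Q0 s * g x s) * E x N s) + Q s * g0 N s) = 0"
        using nz' by (simp add: Qf_def field_simps sum_distrib_left)
    qed
    then show ?thesis by simp
  qed
  \<comment> \<open>The exponent of N at \<alpha> in the term with index x.\<close>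
  define n0 where "n0 x = exp_shift z (fst x) - int (snd x) - (\<Sum>j=1..fst x. a ! (j - 1))" for x :: "nat \<times> nat"
  have n0: "n0 x \<le> 0" if "x \<in> I" for x
    using exp_shift_le_sum(1)[OF cl za, of "fst x"] Ir[OF that] by (simp add: n0_def r_def)
  have prefix_sum\<alpha>: "prefix_sum i \<alpha> = of_int (\<Sum>j=1..i. a ! (j - 1))" if "i \<le> r" for i
  proof -
    have "prefix_sum i \<alpha> = (\<Sum>p<i. of_int (a ! p))"
      unfolding prefix_sum_def by (intro sum.cong) (use that za in \<open>auto simp: \<alpha>_def r_def\<close>)
    also have "\<dots> = (\<Sum>j=1..i. of_int (a ! (j - 1)))"
      by (rule sum.reindex_bij_witness[of _ "\<lambda>j. j - 1" "\<lambda>j. j + 1"]) auto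
    finally show ?thesis by simp
  qed
  \<comment> \<open>The sum of the coefficients of those terms that survive in the constant term at
    \<alpha>; it will turn out to be \<open>Qf\<close> times the right-hand side at generic
    points.\<close>
  define G where "G s = (\<Sum>x\<in>I. if n0 x = 0 \<and> prefix_prod z (fst x) = 1 then Q0 s * g x s else 0)" for s
  have Gh: "holo_on (disc0 r K) G"
    unfolding G_def by (intro holo_on_sum holo_on_if holo_on_mult holo_on_const Qh Q(2))
  obtain BG where BG: "\<And>s. s \<in> disc0 r K \<Longrightarrow> cmod (G s) \<le> BG"
  proof -
    have "\<forall>x\<in>I. \<exists>B. \<forall>s\<in>disc0 r K. cmod (g x s) \<le> B" using Q(4) by blast
    from bchoice[OF this] obtain B where B: "\<And>x s. x \<in> I \<Longrightarrow> s \<in> disc0 r K \<Longrightarrow> cmod (g x s) \<le> B x" by blast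
    have "cmod (G s) \<le> (\<Sum>x\<in>I. BQ0 * \<bar>B x\<bar>)" if "s \<in> disc0 r K" for s
      unfolding G_def
    proof (rule sum_norm_le)
      fix x assume x: "x \<in> I"
      have "cmod (Q0 s * g x s) \<le> BQ0 * \<bar>B x\<bar>"
        unfolding norm_mult using BQ0 B[OF x that] that
        by (intro mult_mono) (auto intro: order_trans[OF _ abs_ge_self])
      then show "cmod (if n0 x = 0 \<and> prefix_prod z (fst x) = 1 then Q0 s * g x s else 0) \<le> BQ0 * \<bar>B x\<bar>"
        using BQ0 by simp
    qed
    then show ?thesis using that by blast
  qed
  have Gh1: "holo_on (polydisc \<alpha> 1) G" by (rule holo_on_subset[OF Gh sub])
  have "\<alpha> \<in> disc0 r K" using sub polydisc_center[of 1 \<alpha>] by auto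
  then have BG0: "BG \<ge> 0" using order_trans[OF norm_ge_zero BG] by blast
  define A where "A ks = taylor_coeff \<alpha> ks G" for ks
  have regA: "reg_const z (\<lambda>N. taylor_coeff \<alpha> ks (\<lambda>s. Qf s * Li_partial z s N)) (A ks)" if ks: "ks \<in> multi_idx r" for ks
  proof -
    have lk: "length ks = length \<alpha>" using ks l\<alpha> by (simp add: multi_idx_def)
    have h1: "holo_on (polydisc \<alpha> 1) (\<lambda>s. Q0 s * g x s)" if "x \<in> I" for x
      by (intro holo_on_mult holo_on_subset[OF Qh(2) sub] holo_on_subset[OF Q(2)[OF that] sub])
    have tm: "reg_const z (\<lambda>N. taylor_coeff \<alpha> ks (\<lambda>s. (Q0 s * g x s) * E x N s))
        (if n0 x = 0 \<and> prefix_prod z (fst x) = 1 then taylor_coeff \<alpha> ks (\<lambda>s. Q0 s * g x s) else 0)" if x: "x \<in> I" for x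
      unfolding E_def
    proof (rule reg_const_taylor_coeff_term[OF zero_less_one h1[OF x] lk])
      show "fst x \<le> length \<alpha>" "cmod (prefix_prod z (fst x)) = 1" "prefix_prod z (fst x) \<in> monomials z"
        using Ir[OF x] l\<alpha> pzn monomial_prefix_prod by (auto simp: r_def)
      show "of_int (exp_shift z (fst x) - int (snd x)) - prefix_sum (fst x) \<alpha> = of_int (n0 x)"
        using prefix_sum\<alpha>[OF Ir[OF x]] by (simp add: n0_def)
    qed (use n0[OF x] fin in auto)
    have tail: "reg_const z (\<lambda>N. taylor_coeff \<alpha> ks (\<lambda>s. Q s * g0 N s)) 0"
    proof (rule reg_const_null)
      \<comment> \<open>The power of 2 comes from Cauchy's estimate with radius 1/2 inside the unit
        polydisc.\<close>
      have "(\<lambda>N. BQ * C0 * 2 ^ sum_list ks * (1 / real N)) \<longlonglongrightarrow> 0"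
        by (intro tendsto_mult_right_zero lim_1_over_n)
      then show "(\<lambda>N. taylor_coeff \<alpha> ks (\<lambda>s. Q s * g0 N s)) \<longlonglongrightarrow> 0"
      proof (rule Lim_null_comparison[rotated])
        show "\<forall>\<^sub>F N in sequentially. cmod (taylor_coeff \<alpha> ks (\<lambda>s. Q s * g0 N s)) \<le> BQ * C0 * 2 ^ sum_list ks * (1 / real N)"
          using eventually_ge_at_top[of 1]
        proof eventually_elim
          case (elim N)
          have "cmod (taylor_coeff \<alpha> ks (\<lambda>s. Q s * g0 N s)) \<le> (BQ * (C0 * real N powr (-1))) / (1/2) ^ sum_list ks"
          proof (rule taylor_coeff_bound[where e = 1])
            show "holo_on (polydisc \<alpha> 1) (\<lambda>s. Q s * g0 N s)"
              by (intro holo_on_mult holo_on_subset[OF Qh(1) sub] holo_on_subset[OF Q0(3)[OF elim] sub])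
            fix s assume "s \<in> polydisc \<alpha> 1"
            then have "s \<in> disc0 r K" using sub by blast
            then show "cmod (Q s * g0 N s) \<le> BQ * (C0 * real N powr (-1))"
              unfolding norm_mult using BQ Q0(4)[OF elim] by (intro mult_mono) auto
          qed (use lk in auto)
          then show ?case using elim by (simp add: powr_minus_divide power_one_over)
        qed
      qed
    qed
    have "reg_const z (\<lambda>N. (\<Sum>x\<in>I. taylor_coeff \<alpha> ks (\<lambda>s. (Q0 s * g x s) * E x N s)) + taylor_coeff \<alpha> ks (\<lambda>s. Q s * g0 N s))
      ((\<Sum>x\<in>I. if n0 x = 0 \<and> prefix_prod z (fst x) = 1 then taylor_coeff \<alpha> ks (\<lambda>s. Q0 s * g x s) else 0) + 0)"
      by (intro reg_const_add reg_const_sum tm tail)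
    moreover have "(\<Sum>x\<in>I. if n0 x = 0 \<and> prefix_prod z (fst x) = 1 then taylor_coeff \<alpha> ks (\<lambda>s. Q0 s * g x s) else 0) = A ks"
    proof -
      have "A ks = (\<Sum>x\<in>I. taylor_coeff \<alpha> ks (\<lambda>s. if n0 x = 0 \<and> prefix_prod z (fst x) = 1 then Q0 s * g x s else 0))"
        unfolding A_def G_def by (intro taylor_coeff_sum[OF zero_less_one _ lk] holo_on_if h1 holo_on_const)
      also have "\<dots> = (\<Sum>x\<in>I. if n0 x = 0 \<and> prefix_prod z (fst x) = 1 then taylor_coeff \<alpha> ks (\<lambda>s. Q0 s * g x s) else 0)"
      proof (intro sum.cong refl)
        fix x
        show "taylor_coeff \<alpha> ks (\<lambda>s. if n0 x = 0 \<and> prefix_prod z (fst x) = 1 then Q0 s * g x s else 0)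
            = (if n0 x = 0 \<and> prefix_prod z (fst x) = 1 then taylor_coeff \<alpha> ks (\<lambda>s. Q0 s * g x s) else 0)"
          by (cases "n0 x = 0 \<and> prefix_prod z (fst x) = 1") (simp_all only: if_True if_False taylor_coeff_zero[OF lk] simp_thms)
      qed
      finally show ?thesis by simp
    qed
    moreover have "\<forall>\<^sub>F N in sequentially. (\<Sum>x\<in>I. taylor_coeff \<alpha> ks (\<lambda>s. (Q0 s * g x s) * E x N s)) + taylor_coeff \<alpha> ks (\<lambda>s. Q s * g0 N s)
        = taylor_coeff \<alpha> ks (\<lambda>s. Qf s * Li_partial z s N)"
      using eventually_ge_at_top[of 1]
    proof eventually_elim
      case (elim N)
      have h2: "holo_on (polydisc \<alpha> 1) (\<lambda>s. (Q0 s * g x s) * E x N s)" if "x \<in> I" for x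
        by (intro holo_on_mult[OF h1[OF that]] holo_on_subset[OF hE[OF elim that] sub])
      have "taylor_coeff \<alpha> ks (\<lambda>s. Qf s * Li_partial z s N) = taylor_coeff \<alpha> ks (\<lambda>s. (\<Sum>x\<in>I. (Q0 s * g x s) * E x N s) + Q s * g0 N s)"
        by (rule taylor_coeff_cong[OF zero_less_one]) (use expansion[OF elim] sub in blast)
      also have "\<dots> = taylor_coeff \<alpha> ks (\<lambda>s. \<Sum>x\<in>I. (Q0 s * g x s) * E x N s) + taylor_coeff \<alpha> ks (\<lambda>s. Q s * g0 N s)"
        by (intro taylor_coeff_add[OF zero_less_one _ _ lk] holo_on_sum h2 holo_on_mult holo_on_subset[OF Qh(1) sub]
            holo_on_subset[OF Q0(3)[OF elim] sub])
      also have "taylor_coeff \<alpha> ks (\<lambda>s. \<Sum>x\<in>I. (Q0 s * g x s) * E x N s) = (\<Sum>x\<in>I. taylor_coeff \<alpha> ks (\<lambda>s. (Q0 s * g x s) * E x N s))"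
        by (intro taylor_coeff_sum[OF zero_less_one _ lk] h2)
      finally show ?case by simp
    qed
    ultimately show ?thesis using reg_const_cong by fastforce
  qed
  have Ab: "cmod (A ks) \<le> BG * 2 ^ sum_list ks" if ks: "ks \<in> multi_idx r" for ks
  proof -
    have "cmod (taylor_coeff \<alpha> ks G) \<le> BG / (1/2) ^ sum_list ks"
      by (rule taylor_coeff_bound[OF Gh1]) (use BG sub ks l\<alpha> in \<open>auto simp: multi_idx_def\<close>)
    then show ?thesis by (simp add: A_def power_one_over)
  qed
  have inc_at: "holo_on (polydisc \<alpha> 1) (\<lambda>s. Li_partial z s N)" for N by (rule holo_on_subset[OF hp sub])
  obtain b C' R' where b: "C' \<ge> 0" "R' \<ge> 1" "\<forall>ks\<in>multi_idx r. reg_const z (\<lambda>N. taylor_coeff \<alpha> ks (\<lambda>s. Li_partial z s N)) (b ks) \<and>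
        cmod (b ks) \<le> C' * R' ^ sum_list ks"
      "\<forall>s S. ((\<lambda>ks. b ks * monomial_at \<alpha> s ks) has_sum S) (multi_idx r) \<longrightarrow>
         ((\<lambda>ks. A ks * monomial_at \<alpha> s ks) has_sum Qf s * S) (multi_idx r)"
    using reg_const_division[where u = "\<lambda>N s. Li_partial z s N" and R = 2 and A = A,
        OF z zero_less_one l\<alpha> inc_at Qf BG0 one_le_numeral regA Ab] by blast
  have bval: "(- 1) ^ sum_list ks / of_nat (\<Prod>j<length ks. fact (ks ! j)) * reg_val z a ks = b ks"
    if ks: "ks \<in> multi_idx r" for ks
  proof -
    have lk: "length ks = length z" using ks by (simp add: multi_idx_def r_def)
    define D where "D = ((- 1) ^ sum_list ks / of_nat (\<Prod>j<length ks. fact (ks ! j)) :: complex)"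
    have D: "D \<noteq> 0" unfolding D_def by simp
    have "reg_const z (\<lambda>N. D * reg_partial z a ks N) (b ks)"
    proof -
      have "reg_const z (\<lambda>N. taylor_coeff \<alpha> ks (\<lambda>s. Li_partial z s N)) (b ks)" using b(3) ks by blast
      then show ?thesis unfolding \<alpha>_def taylor_coeff_Li_partial[OF za lk] D_def .
    qed
    from reg_const_cmult[OF this, of "1 / D"] have "reg_const z (reg_partial z a ks) (b ks / D)" using D by simp
    then have "reg_val z a ks = b ks / D" by (rule reg_val_eqI[OF z])
    then show ?thesis using D by (simp add: D_def)
  qed
  have term_eq: "reg_term z a s ks = b ks * monomial_at \<alpha> s ks" if ks: "ks \<in> multi_idx r" for s ks
  proof -
    have "(\<Prod>j<length ks. (s ! j - of_int (a ! j)) ^ (ks ! j)) = monomial_at \<alpha> s ks"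
      unfolding monomial_at_def by (intro prod.cong) (use ks za in \<open>auto simp: multi_idx_def \<alpha>_def r_def\<close>)
    then show ?thesis unfolding reg_term_def bval[OF ks, symmetric] by simp
  qed
  \<comment> \<open>On this polydisc the bound for the coefficients gives a geometric majorant with
    ratio 1/2.\<close>
  define e where "e = 1 / (2 * R')"
  have e: "e > 0" "e \<le> 1 / 2" using b(2) by (auto simp: e_def divide_le_eq)
  have subP: "polydisc \<alpha> e \<subseteq> polydisc \<alpha> 1" by (rule polydisc_mono) (use e in simp)
  have prod_eq: "Qf s * infsum (reg_term z a s) (multi_idx r) = G s" if s: "s \<in> polydisc \<alpha> e" for s
  proof -
    have sj: "cmod (s ! j - \<alpha> ! j) \<le> e" if "j < length \<alpha>" for j using polydisc_nth[OF s that] by simp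
    have "(\<lambda>ks. b ks * monomial_at \<alpha> s ks) summable_on multi_idx r"
    proof (rule abs_summable_summable, rule Infinite_Sum.abs_summable_on_comparison_test')
      show "(\<lambda>ks. C' * (1/2) ^ sum_list ks) summable_on multi_idx r"
        by (intro summable_on_cmult_right summable_on_multi_idx_geometric) auto
      fix ks assume ks: "ks \<in> multi_idx r"
      have "cmod (b ks * monomial_at \<alpha> s ks) \<le> (C' * R' ^ sum_list ks) * e ^ sum_list ks"
        unfolding norm_mult using b ks sj l\<alpha> by (intro mult_mono monomial_at_bound) (auto simp: multi_idx_def)
      also have "\<dots> = C' * (R' * e) ^ sum_list ks" by (simp add: power_mult_distrib)
      also have "R' * e = 1 / 2" using b(2) by (simp add: e_def)
      finally show "cmod (b ks * monomial_at \<alpha> s ks) \<le> C' * (1/2) ^ sum_list ks" .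
    qed
    then have "((\<lambda>ks. b ks * monomial_at \<alpha> s ks) has_sum infsum (\<lambda>ks. b ks * monomial_at \<alpha> s ks) (multi_idx r)) (multi_idx r)"
      by (rule has_sum_infsum)
    also have "infsum (\<lambda>ks. b ks * monomial_at \<alpha> s ks) (multi_idx r) = infsum (reg_term z a s) (multi_idx r)"
      by (rule infsum_cong) (simp add: term_eq)
    \<comment> \<open>The series with coefficients A is summed in two ways: as \<open>Qf\<close>
      times the regularised series, and as the Taylor series of G.\<close>
    finally have 1: "((\<lambda>ks. A ks * monomial_at \<alpha> s ks) has_sum Qf s * infsum (reg_term z a s) (multi_idx r)) (multi_idx r)"
      using b(4) by blast
    have 2: "((\<lambda>ks. A ks * monomial_at \<alpha> s ks) has_sum G s) (multi_idx r)"
      unfolding A_def l\<alpha>[symmetric]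
      by (rule taylor_coeff_has_sum[OF Gh1, of e "3/4" BG]) (use e BG sub sj polydisc_length[OF s] in auto)
    show ?thesis using has_sum_unique[OF 1 2] .
  qed
  have rou: "\<forall>x\<in>set (drop i z). root_of_unity x" for i using z by (meson in_set_dropD)
  have genL: "generically (disc0 r K) (\<lambda>s. \<forall>i\<in>{..r}. L (drop i z) (drop i s) = Lm i (drop i s))"
  proof (rule generically_ball_finite)
    fix i assume "i \<in> {..r}"
    then have i: "i \<le> r" "i + length (drop i z) = r" by (auto simp: r_def)
    have "generically (disc0 (length (drop i z)) K) (\<lambda>s. L (drop i z) s = Lm i s)"
    proof (rule Li_cont_generically)
      show "Li_cont K (drop i z) (Lm i)" using LX(1) i by (simp add: r_def)
      show "cmod x = 1" if "x \<in> set (drop i z)" for x using zn that by (meson in_set_dropD)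
    qed (use L[OF rou[of i]] K in auto)
    from generically_drop[OF this, of i] show "generically (disc0 r K) (\<lambda>s. L (drop i z) (drop i s) = Lm i (drop i s))"
      unfolding i(2) .
  qed simp
  have "generically (polydisc \<alpha> e) (\<lambda>s. infsum (reg_term z a s) (multi_idx r) = Li_reg_rhs L z a s)"
  proof (rule generically_mono)
    show "generically (polydisc \<alpha> e) (\<lambda>s. (\<forall>i\<in>{..r}. L (drop i z) (drop i s) = Lm i (drop i s)) \<and> Qf s \<noteq> 0)"
      by (rule generically_subset[OF generically_conj[OF genL genQ]]) (use sub subP in blast)
    fix s assume s: "s \<in> polydisc \<alpha> e" and *: "(\<forall>i\<in>{..r}. L (drop i z) (drop i s) = Lm i (drop i s)) \<and> Qf s \<noteq> 0"
    then have sD: "s \<in> disc0 r K" and nz: "Q s \<noteq> 0" "Q0 s \<noteq> 0" using sub subP by (auto simp: Qf_def)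
    have Isub: "Iset z a \<subseteq> {..r}" by (auto simp: Iset_def r_def)
    \<comment> \<open>\<open>n0 x\<close> is the nonpositive difference of \<open>exp_shift\<close>
      and the sum of entries of a, minus m; it is 0 only if m = 0 and that difference
      vanishes.\<close>
    have cond: "n0 x = 0 \<and> prefix_prod z (fst x) = 1 \<longleftrightarrow> snd x = 0 \<and> fst x \<in> Iset z a" if x: "x \<in> I" for x
    proof -
      have i: "fst x \<le> length z" using Ir[OF x] by (simp add: r_def)
      show ?thesis using exp_shift_le_sum[OF cl za i] unfolding n0_def by auto
    qed
    have "G s = (\<Sum>x\<in>I. if snd x = 0 \<and> fst x \<in> Iset z a then Q0 s * g x s else 0)"
      unfolding G_def by (intro sum.cong) (use cond in auto)
    also have "\<dots> = (\<Sum>x\<in>(\<lambda>i. (i, 0)) ` Iset z a. Q0 s * g x s)"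
      using Isub by (intro sum.mono_neutral_cong_right finI) (auto simp: I_def)
    also have "\<dots> = (\<Sum>i\<in>Iset z a. Q0 s * g (i, 0) s)"
      by (subst sum.reindex) (auto simp: inj_on_def)
    also have "\<dots> = (\<Sum>i\<in>Iset z a. Qf s * ((- 1) ^ i * L (drop i z) (drop i s) / (\<Prod>j=1..i. Hfun z i j s)))"
    proof (intro sum.cong refl)
      fix i assume iI: "i \<in> Iset z a"
      then have i: "i \<le> r" "(i, 0) \<in> I" using Isub by (auto simp: I_def)
      have "g (i, 0) s = Q s * c i 0 s" using Q(3)[OF i(2) sD nz(1)] nz by simp
      also have "c i 0 s = Lm i (drop i s) * lead_factor z i s" using c(2)[OF i(1)] by simp
      also have "Lm i (drop i s) = L (drop i z) (drop i s)" using * i by simp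
      also have "lead_factor z i s = (- 1) ^ i / (\<Prod>j=1..i. Hfun z i j s)"
        by (rule lead_factor_eq_Hfun) (use iI len[OF sD] in \<open>auto simp: Iset_def r_def\<close>)
      finally show "Q0 s * g (i, 0) s = Qf s * ((- 1) ^ i * L (drop i z) (drop i s) / (\<Prod>j=1..i. Hfun z i j s))"
        by (simp add: Qf_def)
    qed
    also have "\<dots> = Qf s * Li_reg_rhs L z a s"
      unfolding Li_reg_rhs_def sum_distrib_left ..
    finally have "Qf s * infsum (reg_term z a s) (multi_idx r) = Qf s * Li_reg_rhs L z a s"
      using prod_eq[OF s] by simp
    then show "infsum (reg_term z a s) (multi_idx r) = Li_reg_rhs L z a s" using * by simp
  qed
  with b(1,2,3) bval show ?thesis
    using that[of C' R'] unfolding e_def \<alpha>_def r_def by simp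
qed

lemma meromorphic_rhs:
  assumes z: "\<forall>x\<in>set z. root_of_unity x"
    and L: "\<And>w. \<forall>x\<in>set w. root_of_unity x \<Longrightarrow> meromorphic (length w) (L w)"
  shows "meromorphic (length z) (Li_reg_rhs L z a)"
  unfolding Li_reg_rhs_def
proof (rule meromorphic_sum)
  fix i assume iI: "i \<in> Iset z a"
  then have i: "i \<le> length z" and card: "card {t\<in>{1..i}. zprod z t i \<noteq> 1} \<le> 1" by (auto simp: Iset_def)
  obtain Q c where Q: "form_product (length z) Q" "\<forall>s. length s = length z \<longrightarrow> lead_factor z i s = c / Q s"
    using lead_factor_form[OF i] by blast
  have "\<forall>x\<in>set (drop i z). root_of_unity x" using z by (meson in_set_dropD)
  from meromorphic_drop[OF L[OF this], of i] have "meromorphic (length z) (\<lambda>s. L (drop i z) (drop i s))"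
    using i by simp
  from meromorphic_divide_form_product[OF this Q(1), of c]
  show "meromorphic (length z) (\<lambda>s. (- 1) ^ i * L (drop i z) (drop i s) / (\<Prod>j = 1..i. Hfun z i j s))"
  proof (rule meromorphic_cong)
    fix s :: "complex list" assume s: "length s = length z"
    show "L (drop i z) (drop i s) * (c / Q s) = (- 1) ^ i * L (drop i z) (drop i s) / (\<Prod>j = 1..i. Hfun z i j s)"
      using lead_factor_eq_Hfun[OF i s card] Q(2) s by simp
  qed
qed

section \<open>Gluing the series to the right-hand side\<close>

lemma pdnhds_mono:
  assumes "V \<subseteq> U" shows "pdnhds V p \<le> pdnhds U p"
  unfolding le_filter_def eventually_pdnhds
proof (intro allI impI, elim exE conjE)
  fix P d assume "d > 0" "\<forall>q\<in>U \<inter> polydisc p d. P q"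
  then show "\<exists>d>0. \<forall>q\<in>V \<inter> polydisc p d. P q"
    using assms by (intro exI[of _ d]) auto
qed

text \<open>The extension has to equal the series at every point of the polydisc, whereas f has
  unspecified values at its poles; so F takes its values from B there. Where the local denominator h
  is nonzero, B q = g q / h q follows by continuity from the generic equality of B and f.\<close>

lemma glue_meromorphic:
  assumes rhs: "meromorphic d f" and e: "e > 0" and p: "length p = d"
    and cont: "\<And>q \<epsilon>. q \<in> polydisc p e \<Longrightarrow> \<epsilon> > 0 \<Longrightarrow> \<exists>\<delta>>0. \<forall>s\<in>polydisc q \<delta> \<inter> polydisc p e. cmod (B s - B q) < \<epsilon>"
    and generically: "generically (polydisc p e) (\<lambda>s. B s = f s)"
  defines "F \<equiv> \<lambda>s. if s \<in> polydisc p e then B s else f s"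
  shows "meromorphic d F" "mero_eq d F f"
proof -
  show "meromorphic d F"
    unfolding meromorphic_def
  proof (intro allI impI)
    fix p' :: "complex list" assume "length p' = d"
    then obtain e1 g h where 1: "e1 > 0" "holo_on (polydisc p' e1) g" "holo_on (polydisc p' e1) h"
      "\<exists>q\<in>polydisc p' e1. h q \<noteq> 0" "\<forall>q\<in>polydisc p' e1. h q \<noteq> 0 \<longrightarrow> f q = g q / h q"
      using rhs unfolding meromorphic_def by blast
    have "F q = g q / h q" if q: "q \<in> polydisc p' e1" "h q \<noteq> 0" for q
    proof (cases "q \<in> polydisc p e")
      case False
      then show ?thesis using 1 q by (simp add: F_def)
    next
      case True
      obtain d1 where d1: "d1 > 0" "polydisc q d1 \<subseteq> polydisc p' e1"
        using polydisc_open_polydisc q(1) unfolding polydisc_open_def by blast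
      obtain d2 where d2: "d2 > 0" "polydisc q d2 \<subseteq> polydisc p e"
        using polydisc_open_polydisc True unfolding polydisc_open_def by blast
      have Bc: "(B \<longlongrightarrow> B q) (pdnhds (polydisc p e) q)"
        unfolding tendsto_iff eventually_pdnhds dist_norm using cont[OF True] by (metis Int_commute)
      have mono: "pdnhds (polydisc q (min d1 d2)) q \<le> pdnhds (polydisc p e) q"
        "pdnhds (polydisc q (min d1 d2)) q \<le> pdnhds (polydisc p' e1) q"
        using d1 d2 polydisc_mono[of "min d1 d2" d1 q] polydisc_mono[of "min d1 d2" d2 q]
        by (intro pdnhds_mono; simp)+
      let ?N = "pdnhds (polydisc q (min d1 d2)) q"
      have lim: "((\<lambda>s. B s * h s - g s) \<longlongrightarrow> B q * h q - g q) ?N"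
        by (intro tendsto_diff tendsto_mult tendsto_mono[OF mono(1) Bc]
            tendsto_mono[OF mono(2) holo_onD_tendsto[OF 1(3) q(1)]] tendsto_mono[OF mono(2) holo_onD_tendsto[OF 1(2) q(1)]])
      have limh: "(h \<longlongrightarrow> h q) ?N"
        by (rule tendsto_mono[OF mono(2) holo_onD_tendsto[OF 1(3) q(1)]])
      \<comment> \<open>Otherwise B h - g and h would both be nonzero near q, although B = f = g / h
        at points arbitrarily close to q.\<close>
      have "B q * h q - g q = 0"
      proof (rule ccontr)
        assume nz: "B q * h q - g q \<noteq> 0"
        have "\<forall>\<^sub>F s in ?N. B s * h s - g s \<noteq> 0" "\<forall>\<^sub>F s in ?N. h s \<noteq> 0"
          using tendsto_imp_eventually_ne[OF lim nz] tendsto_imp_eventually_ne[OF limh q(2)] .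
        then have "\<forall>\<^sub>F s in ?N. B s * h s - g s \<noteq> 0 \<and> h s \<noteq> 0" by (rule eventually_conj)
        then obtain \<delta> where \<delta>: "\<delta> > 0"
          "\<forall>s\<in>polydisc q (min d1 d2) \<inter> polydisc q \<delta>. B s * h s - g s \<noteq> 0 \<and> h s \<noteq> 0"
          unfolding eventually_pdnhds by blast
        define \<eta> where "\<eta> = min \<delta> (min d1 d2)"
        have \<eta>: "\<eta> > 0" "polydisc q \<eta> \<subseteq> polydisc q \<delta>" "polydisc q \<eta> \<subseteq> polydisc q (min d1 d2)"
          "polydisc q \<eta> \<subseteq> polydisc q d1" "polydisc q \<eta> \<subseteq> polydisc q d2"
          unfolding \<eta>_def using \<delta> d1 d2 by (auto intro!: polydisc_mono simp del: min.bounded_iff)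
        obtain q' r where q': "r > 0" "polydisc q' r \<subseteq> polydisc q \<eta>" "\<forall>s\<in>polydisc q' r. B s = f s"
          using generically \<eta>(1,5) d2(2) unfolding generically_def by (meson order_trans)
        have "q' \<in> polydisc q \<eta>" using q' by auto
        then have "B q' * h q' - g q' \<noteq> 0" "h q' \<noteq> 0" "f q' = g q' / h q'"
          using \<delta>(2) \<eta> 1(5) d1 by blast+
        moreover have "B q' = f q'" using q' by auto
        ultimately show False by simp
      qed
      then have "B q = g q / h q" using q(2) by (simp add: eq_divide_eq)
      then show ?thesis using True by (simp add: F_def)
    qed
    with 1 show "\<exists>e>0. \<exists>g h. holo_on (polydisc p' e) g \<and> holo_on (polydisc p' e) h \<and>
        (\<exists>q\<in>polydisc p' e. h q \<noteq> 0) \<and> (\<forall>q\<in>polydisc p' e. h q \<noteq> 0 \<longrightarrow> F q = g q / h q)" by blast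
  qed
  show "mero_eq d F f"
    unfolding mero_eq_def
  proof (intro allI impI)
    fix p' :: "complex list" and e' :: real assume "length p' = d" "e' > 0"
    show "\<exists>q\<in>polydisc p' e'. F q = f q"
    proof (cases "p' \<in> polydisc p e")
      case False
      then show ?thesis using \<open>e' > 0\<close> by (intro bexI[of _ p']) (auto simp: F_def)
    next
      case True
      then obtain d1 where d1: "d1 > 0" "polydisc p' d1 \<subseteq> polydisc p e"
        using polydisc_open_polydisc unfolding polydisc_open_def by blast
      define \<eta> where "\<eta> = min d1 e'"
      have \<eta>: "\<eta> > 0" "polydisc p' \<eta> \<subseteq> polydisc p e" "polydisc p' \<eta> \<subseteq> polydisc p' e'"
        using d1 \<open>e' > 0\<close> polydisc_mono[of \<eta> d1 p'] polydisc_mono[of \<eta> e' p'] by (auto simp: \<eta>_def)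
      then obtain q r where q: "r > 0" "polydisc q r \<subseteq> polydisc p' \<eta>" "\<forall>s\<in>polydisc q r. B s = f s"
        using generically unfolding generically_def by blast
      then have "q \<in> polydisc p' \<eta>" "B q = f q" by auto
      then show ?thesis using \<eta> by (intro bexI[of _ q]) (auto simp: F_def)
    qed
  qed
qed

text \<open>With radius 1 / (2 R) the terms are dominated by C / 2^n, where n is the degree, so the
  Weierstrass test makes the series a uniform limit of polynomials.\<close>

lemma power_series_continuous:
  assumes b: "\<And>ks. ks \<in> multi_idx (length p) \<Longrightarrow> cmod (b ks) \<le> C * R ^ sum_list ks"
    and C: "C \<ge> 0" and R: "R \<ge> 1" and q: "q \<in> polydisc p (1 / (2 * R))" and \<epsilon>: "\<epsilon> > 0"
  shows "\<exists>\<delta>>0. \<forall>s\<in>polydisc q \<delta> \<inter> polydisc p (1 / (2 * R)).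
     cmod (infsum (\<lambda>ks. b ks * monomial_at p s ks) (multi_idx (length p)) - infsum (\<lambda>ks. b ks * monomial_at p q ks) (multi_idx (length p))) < \<epsilon>"
proof -
  define U where "U = polydisc p (1 / (2 * R))"
  define S where "S s = infsum (\<lambda>ks. b ks * monomial_at p s ks) (multi_idx (length p))" for s
  have bd: "norm (b ks * monomial_at p s ks) \<le> C * (1/2) ^ sum_list ks" if ks: "ks \<in> multi_idx (length p)" and s: "s \<in> U" for ks s
  proof -
    have "cmod (s ! j - p ! j) \<le> 1 / (2 * R)" if "j < length p" for j
      using polydisc_nth[OF s[unfolded U_def] that] by simp
    then have "cmod (b ks * monomial_at p s ks) \<le> (C * R ^ sum_list ks) * (1 / (2 * R)) ^ sum_list ks"
      unfolding norm_mult using b[OF ks] C R ks by (intro mult_mono monomial_at_bound) (auto simp: multi_idx_def)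
    also have "\<dots> = C * (R * (1 / (2 * R))) ^ sum_list ks" by (simp add: power_mult_distrib del: times_divide_eq_right)
    also have "R * (1 / (2 * R)) = 1 / 2" using R by simp
    finally show ?thesis .
  qed
  have "uniform_limit U (\<lambda>X s. \<Sum>ks\<in>X. b ks * monomial_at p s ks) S (finite_subsets_at_top (multi_idx (length p)))"
    unfolding S_def
    by (rule Weierstrass_m_test_general[OF bd]) (auto intro!: summable_on_cmult_right summable_on_multi_idx_geometric)
  then have "\<forall>\<^sub>F X in finite_subsets_at_top (multi_idx (length p)). \<forall>s\<in>U. dist (\<Sum>ks\<in>X. b ks * monomial_at p s ks) (S s) < \<epsilon> / 3"
    using \<epsilon> by (intro uniform_limitD) auto
  then obtain X where X: "finite X" "X \<subseteq> multi_idx (length p)" "\<And>s. s \<in> U \<Longrightarrow> cmod ((\<Sum>ks\<in>X. b ks * monomial_at p s ks) - S s) < \<epsilon> / 3"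
  proof -
    assume "\<forall>\<^sub>F X in finite_subsets_at_top (multi_idx (length p)). \<forall>s\<in>U. dist (\<Sum>ks\<in>X. b ks * monomial_at p s ks) (S s) < \<epsilon> / 3"
    then obtain X where "finite X" "X \<subseteq> multi_idx (length p)"
      and Y: "\<forall>Y. finite Y \<and> X \<subseteq> Y \<and> Y \<subseteq> multi_idx (length p) \<longrightarrow> (\<forall>s\<in>U. dist (\<Sum>ks\<in>Y. b ks * monomial_at p s ks) (S s) < \<epsilon> / 3)"
      unfolding eventually_finite_subsets_at_top by (elim exE conjE)
    then show ?thesis using that[of X] Y[rule_format, of X] by (simp add: dist_norm)
  qed
  have "holo_on U (\<lambda>s. \<Sum>ks\<in>X. b ks * monomial_at p s ks)"
    unfolding monomial_at_def
  proof (intro holo_on_sum holo_on_mult holo_on_const holo_on_prod)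
    fix ks j assume "ks \<in> X" "j \<in> {..<length ks}"
    then have j: "j < length p" using X(2) by (auto simp: multi_idx_def)
    have "holo_on U (\<lambda>s. s ! j - p ! j)"
      by (intro holo_on_diff holo_on_const holo_on_coord) (use j in \<open>auto simp: U_def dest!: polydisc_length\<close>)
    then show "holo_on U (\<lambda>s. (s ! j - p ! j) ^ (ks ! j))"
      by (rule holo_on_compose) (auto intro!: holomorphic_on_imp_differentiable_at[of _ UNIV] holomorphic_intros)
  qed
  then obtain \<delta> where \<delta>: "\<delta> > 0" "\<forall>s\<in>U \<inter> polydisc q \<delta>. cmod ((\<Sum>ks\<in>X. b ks * monomial_at p s ks) - (\<Sum>ks\<in>X. b ks * monomial_at p q ks)) < \<epsilon> / 3"
    using q \<epsilon> unfolding holo_on_def U_def[symmetric] by (meson divide_pos_pos zero_less_numeral)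
  have "cmod (S s - S q) < \<epsilon>" if s: "s \<in> polydisc q \<delta> \<inter> U" for s
  proof -
    let ?T = "\<lambda>s. \<Sum>ks\<in>X. b ks * monomial_at p s ks"
    have "S s - S q = (?T s - ?T q) - (?T s - S s) + (?T q - S q)" by simp
    then have "cmod (S s - S q) \<le> cmod (?T s - ?T q) + cmod (?T s - S s) + cmod (?T q - S q)"
      by (smt (verit) norm_triangle_ineq norm_triangle_ineq4)
    moreover have "cmod (?T s - ?T q) < \<epsilon> / 3" using \<delta>(2) s by blast
    moreover have "cmod (?T s - S s) < \<epsilon> / 3" "cmod (?T q - S q) < \<epsilon> / 3" using X(3) s q by (auto simp: U_def)
    ultimately show ?thesis by linarith
  qed
  with \<delta>(1) show ?thesis unfolding S_def U_def by blast
qed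

theorem theorem4:
  fixes z :: "complex list" and a :: "int list"
    and L :: "complex list \<Rightarrow> complex list \<Rightarrow> complex"
  assumes "length z \<ge> 1" and "length a = length z"
    and "\<forall>x\<in>set z. root_of_unity x"
    and "pd_closure (U_dom z) (map of_int a)"
    and "\<forall>w. (\<forall>x\<in>set w. root_of_unity x) \<longrightarrow>
           meromorphic (length w) (L w) \<and> (\<forall>s\<in>Li_conv_dom w. L w s = Li_series w s)"
  shows "\<exists>e>0. (\<forall>s\<in>polydisc (map of_int a) e.
                  reg_term z a s summable_on multi_idx (length z)) \<and>
              (\<exists>F. meromorphic (length z) F \<and>
                   (\<forall>s\<in>polydisc (map of_int a) e.
                       F s = infsum (reg_term z a s) (multi_idx (length z))) \<and>
                   mero_eq (length z) F (Li_reg_rhs L z a))"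
proof -
  define \<alpha> :: "complex list" where "\<alpha> = map of_int a"
  have l\<alpha>: "length \<alpha> = length z" using assms(2) by (simp add: \<alpha>_def)
  define b where "b ks = (- 1) ^ sum_list ks / of_nat (\<Prod>j<length ks. fact (ks ! j)) * reg_val z a ks" for ks
  obtain C R where CR: "C \<ge> 0" "R \<ge> 1" "\<And>ks. ks \<in> multi_idx (length z) \<Longrightarrow> cmod (b ks) \<le> C * R ^ sum_list ks"
    "generically (polydisc \<alpha> (1 / (2 * R))) (\<lambda>s. infsum (reg_term z a s) (multi_idx (length z)) = Li_reg_rhs L z a s)"
    unfolding b_def \<alpha>_def
    by (rule reg_series_eq_generic[OF assms(2,3,4), of L]) (use assms(5) in blast)+
  have term_eq: "reg_term z a s ks = b ks * monomial_at \<alpha> s ks" if ks: "ks \<in> multi_idx (length z)" for s ks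
  proof -
    have "(\<Prod>j<length ks. (s ! j - of_int (a ! j)) ^ (ks ! j)) = monomial_at \<alpha> s ks"
      unfolding monomial_at_def by (intro prod.cong) (use ks assms(2) in \<open>auto simp: multi_idx_def \<alpha>_def\<close>)
    then show ?thesis by (simp add: reg_term_def b_def)
  qed
  define e where "e = 1 / (2 * R)"
  have e: "e > 0" using CR(2) by (simp add: e_def)
  have sum: "reg_term z a s summable_on multi_idx (length z)" if s: "s \<in> polydisc \<alpha> e" for s
  proof (rule abs_summable_summable, rule Infinite_Sum.abs_summable_on_comparison_test')
    show "(\<lambda>ks. C * (1/2) ^ sum_list ks) summable_on multi_idx (length z)"
      by (intro summable_on_cmult_right summable_on_multi_idx_geometric) auto
    fix ks assume ks: "ks \<in> multi_idx (length z)"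
    have sj: "cmod (s ! j - \<alpha> ! j) \<le> e" if "j < length \<alpha>" for j using polydisc_nth[OF s that] by simp
    have "cmod (b ks * monomial_at \<alpha> s ks) \<le> (C * R ^ sum_list ks) * e ^ sum_list ks"
      unfolding norm_mult using CR ks sj l\<alpha> by (intro mult_mono monomial_at_bound) (auto simp: multi_idx_def)
    also have "\<dots> = C * (R * e) ^ sum_list ks" by (simp add: power_mult_distrib)
    also have "R * e = 1 / 2" using CR(2) by (simp add: e_def)
    finally show "norm (reg_term z a s ks) \<le> C * (1/2) ^ sum_list ks" unfolding term_eq[OF ks] .
  qed
  define B where "B s = infsum (reg_term z a s) (multi_idx (length z))" for s
  have B_eq: "B s = infsum (\<lambda>ks. b ks * monomial_at \<alpha> s ks) (multi_idx (length \<alpha>))" for s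
    unfolding B_def l\<alpha> by (rule infsum_cong) (simp add: term_eq)
  define F where "F s = (if s \<in> polydisc \<alpha> e then B s else Li_reg_rhs L z a s)" for s
  have cont: "\<exists>\<delta>>0. \<forall>s\<in>polydisc q \<delta> \<inter> polydisc \<alpha> e. cmod (B s - B q) < \<epsilon>"
    if "q \<in> polydisc \<alpha> e" "\<epsilon> > 0" for q \<epsilon>
    unfolding B_eq e_def
    by (rule power_series_continuous) (use CR that l\<alpha> in \<open>auto simp: e_def\<close>)
  have rhs: "meromorphic (length z) (Li_reg_rhs L z a)"
    by (rule meromorphic_rhs[OF assms(3)]) (use assms(5) in blast)
  have "meromorphic (length z) F" "mero_eq (length z) F (Li_reg_rhs L z a)"
    unfolding F_def[abs_def]
    by (rule glue_meromorphic[OF rhs e l\<alpha> cont]; use CR(4) in \<open>simp add: B_def e_def\<close>)+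
  then show ?thesis
    unfolding \<alpha>_def[symmetric] using e sum
    by (intro exI[of _ e] conjI exI[of _ F]) (auto simp: F_def B_def)
qed

end
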